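(* Consider the Markov model (the $\ast$-model, defined in the context) with parameters $\eta\in\mathbb{R}$, $\mathbf{c}>0$, $\boldsymbol{\sigma}>0$. For fixed $T>0$ set $N=\lfloor T/\mathbf{c}\rfloor$ and let $\Omega_N^*=\{\text{particle } j \text{ in the }\ast\text{-model has parent } j-1 \text{ for all } j=1,\dots,N\}$. Set $\sigma_0=\mathbf{c}^{\gamma^*}$ where $$\gamma^*>\frac{\eta+1}{2(\eta-1)}.$$ Then $$\lim_{\mathbf{c}\to0}\ \inf_{0<\boldsymbol{\sigma}<\sigma_0}\mathbb{P}(\Omega_N^* )=1\quad\text{if }\eta>1,$$ $$\lim_{\mathbf{c}\to0}\ \sup_{\boldsymbol{\sigma}>0}\mathbb{P}(\Omega_N^* )=0\quad\text{if }\eta<1.$$ Furthermore, when $\eta>1$ and $\boldsymbol{\sigma}<\sigma_0$, for any $r>1$ and $T<\infty$, with $n(t)=\lfloor t/\mathbf{c}\rfloor$, $$\sup_{t\le T}\ \sup_{\{|z|>r\}}\left|\Phi^*_{n(t)}(z)-e^{i\theta_1^*}f_t(e^{-i\theta_1^*}z)\right|\to0\quad\text{in probability as }\mathbf{c}\to0,$$ and the cluster $K^*_{n(t)}$ converges in the Hausdorff topology to a disk with a slit of logarithmic capacity $t$ attached at position $z=e^{i\theta_1^*}$.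
   Context: Notation. $\Delta=\{z\in\mathbb{C}:|z|>1\}\cup\{\infty\}$, $\mathbb{T}$ is the unit circle, $\overline{\mathbb{D}}$ the closed unit disk. For $t>0$, $f_t:\Delta\to\Delta\setminus(1,1+d(t)]$ is the unique conformal map with $f_t(z)=e^tz+\mathcal{O}(1)$ as $z\to\infty$; $f_0(z)=z$. The slit length $d(t)$ and the logarithmic capacity $t$ are related by $e^t=1+\frac{d(t)^2}{4(1+d(t))}$, i.e. $d(t)=2e^t(1+\sqrt{1-e^{-t}})-2$. The disk with a slit of logarithmic capacity $t$ attached at $e^{i\theta}$ is $\overline{\mathbb{D}}\cup e^{i\theta}(1,1+d(t)]$. The map $f_t$ extends continuously to $\mathbb{T}$, and $\beta_t\in(0,\pi)$ is defined by $f_t^{-1}((1,1+d(t)])=\{e^{i\theta}:|\theta|<\beta_t\}$, so that $f_t(e^{\pm i\beta_t})=1$. The Markov model. Given random angles $\theta_1^*,\theta_2^*,\dots$, set $f_k^*(z)=e^{i\theta_k^*}f_{\mathbf{c}}(e^{-i\theta_k^*}z)$, $\Phi_0^*(z)=z$ and $\Phi_n^*=f_1^*\circ\cdots\circ f_n^*$, which maps $\Delta$ conformally onto the complement of a compact set $K_n^*$ (the cluster). The angle sequence is a Markov chain (angles modulo $2\pi$): $\theta_1^*$ is uniform, and for $k\ge2$, conditionally on $\theta_1^*,\dots,\theta_{k-1}^*$, the angle $\theta_k^*$ has density $$h_k^*(\theta\mid\theta_{k-1}^* )=\frac{1}{Z_{k-1}^*}\left|f'_{\mathbf{c}(k-1)}(e^{\boldsymbol{\sigma}+i(\theta-\theta_{k-1}^*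 )})\right|^{-\eta},\qquad Z_k^*=\int_{-\pi}^{\pi}|f'_{\mathbf{c}k}(e^{\boldsymbol{\sigma}+is})|^{-\eta}\,ds,$$ where $f_{\mathbf{c}(k-1)}$ is the slit map $f_t$ with $t=\mathbf{c}(k-1)$. Parents. Write $\Phi^*_{k,j}=f^*_k\circ\cdots\circ f^*_j$ for $k\le j$. Particle $j$ has parent $0$ if $|\Phi^*_j(e^{i(\theta^*_j\pm\beta_{\mathbf{c}})})|=1$; it has parent $k\ge1$ (for $j>k$) if $e^{-i\theta^*_k}\Phi^*_{k,j}(e^{i(\theta^*_j\pm\beta_{\mathbf{c}})})\in(1,1+d(\mathbf{c})]$.
   Formalization: The sup over all |z|>r is infinite when t is not a multiple of c, since the leading terms e^{c n(t)}z and e^t z differ. Proved instead: the claim with r<|z|<R for every finite R, and the claim over all |z|>r with f_t replaced by the slit map of capacity c n(t). *)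

theory Defs
  imports
    "HOL-Probability.Probability"
    "HOL-Complex_Analysis.Complex_Analysis"
    "HOL-Library.Landau_Symbols"
begin

section \<open>Slit maps\<close>

definition slit_length :: "real \<Rightarrow> real" where
  "slit_length t = 2 * exp t * (1 + sqrt (1 - exp (- t))) - 2"

definition slit :: "real \<Rightarrow> complex set" where
  "slit t = complex_of_real ` {1<..1 + slit_length t}"

text \<open>The exterior disk without the point at infinity; there the maps below fix infinity.\<close>

definition exterior :: "complex set" where
  "exterior = {z. 1 < norm z}"

definition conformal_slit_map :: "real \<Rightarrow> (complex \<Rightarrow> complex) \<Rightarrow> bool" where
  "conformal_slit_map t f \<longleftrightarrow>
     f holomorphic_on exterior \<and> inj_on f exterior \<and> f ` exterior = exterior - slit t \<and>
     (\<lambda>z. f z - complex_of_real (exp t) * z) \<in> O[at_infinity](\<lambda>_. 1)"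

text \<open>
  The value of the slit map on the unit circle is that of its continuous extension. Its value
  inside the open disk is never used and is set to 0, so that the description below is unique.
  For \<open>t = 0\<close> the slit is empty and the map is the identity on \<open>1 \<le> norm z\<close>.
\<close>

definition slit_map :: "real \<Rightarrow> complex \<Rightarrow> complex" where
  "slit_map t = (THE f. conformal_slit_map t f \<and> continuous_on {z. 1 \<le> norm z} f \<and>
                        (\<forall>z. norm z < 1 \<longrightarrow> f z = 0))"

definition slit_angle :: "real \<Rightarrow> real" where
  "slit_angle t = (THE b. 0 < b \<and> b < pi \<and>
     {z. 1 \<le> norm z \<and> slit_map t z \<in> slit t} = {cis x | x. \<bar>x\<bar> < b})"

definition slit_disk :: "real \<Rightarrow> real \<Rightarrow> complex set" where
  "slit_disk t x = cball 0 1 \<union> (\<lambda>z. cis x * z) ` slit t"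


section \<open>Clusters and parents\<close>

text \<open>In this section \<open>\<theta>\<close> is a deterministic angle sequence, indexed from 1.\<close>

definition rotated_slit_map :: "real \<Rightarrow> real \<Rightarrow> complex \<Rightarrow> complex" where
  "rotated_slit_map t x z = cis x * slit_map t (cis (- x) * z)"

text \<open>\<open>f\<^sub>k \<circ> \<cdots> \<circ> f\<^sub>j\<close>; the empty composition (\<open>j < k\<close>) is the identity.\<close>

definition compose_from_to :: "real \<Rightarrow> (nat \<Rightarrow> real) \<Rightarrow> nat \<Rightarrow> nat \<Rightarrow> complex \<Rightarrow> complex" where
  "compose_from_to c \<theta> k j = foldr (\<lambda>i g. rotated_slit_map c (\<theta> i) \<circ> g) [k..<Suc j] id"

definition cluster_map :: "real \<Rightarrow> (nat \<Rightarrow> real) \<Rightarrow> nat \<Rightarrow> complex \<Rightarrow> complex" where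
  "cluster_map c \<theta> n = compose_from_to c \<theta> 1 n"

definition cluster :: "real \<Rightarrow> (nat \<Rightarrow> real) \<Rightarrow> nat \<Rightarrow> complex set" where
  "cluster c \<theta> n = - (cluster_map c \<theta> n ` exterior)"

text \<open>Both base points \<open>\<theta>\<^sub>j \<plusminus> \<beta>\<close> of particle \<open>j\<close> have to lie on the parent.\<close>

definition has_parent :: "real \<Rightarrow> (nat \<Rightarrow> real) \<Rightarrow> nat \<Rightarrow> nat \<Rightarrow> bool" where
  "has_parent c \<theta> j k \<longleftrightarrow> k < j \<and>
     (\<forall>x \<in> {\<theta> j + slit_angle c, \<theta> j - slit_angle c}.
        if k = 0 then norm (cluster_map c \<theta> j (cis x)) = 1
        else cis (- \<theta> k) * compose_from_to c \<theta> k j (cis x) \<in> slit c)"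


section \<open>The Markov model\<close>

definition angle_weight :: "real \<Rightarrow> real \<Rightarrow> real \<Rightarrow> real \<Rightarrow> real" where
  "angle_weight \<eta> \<sigma> t s = norm (deriv (slit_map t) (exp (Complex \<sigma> s))) powr (- \<eta>)"

definition angle_partition :: "real \<Rightarrow> real \<Rightarrow> real \<Rightarrow> real" where
  "angle_partition \<eta> \<sigma> t = (LINT s:{- pi..pi}|lborel. angle_weight \<eta> \<sigma> t s)"

definition angle_density :: "real \<Rightarrow> real \<Rightarrow> real \<Rightarrow> nat \<Rightarrow> real \<Rightarrow> real \<Rightarrow> real" where
  "angle_density \<eta> c \<sigma> k x y =
     angle_weight \<eta> \<sigma> (c * real (k - 1)) (x - y) / angle_partition \<eta> \<sigma> (c * real (k - 1))"

text \<open>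
  Angles modulo \<open>2 * pi\<close> are represented in \<open>{- pi<..pi}\<close>: the distributional assumptions
  put all mass of every \<open>\<theta> k\<close> there. The conditional density of \<open>\<theta> k\<close> is expressed by the
  conditional probabilities given the sigma-algebra generated by \<open>\<theta> 1, \<dots>, \<theta> (k - 1)\<close>.
\<close>

locale markov_slit_model = prob_space M for M :: "'w measure" +
  fixes \<eta> c \<sigma> :: real and \<theta> :: "nat \<Rightarrow> 'w \<Rightarrow> real"
  assumes c_pos: "0 < c" and \<sigma>_pos: "0 < \<sigma>"
    and angle_measurable: "\<And>k. 1 \<le> k \<Longrightarrow> random_variable borel (\<theta> k)"
    and first_angle: "distr M borel (\<theta> 1) = uniform_measure lborel {- pi<..pi}"
    and next_angle: "\<And>k A. 2 \<le> k \<Longrightarrow> A \<in> sets borel \<Longrightarrow>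
      AE \<omega> in M.
        real_cond_exp M
          (vimage_algebra (space M) (\<lambda>\<omega>. \<lambda>i\<in>{1..<k}. \<theta> i \<omega>) (PiM {1..<k} (\<lambda>_. borel)))
          (indicator (\<theta> k -` A \<inter> space M)) \<omega> =
        (LINT x:A \<inter> {- pi<..pi}|lborel. angle_density \<eta> c \<sigma> k x (\<theta> (k - 1) \<omega>))"

definition path_event :: "'w measure \<Rightarrow> real \<Rightarrow> (nat \<Rightarrow> 'w \<Rightarrow> real) \<Rightarrow> nat \<Rightarrow> 'w set" where
  "path_event M c \<theta> N =
     {\<omega> \<in> space M. \<forall>j\<in>{1..N}. has_parent c (\<lambda>i. \<theta> i \<omega>) j (j - 1)}"


section \<open>Modes of convergence\<close>

text \<open>Intended for nonempty sets, as \<open>infdist x {} = 0\<close>.\<close>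

definition hausdorff_dist :: "'a::metric_space set \<Rightarrow> 'a set \<Rightarrow> ennreal" where
  "hausdorff_dist A B =
     sup (SUP a\<in>A. ennreal (infdist a B)) (SUP b\<in>B. ennreal (infdist b A))"

text \<open>
  The variables may live on different probability spaces. Measurability is part of the notion,
  because \<^const>\<open>measure\<close> vanishes on non-measurable sets.
\<close>

definition tendsto_zero_in_probability ::
  "('i \<Rightarrow> 'w measure) \<Rightarrow> ('i \<Rightarrow> 'w \<Rightarrow> ennreal) \<Rightarrow> 'i filter \<Rightarrow> bool" where
  "tendsto_zero_in_probability M X F \<longleftrightarrow>
     (\<forall>\<^sub>F i in F. X i \<in> borel_measurable (M i)) \<and>
     (\<forall>\<epsilon>>0::real.
        ((\<lambda>i. measure (M i) {\<omega> \<in> space (M i). ennreal \<epsilon> < X i \<omega>}) \<longlongrightarrow> 0) F)"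

end

(*
  In the coordinate K(z) = z + 1/z + 2 the slit map f_t becomes multiplication by e^t. Since
  circles and rays are the ellipses and hyperbolas |K| + |K - 4| = const, |K| - |K - 4| = const,
  the geometric properties of f_t (it increases moduli, is largest on the slit direction, and turns
  arguments towards it) are single applications of the triangle inequality.

  Particle j has parent j - 1 iff the j-th angle increment is at most beta_c in absolute value.
  The increments are independent of the past with density proportional to |f'|^(-eta), where
  (z f'/f)^2 = (K - 4)/(K - 4 e^(-t)). For eta < 1 a single increment already has probability
  O(beta_c^(1 - max eta 0)) of being this small. For eta > 1 the probability that some increment
  exceeds x = c^(1/2 + delta) is of order
  sigma^(eta - 1) (c^(-(eta + 1)/2) + c^(-1) x^(1 - eta)), which vanishes for small delta because
  gamma > (eta + 1)/(2 (eta - 1)). By symmetry of the increments the angles then form a random walk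
  of vanishing variance, so all of them stay within epsilon of the first one.

  On that event the cluster map is a small perturbation of f_c iterated n times, which is f_(cn).
  The cluster stays in a sector of opening epsilon of length at most the slit length, and a
  capacity comparison (Schwarz lemma at infinity) forces it to fill that length.
*)
theory Submission
  imports Defs
begin

section \<open>The Koebe coordinate\<close>

definition koebe :: "complex \<Rightarrow> complex" where
  "koebe z = z + 1 / z + 2"

lemma koebe_eq: "z \<noteq> 0 \<Longrightarrow> koebe z = (z + 1)\<^sup>2 / z"
  by (simp add: koebe_def field_simps power2_eq_square)

lemma koebe_minus_4_eq: "z \<noteq> 0 \<Longrightarrow> koebe z - 4 = (z - 1)\<^sup>2 / z"
  by (simp add: koebe_def field_simps power2_eq_square)

lemma norm_koebe: "z \<noteq> 0 \<Longrightarrow> norm (koebe z) = ((norm z)\<^sup>2 + 2 * Re z + 1) / norm z"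
  by (simp add: koebe_eq norm_divide norm_power cmod_power2) (simp add: power2_eq_square algebra_simps)

lemma norm_koebe_minus_4: "z \<noteq> 0 \<Longrightarrow> norm (koebe z - 4) = ((norm z)\<^sup>2 - 2 * Re z + 1) / norm z"
  by (simp add: koebe_minus_4_eq norm_divide norm_power cmod_power2)
     (simp add: power2_eq_square algebra_simps)

text \<open>Circles and rays in the \<open>z\<close>-plane become the ellipses and hyperbolas with foci 0 and 4.\<close>

lemma koebe_ellipse: "z \<noteq> 0 \<Longrightarrow> norm (koebe z) + norm (koebe z - 4) = 2 * (norm z + 1 / norm z)"
  by (simp add: norm_koebe norm_koebe_minus_4 field_simps power2_eq_square)

lemma koebe_hyperbola: "z \<noteq> 0 \<Longrightarrow> norm (koebe z) - norm (koebe z - 4) = 4 * (Re z / norm z)"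
  by (simp add: norm_koebe norm_koebe_minus_4 field_simps power2_eq_square)

lemma koebe_diff: "z \<noteq> 0 \<Longrightarrow> w \<noteq> 0 \<Longrightarrow> koebe z - koebe w = (z - w) * (1 - 1 / (z * w))"
  by (simp add: koebe_def field_simps)

lemma koebe_eq_iff: "z \<noteq> 0 \<Longrightarrow> w \<noteq> 0 \<Longrightarrow> koebe z = koebe w \<longleftrightarrow> z = w \<or> z * w = 1"
proof -
  assume "z \<noteq> 0" "w \<noteq> 0"
  then have "koebe z = koebe w \<longleftrightarrow> (z - w) * (1 - 1 / (z * w)) = 0"
    using koebe_diff[of z w] by (metis right_minus_eq)
  also have "\<dots> \<longleftrightarrow> z = w \<or> z * w = 1"
    using \<open>z \<noteq> 0\<close> \<open>w \<noteq> 0\<close> unfolding mult_eq_0_iff right_minus_eq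
    by (simp add: eq_divide_eq)
  finally show ?thesis .
qed

lemma add_inverse_mono:
  fixes x y :: real
  assumes "1 \<le> x" "x \<le> y"
  shows "x + 1 / x \<le> y + 1 / y"
proof -
  have "(y + 1 / y) - (x + 1 / x) = (y - x) * (1 - 1 / (x * y))"
    using assms by (simp add: field_simps)
  moreover have "1 * 1 \<le> x * y" using assms by (intro mult_mono) auto
  then have "0 \<le> (y - x) * (1 - 1 / (x * y))" using assms by (intro mult_nonneg_nonneg) auto
  ultimately show ?thesis by simp
qed

lemma add_inverse_le_imp_le:
  fixes x y :: real
  assumes "0 < x" "1 \<le> y" "x + 1 / x \<le> y + 1 / y"
  shows "x \<le> y"
proof (rule ccontr)
  assume "\<not> x \<le> y"
  then have "y < x" by simp
  have "(x + 1 / x) - (y + 1 / y) = (x - y) * (1 - 1 / (x * y))"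
    using assms by (simp add: field_simps)
  moreover have "x * 1 \<le> x * y" using assms by (intro mult_left_mono) auto
  then have "1 < x * y" using assms \<open>y < x\<close> by linarith
  then have "0 < (x - y) * (1 - 1 / (x * y))" using \<open>y < x\<close> by (intro mult_pos_pos) auto
  ultimately show False using assms by linarith
qed

lemma add_inverse_ge_2: "0 < (x::real) \<Longrightarrow> 2 \<le> x + 1 / x"
proof -
  assume x: "0 < x"
  have "0 \<le> (x - 1)\<^sup>2 / x" using x by simp
  also have "\<dots> = x + 1 / x - 2" using x by (simp add: field_simps power2_eq_square)
  finally show ?thesis by simp
qed

lemma koebe_of_circle:
  assumes "norm z = 1" shows "koebe z = of_real (2 + 2 * Re z)"
proof -
  have "1 / z = cnj z" using assms complex_norm_square[of z]
    by (metis divide_eq_eq mult.commute norm_zero of_real_1 one_power2 zero_neq_one)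
  then show ?thesis by (simp add: koebe_def complex_eq_iff)
qed

lemma koebe_of_cis: "koebe (cis x) = of_real (4 * (cos (x / 2))\<^sup>2)"
proof -
  have "cos x = 2 * (cos (x / 2))\<^sup>2 - 1" using cos_double_cos[of "x/2"] by simp
  then show ?thesis by (simp add: koebe_of_circle)
qed

lemma norm_eq_1_if_koebe_mem:
  assumes z: "1 \<le> norm z" and k: "koebe z = of_real x" "0 \<le> x" "x \<le> 4"
  shows "norm z = 1"
proof -
  have "z \<noteq> 0" using z by auto
  have "2 * (norm z + 1 / norm z) = 4"
  proof -
    have "koebe z - 4 = of_real (x - 4)" by (simp add: k)
    then have "norm (koebe z - 4) = 4 - x" using k(3) by (simp only: norm_of_real)
    moreover have "norm (koebe z) = x" using k by simp
    ultimately show ?thesis using koebe_ellipse[OF \<open>z \<noteq> 0\<close>] by simp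
  qed
  moreover have "0 < norm z" using z by linarith
  ultimately have "norm z \<le> 1" using add_inverse_le_imp_le[of "norm z" 1] by argo
  then show ?thesis using z by simp
qed

lemma ex_koebe_preimage:
  obtains z where "1 \<le> norm z" "koebe z = v"
proof -
  define s where "s = csqrt ((v - 2)\<^sup>2 / 4 - 1)"
  define p where "p = (v - 2) / 2 + s"
  define q where "q = (v - 2) / 2 - s"
  have "s\<^sup>2 = (v - 2)\<^sup>2 / 4 - 1" by (simp add: s_def)
  then have pq: "p * q = 1" by (simp add: p_def q_def power2_eq_square field_simps)
  have sum: "p + q = v - 2" by (simp add: p_def q_def)
  have "p \<noteq> 0" "q \<noteq> 0" using pq by auto
  have K: "koebe p = v" "koebe q = v"
  proof -
    have "1 / p = q" "1 / q = p" using pq \<open>p \<noteq> 0\<close> \<open>q \<noteq> 0\<close> by (auto simp: field_simps)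
    then show "koebe p = v" "koebe q = v" using sum by (auto simp: koebe_def algebra_simps)
  qed
  have "norm p * norm q = 1" using pq by (metis norm_mult norm_one)
  then have "1 \<le> norm p \<or> 1 \<le> norm q"
    using mult_strict_mono'[of "norm p" 1 "norm q" 1] by fastforce
  then show ?thesis using K that by blast
qed

lemma one_plus_slit_length:
  assumes "0 \<le> t"
  defines "y \<equiv> 1 + slit_length t"
  shows "1 \<le> y" "0 < t \<Longrightarrow> 1 < y" "y + 1 / y + 2 = 4 * exp t"
proof -
  define s where "s = sqrt (1 - exp (- t))"
  have s0: "0 \<le> s" using assms by (simp add: s_def)
  have E: "1 \<le> exp t" using assms by simp
  have y: "y = 2 * exp t * (1 + s) - 1" by (simp add: y_def s_def slit_length_def)
  show y1: "1 \<le> y" using E s0 mult_mono[of 1 "exp t" 1 "1 + s"] by (simp add: y)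
  show "1 < y" if "0 < t"
  proof -
    have "1 < exp t" using that by simp
    have "exp t \<le> exp t * (1 + s)" using s0 by (simp add: algebra_simps)
    then show ?thesis using \<open>1 < exp t\<close> unfolding y by linarith
  qed
  have s2: "exp t * s\<^sup>2 = exp t - 1"
    using assms by (simp add: s_def algebra_simps exp_minus field_simps)
  have "(y + 1)\<^sup>2 = 4 * exp t * (exp t + 2 * exp t * s + exp t * s\<^sup>2)"
    by (simp add: y power2_eq_square algebra_simps)
  also have "\<dots> = 4 * exp t * y" unfolding s2 by (simp add: y algebra_simps)
  finally show "y + 1 / y + 2 = 4 * exp t" using y1 by (simp add: field_simps power2_eq_square)
qed

lemma slit_length_nonneg: "0 \<le> t \<Longrightarrow> 0 \<le> slit_length t"
  using one_plus_slit_length(1)[of t] by simp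

lemma slit_length_mono: "0 \<le> s \<Longrightarrow> s \<le> t \<Longrightarrow> slit_length s \<le> slit_length t"
  unfolding slit_length_def by (intro diff_right_mono mult_mono add_left_mono real_sqrt_le_mono) auto

lemma slit_length_0 [simp]: "slit_length 0 = 0"
  by (simp add: slit_length_def)

lemma mem_slit_iff:
  assumes "0 \<le> t" "1 \<le> norm w"
  shows "w \<in> slit t \<longleftrightarrow> (\<exists>x. koebe w = of_real x \<and> 4 < x \<and> x \<le> 4 * exp t)"
proof
  assume "w \<in> slit t"
  then obtain y where y: "w = of_real y" "1 < y" "y \<le> 1 + slit_length t" by (auto simp: slit_def)
  have "y + 1 / y + 2 \<le> 4 * exp t"
    using add_inverse_mono[of y "1 + slit_length t"] y one_plus_slit_length(3)[OF assms(1)] by simp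
  moreover have "4 < y + 1 / y + 2"
  proof -
    have "0 < (y - 1)\<^sup>2 / y" using y by simp
    also have "(y - 1)\<^sup>2 / y = y + 1 / y + 2 - 4" using y by (simp add: field_simps power2_eq_square)
    finally show ?thesis by simp
  qed
  moreover have "koebe w = of_real (y + 1 / y + 2)" by (simp add: koebe_def y)
  ultimately show "\<exists>x. koebe w = of_real x \<and> 4 < x \<and> x \<le> 4 * exp t" by blast
next
  assume "\<exists>x. koebe w = of_real x \<and> 4 < x \<and> x \<le> 4 * exp t"
  then obtain x where x: "koebe w = of_real x" "4 < x" "x \<le> 4 * exp t" by blast
  define u where "u = ln (x / 4)"
  have u: "0 < u" "exp u = x / 4" using x by (auto simp: u_def)
  have ut: "u \<le> t" using u x by (metis divide_le_eq exp_le_cancel_iff mult.commute zero_less_numeral)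
  define y where "y = 1 + slit_length u"
  have y: "1 < y" "y + 1 / y + 2 = x"
    using one_plus_slit_length(2,3)[of u] u by (auto simp: y_def)
  have "koebe w = koebe (of_real y)"
    using x(1) unfolding y(2)[symmetric] by (simp add: koebe_def[of "of_real y"])
  moreover have "w \<noteq> 0" using assms by auto
  ultimately have "w = of_real y \<or> w * of_real y = 1" using y by (subst (asm) koebe_eq_iff) auto
  moreover have "w * of_real y \<noteq> 1"
  proof
    assume "w * of_real y = 1"
    then have "norm w * y = 1" using y by (metis norm_mult norm_of_real norm_one abs_of_pos less_trans zero_less_one)
    moreover have "1 * y \<le> norm w * y" using assms y by (intro mult_right_mono) auto
    ultimately show False using y by simp
  qed
  ultimately have "w = of_real y" by blast
  moreover have "y \<le> 1 + slit_length t" using slit_length_mono[of u t] u ut by (simp add: y_def)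
  ultimately show "w \<in> slit t" using y by (auto simp: slit_def)
qed

section \<open>Explicit slit maps\<close>

lemma isCont_csqrt_0: "isCont csqrt 0"
proof -
  have "((\<lambda>z. csqrt z) \<longlongrightarrow> 0) (at 0)"
  proof (rule tendsto_norm_zero_cancel)
    have "norm (csqrt z) = sqrt (norm z)" for z
      by (metis norm_ge_zero norm_power power2_csqrt real_sqrt_abs abs_of_nonneg)
    moreover have "((\<lambda>z::complex. sqrt (norm z)) \<longlongrightarrow> 0) (at 0)" by (auto intro!: tendsto_eq_intros)
    ultimately show "((\<lambda>z. norm (csqrt z)) \<longlongrightarrow> 0) (at 0)" by simp
  qed
  then show ?thesis by (simp add: isCont_def)
qed

lemma continuous_on_csqrt_halfplane:
  assumes "continuous_on S f" "\<And>x. x \<in> S \<Longrightarrow> 0 \<le> Re (f x)"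
  shows "continuous_on S (\<lambda>x. csqrt (f x))"
proof -
  have "isCont csqrt w" if "0 \<le> Re w" for w
  proof (cases "w = 0")
    case False
    then have "w \<notin> \<real>\<^sub>\<le>\<^sub>0" using that by (auto simp: complex_nonpos_Reals_iff complex_eq_iff)
    then show ?thesis by (rule continuous_at_csqrt)
  qed (simp add: isCont_csqrt_0)
  then have "continuous_on {w. 0 \<le> Re w} csqrt" by (simp add: continuous_at_imp_continuous_on)
  from continuous_on_compose2[OF this assms(1)] assms(2) show ?thesis by auto
qed

definition arc_angle :: "real \<Rightarrow> real" where
  "arc_angle t = 2 * arccos (exp (- t / 2))"

lemma cos_arc_angle_half: "0 \<le> t \<Longrightarrow> cos (arc_angle t / 2) = exp (- t / 2)"
  by (simp add: arc_angle_def cos_arccos less_imp_le order_trans[of "-1" 0])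

lemma arc_angle_pos:
  assumes "0 < t" shows "0 < arc_angle t"
proof -
  have "-1 < exp (- t / 2)" by (rule less_trans[of _ 0]) auto
  moreover have "exp (- t / 2) < 1" using assms by simp
  ultimately show ?thesis using arccos_lt_bounded[of "exp (- t / 2)"] by (simp add: arc_angle_def)
qed

lemma arc_angle_bounds: "0 \<le> t \<Longrightarrow> 0 \<le> arc_angle t \<and> arc_angle t < pi"
proof -
  assume t: "0 \<le> t"
  have "arccos (exp (- t / 2)) < arccos 0" using t by (subst arccos_less_mono) auto
  moreover have "0 \<le> arccos (exp (- t / 2))" using t by (intro arccos_lbound) (auto simp: order_trans[of "-1" 0])
  ultimately show ?thesis by (simp add: arc_angle_def)
qed

lemma cos_arc_angle: "0 \<le> t \<Longrightarrow> cos (arc_angle t) = 2 * exp (- t) - 1"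
proof -
  assume "0 \<le> t"
  have "cos (arc_angle t) = 2 * (cos (arc_angle t / 2))\<^sup>2 - 1" using cos_double_cos[of "arc_angle t / 2"] by simp
  also have "(cos (arc_angle t / 2))\<^sup>2 = exp (- t)"
    by (simp add: cos_arc_angle_half[OF \<open>0 \<le> t\<close>] power2_eq_square flip: exp_add)
  finally show ?thesis .
qed

text \<open>
  With \<open>u = 1 / z\<close> and \<open>b = cis \<beta>\<close>, the two summands \<open>A\<close>, \<open>B\<close> of \<open>slit_factor\<close> satisfy
  \<open>e\<^sup>t (A\<^sup>2 - B\<^sup>2) = 4 u\<close>, which makes \<open>z e\<^sup>t (A + B)\<^sup>2 / 4\<close> solve the quadratic
  equation \<open>koebe f = e\<^sup>t koebe z\<close>. Splitting the square root into two principal roots places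
  its branch cuts inside the disk.
\<close>

definition slit_factor :: "real \<Rightarrow> complex \<Rightarrow> complex" where
  "slit_factor t u = (1 + u) + csqrt (1 - cis (arc_angle t) * u) * csqrt (1 - cis (- arc_angle t) * u)"

definition slit_fun :: "real \<Rightarrow> complex \<Rightarrow> complex" where
  "slit_fun t z = of_real (exp t) * z / 4 * (slit_factor t (1 / z))\<^sup>2"

lemma koebe_slit_fun:
  assumes t: "0 \<le> t" and z: "z \<noteq> 0"
  shows "slit_fun t z \<noteq> 0" "koebe (slit_fun t z) = of_real (exp t) * koebe z"
proof -
  define A where "A = 1 + 1 / z"
  define B where "B = csqrt (1 - cis (arc_angle t) * (1/z)) * csqrt (1 - cis (- arc_angle t) * (1/z))"
  define E where "E = complex_of_real (exp t)"
  have f: "slit_fun t z = E * z / 4 * (A + B)\<^sup>2"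
    by (simp add: slit_fun_def slit_factor_def A_def B_def E_def exp_of_real)
  have "B\<^sup>2 = (1 - cis (arc_angle t) * (1/z)) * (1 - cis (- arc_angle t) * (1/z))"
    by (simp add: B_def power_mult_distrib)
  also have "\<dots> = 1 - (cis (arc_angle t) + cis (- arc_angle t)) / z + (cis (arc_angle t) * cis (- arc_angle t)) / z\<^sup>2"
    using z by (simp add: field_simps power2_eq_square)
  also have "cis (arc_angle t) + cis (- arc_angle t) = 4 / E - 2"
    by (simp add: complex_eq_iff cos_arc_angle[OF t] E_def exp_minus field_simps Re_divide_of_real)
  also have "cis (arc_angle t) * cis (- arc_angle t) = 1" by (simp add: cis_mult)
  finally have B2: "B\<^sup>2 = 1 - (4 / E - 2) / z + 1 / z\<^sup>2" .
  have E0: "E \<noteq> 0" by (simp add: E_def)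
  have AB: "(A + B) * (A - B) = 4 / (E * z)"
  proof -
    have "(A + B) * (A - B) = A\<^sup>2 - B\<^sup>2" by (simp add: power2_eq_square algebra_simps)
    also have "\<dots> = 4 / (E * z)" unfolding B2 A_def using z E0
      by (simp add: field_simps power2_eq_square)
    finally show ?thesis .
  qed
  then have AB0: "A + B \<noteq> 0" using z E0 by auto
  show "slit_fun t z \<noteq> 0" using AB0 z E0 by (simp add: f)
  have D: "A - B = 4 / (E * z * (A + B))"
  proof -
    have "A - B = (A + B) * (A - B) / (A + B)" using AB0 by simp
    also have "\<dots> = 4 / (E * z * (A + B))" unfolding AB by simp
    finally show ?thesis .
  qed
  have inv: "1 / slit_fun t z = E * z / 4 * (A - B)\<^sup>2"
  proof -
    define S where "S = A + B"
    have "S \<noteq> 0" using AB0 by (simp add: S_def)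
    then show ?thesis unfolding f D S_def[symmetric] using z E0 by (simp add: field_simps power2_eq_square)
  qed
  have "slit_fun t z + 1 / slit_fun t z = E * z / 2 * (A\<^sup>2 + B\<^sup>2)"
    unfolding inv unfolding f by (simp add: field_simps power2_eq_square)
  also have "\<dots> = E * koebe z - 2"
    unfolding B2 A_def koebe_def using z E0 by (simp add: field_simps power2_eq_square)
  finally show "koebe (slit_fun t z) = of_real (exp t) * koebe z" by (simp add: koebe_def E_def)
qed

lemma Re_one_minus_cis_nonneg:
  assumes "1 \<le> norm z" shows "0 \<le> Re (1 - cis x * (1 / z))"
proof -
  have "Re (cis x * (1 / z)) \<le> norm (cis x * (1 / z))" by (rule complex_Re_le_cmod)
  also have "\<dots> \<le> 1" using assms by (simp add: norm_mult norm_divide divide_le_eq)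
  finally show ?thesis by simp
qed

lemma continuous_on_slit_fun: "continuous_on {z. 1 \<le> norm z} (slit_fun t)"
  unfolding slit_fun_def slit_factor_def
  by (intro continuous_intros continuous_on_csqrt_halfplane) (use Re_one_minus_cis_nonneg in auto)

lemma holomorphic_on_slit_fun: "slit_fun t holomorphic_on exterior"
proof -
  have "1 - cis x * (1 / z) \<notin> \<real>\<^sub>\<le>\<^sub>0" if "1 < norm z" for x z
  proof -
    have "Re (cis x * (1 / z)) \<le> norm (cis x * (1 / z))" by (rule complex_Re_le_cmod)
    also have "\<dots> < 1" using that by (simp add: norm_mult norm_divide divide_less_eq)
    finally show ?thesis by (auto simp: complex_nonpos_Reals_iff)
  qed
  then show ?thesis
    unfolding slit_fun_def slit_factor_def exterior_def
    by (intro holomorphic_intros) auto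
qed

lemma norm_slit_fun_gt_1:
  assumes t: "0 \<le> t" and z0: "1 < norm z0"
  shows "1 < norm (slit_fun t z0)"
proof (rule ccontr)
  assume le: "\<not> 1 < norm (slit_fun t z0)"
  have "isCont (slit_factor t) 0"
    unfolding slit_factor_def
    by (intro continuous_intros isCont_csqrt' ) (auto simp: complex_nonpos_Reals_iff)
  moreover have "slit_factor t 0 = 2" by (simp add: slit_factor_def)
  ultimately obtain d where d: "d > 0" "\<And>u. norm u < d \<Longrightarrow> dist (slit_factor t u) 2 < 1"
    unfolding continuous_at_eps_delta by (metis dist_0_norm dist_commute zero_less_one)
  define x where "x = max 4 (2 / d)"
  have x: "4 \<le> x" "2 / d \<le> x" by (auto simp: x_def)
  have xz: "x < norm (of_real x * z0)" using z0 x by (simp add: norm_mult)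
  have "norm (1 / (of_real x * z0)) < d"
  proof -
    have "2 / d < norm (of_real x * z0)" using xz x by linarith
    then have "2 < d * norm (of_real x * z0)" using d by (simp add: field_simps)
    then have "1 < d * norm (of_real x * z0)" by simp
    moreover have "0 < norm (of_real x * z0)" using xz x by linarith
    ultimately show ?thesis unfolding norm_divide norm_one by (simp only: divide_less_eq if_True)
  qed
  then have "dist (slit_factor t (1 / (of_real x * z0))) 2 < 1" by (rule d)
  then have g1: "1 \<le> norm (slit_factor t (1 / (of_real x * z0)))"
    using norm_triangle_ineq2[of 2 "slit_factor t (1 / (of_real x * z0))"]
    by (simp add: dist_norm norm_minus_commute)
  have "1 * (4 / 4) * 1\<^sup>2 \<le> exp t * (norm (of_real x * z0) / 4) * (norm (slit_factor t (1 / (of_real x * z0))))\<^sup>2"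
    by (intro mult_mono power_mono) (use t xz x g1 in auto)
  then have big: "1 \<le> norm (slit_fun t (of_real x * z0))"
    by (simp add: slit_fun_def norm_mult norm_divide norm_power)
  have "\<exists>y\<ge>1. y \<le> x \<and> norm (slit_fun t (of_real y * z0)) = 1"
  proof (rule IVT')
    show "norm (slit_fun t (of_real 1 * z0)) \<le> 1" using le by simp
    show "1 \<le> norm (slit_fun t (of_real x * z0))" by (rule big)
    show "1 \<le> x" using x by simp
    have ge: "1 \<le> norm (of_real y * z0)" if "y \<in> {1..x}" for y
      using that z0 mult_mono[of 1 y 1 "norm z0"] by (simp add: norm_mult)
    show "continuous_on {1..x} (\<lambda>y. norm (slit_fun t (of_real y * z0)))"
      by (intro continuous_intros continuous_on_compose2[OF continuous_on_slit_fun])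
         (use ge in auto)
  qed
  then obtain y where y: "1 \<le> y" "norm (slit_fun t (of_real y * z0)) = 1" by blast
  define w where "w = of_real y * z0"
  have w1: "1 < norm w" using y z0 by (simp add: w_def norm_mult) (metis less_1_mult less_le mult_1)
  then have w0: "w \<noteq> 0" by auto
  define r where "r = (2 + 2 * Re (slit_fun t w)) / exp t"
  have "\<bar>Re (slit_fun t w)\<bar> \<le> 1" using y abs_Re_le_cmod[of "slit_fun t w"] by (simp add: w_def)
  then have r: "0 \<le> r" "r \<le> 4"
    using t one_le_exp_iff[of t] by (auto simp: r_def divide_le_eq simp del: one_le_exp_iff)
  have "of_real (exp t) * koebe w = of_real (2 + 2 * Re (slit_fun t w))"
    using koebe_slit_fun(2)[OF t w0] koebe_of_circle[of "slit_fun t w"] y by (simp add: w_def)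
  then have "koebe w = of_real r"
    unfolding r_def of_real_divide by (metis exp_not_eq_zero mult.commute nonzero_mult_div_cancel_right of_real_eq_0_iff)
  then have "norm w = 1" using norm_eq_1_if_koebe_mem[of w r] r w1 by simp
  then show False using w1 by simp
qed

lemma mem_closure_exterior: "1 \<le> norm z \<Longrightarrow> z \<in> closure exterior"
proof -
  assume z: "1 \<le> norm z"
  have "(\<lambda>n. of_real (1 + 1 / real (Suc n)) * z) \<longlonglongrightarrow> of_real (1 + 0) * z"
    by (intro tendsto_intros LIMSEQ_Suc lim_1_over_n)
  moreover have "of_real (1 + 1 / real (Suc n)) * z \<in> exterior" for n
  proof -
    have "1 < 1 + 1 / real (Suc n)" by simp
    also have "\<dots> \<le> (1 + 1 / real (Suc n)) * norm z"
      using z mult_left_mono[of 1 "norm z" "1 + 1 / real (Suc n)"] by simp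
    finally have "1 < (1 + 1 / real (Suc n)) * norm z" .
    moreover have "norm (of_real (1 + 1 / real (Suc n)) * z) = (1 + 1 / real (Suc n)) * norm z"
      unfolding norm_mult norm_of_real by simp
    ultimately show ?thesis by (simp add: exterior_def)
  qed
  ultimately have "\<exists>x. (\<forall>n. x n \<in> exterior) \<and> x \<longlonglongrightarrow> z"
    by (intro exI[of _ "\<lambda>n. of_real (1 + 1 / real (Suc n)) * z"]) simp
  then show ?thesis by (simp only: closure_sequential)
qed

lemma norm_slit_fun_ge_1:
  assumes t: "0 \<le> t" and z: "1 \<le> norm z"
  shows "1 \<le> norm (slit_fun t z)"
proof -
  have sub: "closure exterior \<subseteq> {z. 1 \<le> norm z}"
    by (rule closure_minimal) (auto simp: exterior_def intro!: closed_Collect_le continuous_intros)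
  show ?thesis
  proof (rule continuous_ge_on_closure[OF _ mem_closure_exterior[OF z]])
    show "continuous_on (closure exterior) (\<lambda>z. norm (slit_fun t z))"
      by (intro continuous_intros continuous_on_subset[OF continuous_on_slit_fun sub])
    show "1 \<le> norm (slit_fun t w)" if "w \<in> exterior" for w
      using norm_slit_fun_gt_1[OF t, of w] that by (simp add: exterior_def)
  qed
qed

section \<open>Subordination of exterior maps\<close>

lemma open_norm_greater: "open {z :: complex. \<rho> < norm z}"
  by (intro open_Collect_less continuous_intros)

lemma exterior_subordination:
  assumes \<Phi>: "\<Phi> holomorphic_on exterior" "inj_on \<Phi> exterior"
    and \<Phi>_bd: "\<And>z. z \<in> exterior \<Longrightarrow> norm (\<Phi> z) \<le> C * norm z"
    and \<Phi>_lim: "((\<lambda>z. \<Phi> z / z) \<longlongrightarrow> a) at_infinity"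
    and f: "f holomorphic_on {z. \<rho> < norm z}" "f ` {z. \<rho> < norm z} \<subseteq> \<Phi> ` exterior"
    and f_lim: "((\<lambda>z. f z / z) \<longlongrightarrow> b) at_infinity"
    and \<rho>: "0 < \<rho>" and a0: "a \<noteq> 0" and b0: "b \<noteq> 0"
  obtains \<phi> where "\<phi> holomorphic_on ball 0 (1 / \<rho>)" "\<phi> 0 = 0" "deriv \<phi> 0 = a / b"
    "\<And>u. norm u < 1 / \<rho> \<Longrightarrow> norm (\<phi> u) < 1"
    "\<And>u. norm u < 1 / \<rho> \<Longrightarrow> u \<noteq> 0 \<Longrightarrow> \<phi> u \<noteq> 0 \<and> \<Phi> (1 / \<phi> u) = f (1 / u)"
proof -
  have op: "open exterior" unfolding exterior_def by (rule open_norm_greater)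
  obtain g where g: "g holomorphic_on \<Phi> ` exterior" "\<And>z. z \<in> exterior \<Longrightarrow> g (\<Phi> z) = z"
    using holomorphic_has_inverse[OF \<Phi>(1) op \<Phi>(2)] by metis
  define h where "h = g \<circ> f"
  have h: "h z \<in> exterior" "\<Phi> (h z) = f z" if "\<rho> < norm z" for z
    using f(2) g(2) that by (auto simp: h_def)
  have h_hol: "h holomorphic_on {z. \<rho> < norm z}"
    unfolding h_def by (rule holomorphic_on_compose_gen[OF f(1) g(1) f(2)])
  have ev: "\<forall>\<^sub>F z in at_infinity. \<rho> < norm z"
    unfolding eventually_at_infinity by (intro exI[of _ "\<rho> + 1"]) auto
  have C: "0 < C"
  proof -
    have mem: "(2 :: complex) \<in> exterior" "(3 :: complex) \<in> exterior" by (auto simp: exterior_def)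
    have "0 \<le> C * norm (2 :: complex)"
      using \<Phi>_bd[OF mem(1)] norm_ge_zero[of "\<Phi> 2"] by (rule order_trans[rotated])
    then have "0 \<le> C" by simp
    moreover have "C \<noteq> 0"
    proof
      assume "C = 0"
      then have "\<Phi> z = 0" if "z \<in> exterior" for z using \<Phi>_bd[OF that] by simp
      then show False using inj_onD[OF \<Phi>(2), of 2 3] mem by simp
    qed
    ultimately show ?thesis by simp
  qed
  have f_inf: "filterlim f at_infinity at_infinity"
  proof -
    have "filterlim (\<lambda>z. f z / z * z) at_infinity at_infinity"
      by (rule tendsto_mult_filterlim_at_infinity[OF f_lim b0]) (rule filterlim_ident)
    moreover have "\<forall>\<^sub>F z in at_infinity. f z / z * z = f z"
      using ev by eventually_elim (use \<rho> in auto)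
    ultimately show ?thesis by (rule filterlim_mono_eventually[OF _ order_refl order_refl])
  qed
  have h_inf: "filterlim h at_infinity at_infinity"
  proof (rule filterlim_norm_at_top_imp_at_infinity, rule filterlim_at_top_mono)
    show "filterlim (\<lambda>z. (1 / C) * norm (f z)) at_top at_infinity"
      by (intro filterlim_tendsto_pos_mult_at_top[OF tendsto_const] filterlim_at_infinity_imp_norm_at_top f_inf)
         (use C in auto)
    show "\<forall>\<^sub>F z in at_infinity. 1 / C * norm (f z) \<le> norm (h z)"
      using ev
    proof eventually_elim
      case (elim z)
      show ?case using \<Phi>_bd[OF h(1)[OF elim]] h(2)[OF elim] C by (simp add: field_simps)
    qed
  qed
  have lim: "((\<lambda>z. z / h z) \<longlongrightarrow> a / b) at_infinity"
  proof -
    have "((\<lambda>z. \<Phi> (h z) / h z) \<longlongrightarrow> a) at_infinity"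
      using filterlim_compose[OF \<Phi>_lim h_inf] .
    then have "((\<lambda>z. (\<Phi> (h z) / h z) / (f z / z)) \<longlongrightarrow> a / b) at_infinity"
      by (intro tendsto_divide f_lim b0)
    moreover have "\<forall>\<^sub>F z in at_infinity. (\<Phi> (h z) / h z) / (f z / z) = z / h z"
      using ev filterlim_at_infinity_imp_eventually_ne[OF f_inf, of 0]
    proof eventually_elim
      case (elim z)
      then show ?case using h(2)[OF elim(1)] \<rho> by (simp add: field_simps)
    qed
    ultimately show ?thesis by (rule Lim_transform_eventually)
  qed
  define \<phi> where "\<phi> u = (if u = 0 then 0 else 1 / h (1 / u))" for u
  have inv: "\<rho> < norm (1 / u)" if "norm u < 1 / \<rho>" "u \<noteq> 0" for u :: complex
    using that \<rho> by (simp add: norm_divide field_simps)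
  have h0: "1 < norm (h z)" if "\<rho> < norm z" for z using h(1)[OF that] by (simp add: exterior_def)
  have d0: "(\<phi> has_field_derivative a / b) (at 0)"
  proof -
    have "((\<lambda>u. 1 / u / h (1 / u)) \<longlongrightarrow> a / b) (at 0)"
      using filterlim_compose[OF lim, of "\<lambda>u. 1 / u" "at 0"] filterlim_inverse_at_infinity
      by (simp add: inverse_eq_divide[abs_def])
    moreover have "\<forall>\<^sub>F u in at 0. 1 / u / h (1 / u) = (\<phi> (0 + u) - \<phi> 0) / u"
      by (auto simp: eventually_at_filter \<phi>_def)
    ultimately show ?thesis unfolding DERIV_def by (rule Lim_transform_eventually)
  qed
  have "\<phi> field_differentiable at u" if u: "norm u < 1 / \<rho>" for u
  proof (cases "u = 0")
    case True then show ?thesis using d0 by (auto simp: field_differentiable_def)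
  next
    case False
    have "(\<lambda>u. 1 / h (1 / u)) holomorphic_on (ball 0 (1 / \<rho>) - {0})"
    proof (intro holomorphic_intros holomorphic_on_compose_gen[OF _ h_hol, unfolded o_def])
      show "(\<lambda>u. 1 / u) ` (ball 0 (1 / \<rho>) - {0}) \<subseteq> {z :: complex. \<rho> < norm z}" using inv by auto
      show "h (1 / u) \<noteq> 0" if "u \<in> ball 0 (1 / \<rho>) - {0}" for u
        using h0[of "1 / u"] inv[of u] that by auto
    qed auto
    then have "\<phi> holomorphic_on (ball 0 (1 / \<rho>) - {0})"
      by (rule holomorphic_transform) (auto simp: \<phi>_def)
    moreover have "open (ball 0 (1 / \<rho>) - {0 :: complex})" by auto
    ultimately show ?thesis using u False by (auto simp: holomorphic_on_open field_differentiable_def)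
  qed
  then have "\<phi> holomorphic_on ball 0 (1 / \<rho>)"
    by (auto simp: holomorphic_on_def intro: field_differentiable_at_within)
  moreover have "norm (\<phi> u) < 1" if "norm u < 1 / \<rho>" for u
    using h0[OF inv[OF that]] by (auto simp: \<phi>_def norm_divide divide_less_eq)
  moreover have "\<phi> u \<noteq> 0 \<and> \<Phi> (1 / \<phi> u) = f (1 / u)" if "norm u < 1 / \<rho>" "u \<noteq> 0" for u
    using h0[OF inv[OF that]] h(2)[OF inv[OF that]] that by (auto simp: \<phi>_def)
  ultimately show ?thesis using that[of \<phi>] DERIV_imp_deriv[OF d0] by (auto simp: \<phi>_def)
qed

lemma exterior_subordination_bound:
  assumes "\<Phi> holomorphic_on exterior" "inj_on \<Phi> exterior"
    and "\<And>z. z \<in> exterior \<Longrightarrow> norm (\<Phi> z) \<le> C * norm z"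
    and "((\<lambda>z. \<Phi> z / z) \<longlongrightarrow> a) at_infinity"
    and "f holomorphic_on {z. \<rho> < norm z}" "f ` {z. \<rho> < norm z} \<subseteq> \<Phi> ` exterior"
    and "((\<lambda>z. f z / z) \<longlongrightarrow> b) at_infinity"
    and \<rho>: "0 < \<rho>" and "a \<noteq> 0" "b \<noteq> 0"
  shows "norm a \<le> \<rho> * norm b"
proof -
  obtain \<phi> where \<phi>: "\<phi> holomorphic_on ball 0 (1 / \<rho>)" "\<phi> 0 = 0" "deriv \<phi> 0 = a / b"
    "\<And>u. norm u < 1 / \<rho> \<Longrightarrow> norm (\<phi> u) < 1"
    using exterior_subordination[OF assms] by metis
  define \<psi> where "\<psi> u = \<phi> (u / of_real \<rho>)" for u
  have sc: "norm (u / of_real \<rho>) < 1 / \<rho>" if "norm u < 1" for u :: complex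
    using that \<rho> by (simp add: norm_divide divide_strict_right_mono)
  have "\<psi> holomorphic_on ball 0 1"
    unfolding \<psi>_def using sc \<rho>
    by (intro holomorphic_on_compose_gen[OF _ \<phi>(1), unfolded o_def] holomorphic_intros) auto
  moreover have "\<psi> 0 = 0" using \<phi>(2) by (simp add: \<psi>_def)
  moreover have "norm (\<psi> u) < 1" if "norm u < 1" for u unfolding \<psi>_def using \<phi>(4) sc[OF that] .
  ultimately have "norm (deriv \<psi> 0) \<le> 1" by (intro Schwarz_Lemma(2)[where \<xi> = 0]) auto
  moreover have "(\<psi> has_field_derivative a / b * (1 / of_real \<rho>)) (at 0)"
    unfolding \<psi>_def
  proof (rule DERIV_chain2[where f = \<phi> and g = "\<lambda>u. u / of_real \<rho>"])
    have "(\<phi> has_field_derivative deriv \<phi> 0) (at 0)"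
      using \<phi>(1) \<rho> by (intro holomorphic_derivI[OF \<phi>(1)]) auto
    then show "(\<phi> has_field_derivative a / b) (at (0 / of_real \<rho>))" by (simp add: \<phi>(3))
    show "((\<lambda>u. u / of_real \<rho>) has_field_derivative 1 / of_real \<rho>) (at 0)"
      using \<rho> by (auto intro!: derivative_eq_intros)
  qed
  ultimately have "norm (a / b * (1 / of_real \<rho>)) \<le> 1" by (simp add: DERIV_imp_deriv)
  then show ?thesis using \<rho> assms(10) by (simp add: norm_mult norm_divide field_simps)
qed

section \<open>The slit map\<close>

lemma norm_slit_fun_le_slit_fun_norm:
  assumes t: "0 \<le> t" and z: "1 \<le> norm z"
  shows "norm (slit_fun t z) + 1 / norm (slit_fun t z) + 2 \<le> exp t * (norm z + 1 / norm z + 2)"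
proof -
  have z0: "z \<noteq> 0" using z by auto
  have w0: "slit_fun t z \<noteq> 0" using koebe_slit_fun(1)[OF t z0(1)] .
  have E: "1 \<le> exp t" using t by simp
  define p where "p = koebe z"
  have q: "koebe (slit_fun t z) = of_real (exp t) * p" using koebe_slit_fun(2)[OF t z0] by (simp add: p_def)
  have "norm (of_real (exp t) * p - 4) \<le> norm (of_real (exp t) * (p - 4)) + norm (of_real (4 * exp t - 4) :: complex)"
    using norm_triangle_ineq[of "of_real (exp t) * (p - 4)" "of_real (4 * exp t - 4)"] by (simp add: algebra_simps)
  also have "norm (of_real (4 * exp t - 4) :: complex) = 4 * exp t - 4"
    unfolding norm_of_real using E by simp
  also have "norm (of_real (exp t) * (p - 4)) + (4 * exp t - 4) = exp t * norm (p - 4) + (4 * exp t - 4)"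
    by (simp add: norm_mult)
  finally have "norm (koebe (slit_fun t z)) + norm (koebe (slit_fun t z) - 4)
      \<le> exp t * (norm p + norm (p - 4)) + (4 * exp t - 4)"
    by (simp add: q norm_mult algebra_simps)
  then have le: "2 * (norm (slit_fun t z) + 1 / norm (slit_fun t z)) \<le> exp t * (2 * (norm z + 1 / norm z)) + (4 * exp t - 4)"
    unfolding koebe_ellipse[OF w0] p_def koebe_ellipse[OF z0] .
  have "2 * X \<le> e * (2 * Y) + (4 * e - 4) \<Longrightarrow> X + 2 \<le> e * (Y + 2)" for X Y e :: real
    by (simp add: algebra_simps)
  from this[OF le] show ?thesis .
qed

lemma norm_slit_fun_bounds:
  assumes t: "0 \<le> t" and z: "1 \<le> norm z"
  shows "norm z \<le> norm (slit_fun t z)" "norm (slit_fun t z) \<le> 4 * exp t * norm z"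
    "norm (slit_fun t z - of_real (exp t) * z) \<le> 3 * exp t + 3"
proof -
  have z0: "z \<noteq> 0" "0 < norm z" using z by auto
  have w: "1 \<le> norm (slit_fun t z)" and w0: "slit_fun t z \<noteq> 0"
    using norm_slit_fun_ge_1[OF assms] koebe_slit_fun(1)[OF t z0(1)] .
  have E: "1 \<le> exp t" using t by simp
  define p where "p = koebe z"
  have q: "koebe (slit_fun t z) = of_real (exp t) * p" using koebe_slit_fun(2)[OF t z0(1)] by (simp add: p_def)
  have "norm (p - of_real (exp t) * p) = (exp t - 1) * norm p"
  proof -
    have "p - of_real (exp t) * p = of_real (1 - exp t) * p" by (simp add: algebra_simps)
    then show ?thesis using E by (simp only: norm_mult norm_of_real) simp
  qed
  then have "norm (p - 4) \<le> (exp t - 1) * norm p + norm (of_real (exp t) * p - 4)"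
    using norm_triangle_ineq[of "p - of_real (exp t) * p" "of_real (exp t) * p - 4"] by simp
  then have "norm p + norm (p - 4) \<le> norm (koebe (slit_fun t z)) + norm (koebe (slit_fun t z) - 4)"
    by (simp add: q norm_mult algebra_simps)
  then have "norm z + 1 / norm z \<le> norm (slit_fun t z) + 1 / norm (slit_fun t z)"
    using koebe_ellipse[OF z0(1)] koebe_ellipse[OF w0] by (simp add: p_def)
  then show "norm z \<le> norm (slit_fun t z)" by (rule add_inverse_le_imp_le[OF z0(2) w])
  have d: "slit_fun t z - of_real (exp t) * z = of_real (exp t) * (1 / z + 2) - 2 - 1 / slit_fun t z"
    using q by (simp add: p_def koebe_def algebra_simps)
  have "norm (of_real (exp t) * (1 / z + 2)) \<le> exp t * 3"
  proof -
    have "norm (1 / z + 2) \<le> norm (1 / z) + norm (2::complex)" by (rule norm_triangle_ineq)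
    also have "\<dots> \<le> 3" using z by (simp add: norm_divide divide_le_eq)
    finally show ?thesis by (simp add: norm_mult)
  qed
  moreover have "norm (1 / slit_fun t z) \<le> 1" using w w0 by (simp add: norm_divide divide_le_eq)
  ultimately show "norm (slit_fun t z - of_real (exp t) * z) \<le> 3 * exp t + 3"
    unfolding d using norm_triangle_ineq4[of "of_real (exp t) * (1 / z + 2) - 2" "1 / slit_fun t z"]
      norm_triangle_ineq4[of "of_real (exp t) * (1 / z + 2)" "2"] by simp
  have le: "norm (slit_fun t z) + 1 / norm (slit_fun t z) + 2 \<le> exp t * (norm z + 1 / norm z + 2)"
    by (rule norm_slit_fun_le_slit_fun_norm[OF assms])
  have i: "0 \<le> 1 / norm (slit_fun t z)" "exp t * (1 / norm z) \<le> exp t * norm z" "exp t * 1 \<le> exp t * norm z"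
    using z by (auto simp: divide_le_eq intro: order_trans[OF _ mult_right_mono[of 1 "norm z" "norm z"]])
  show "norm (slit_fun t z) \<le> 4 * exp t * norm z"
    using le i by (simp only: distrib_left mult.assoc)
qed

lemma slit_fun_mem_slit_imp:
  assumes t: "0 \<le> t" and z: "1 \<le> norm z" and mem: "slit_fun t z \<in> slit t"
  shows "norm z = 1"
proof -
  obtain x where x: "koebe (slit_fun t z) = of_real x" "4 < x" "x \<le> 4 * exp t"
    using mem mem_slit_iff[OF t norm_slit_fun_ge_1[OF t z]] by blast
  have "z \<noteq> 0" using z by auto
  then have "koebe z = of_real (x / exp t)"
    using x koebe_slit_fun(2)[OF t] by (simp add: field_simps)
  then show ?thesis using norm_eq_1_if_koebe_mem[OF z, of "x / exp t"] x by (simp add: field_simps)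
qed

lemma conformal_slit_map_slit_fun:
  assumes t: "0 \<le> t"
  shows "conformal_slit_map t (slit_fun t)"
  unfolding conformal_slit_map_def
proof (intro conjI)
  show "slit_fun t holomorphic_on exterior" by (rule holomorphic_on_slit_fun)
  show "inj_on (slit_fun t) exterior"
  proof
    fix z w assume zw: "z \<in> exterior" "w \<in> exterior" "slit_fun t z = slit_fun t w"
    then have n: "1 < norm z" "1 < norm w" "z \<noteq> 0" "w \<noteq> 0" by (auto simp: exterior_def)
    have "of_real (exp t) * koebe z = of_real (exp t) * koebe w"
      using koebe_slit_fun(2)[OF t n(3)] koebe_slit_fun(2)[OF t n(4)] zw(3) by metis
    then have "koebe z = koebe w" by simp
    moreover have "z * w \<noteq> 1"
    proof
      assume "z * w = 1"
      then have "norm z * norm w = 1" by (metis norm_mult norm_one)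
      then show False using n less_1_mult[of "norm z" "norm w"] by simp
    qed
    ultimately show "z = w" using koebe_eq_iff n by blast
  qed
  show "slit_fun t ` exterior = exterior - slit t"
  proof (intro equalityI subsetI)
    fix w assume "w \<in> slit_fun t ` exterior"
    then obtain z where z: "1 < norm z" "w = slit_fun t z" by (auto simp: exterior_def)
    then show "w \<in> exterior - slit t"
      using norm_slit_fun_gt_1[OF t z(1)] slit_fun_mem_slit_imp[OF t, of z] by (auto simp: exterior_def)
  next
    fix w assume w: "w \<in> exterior - slit t"
    then have w1: "1 < norm w" "w \<noteq> 0" by (auto simp: exterior_def)
    obtain z where z: "1 \<le> norm z" "koebe z = koebe w / of_real (exp t)" by (rule ex_koebe_preimage)
    then have z0: "z \<noteq> 0" by auto
    have K: "koebe (slit_fun t z) = koebe w" using koebe_slit_fun(2)[OF t z0] z(2) by simp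
    have "norm z \<noteq> 1"
    proof
      assume c: "norm z = 1"
      define x where "x = exp t * (2 + 2 * Re z)"
      have x: "koebe w = of_real x" using koebe_of_circle[OF c] z(2) by (simp add: x_def field_simps)
      have "\<bar>Re z\<bar> \<le> 1" using c abs_Re_le_cmod[of z] by simp
      then have "0 \<le> x" "x \<le> exp t * 4" unfolding x_def by (auto intro!: mult_left_mono)
      then consider "0 \<le> x \<and> x \<le> 4" | "4 < x \<and> x \<le> 4 * exp t" by linarith
      then show False
      proof cases
        case 1 then show False using norm_eq_1_if_koebe_mem[of w x] w1 x by simp
      next
        case 2 then show False using mem_slit_iff[OF t, of w] w1 w x by auto
      qed
    qed
    then have z1: "1 < norm z" using z by simp
    have "slit_fun t z * w \<noteq> 1"
    proof
      assume "slit_fun t z * w = 1"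
      then have "norm (slit_fun t z) * norm w = 1" by (metis norm_mult norm_one)
      then show False using w1 norm_slit_fun_gt_1[OF t z1] less_1_mult[of "norm (slit_fun t z)" "norm w"] by simp
    qed
    then have "slit_fun t z = w" using K koebe_eq_iff koebe_slit_fun(1)[OF t z0] w1 by blast
    then show "w \<in> slit_fun t ` exterior" using z1 by (auto simp: exterior_def)
  qed
  show "(\<lambda>z. slit_fun t z - complex_of_real (exp t) * z) \<in> O[at_infinity](\<lambda>_. 1)"
    by (rule bigoI[of _ "3 * exp t + 3"])
       (use norm_slit_fun_bounds(3)[OF t] in \<open>auto simp: eventually_at_infinity\<close>)
qed

lemma conformal_slit_map_lim:
  assumes "conformal_slit_map t f"
  shows "((\<lambda>z. f z / z) \<longlongrightarrow> of_real (exp t)) at_infinity"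
proof -
  have "(\<lambda>z. f z - complex_of_real (exp t) * z) \<in> O[at_infinity](\<lambda>_. 1)"
    using assms by (simp add: conformal_slit_map_def)
  also have "(\<lambda>_. 1) \<in> o[at_infinity](\<lambda>z::complex. z)"
    by (rule smalloI_tendsto) (auto intro!: tendsto_divide_0[OF tendsto_const] filterlim_ident eventually_not_equal_at_infinity)
  finally have "((\<lambda>z. (f z - complex_of_real (exp t) * z) / z) \<longlongrightarrow> 0) at_infinity"
    by (rule smalloD_tendsto)
  then have "((\<lambda>z. (f z - complex_of_real (exp t) * z) / z + of_real (exp t)) \<longlongrightarrow> 0 + of_real (exp t)) at_infinity"
    by (intro tendsto_intros)
  moreover have "\<forall>\<^sub>F z in at_infinity. (f z - complex_of_real (exp t) * z) / z + of_real (exp t) = f z / z"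
    using eventually_not_equal_at_infinity[of 0] by eventually_elim (simp add: field_simps)
  ultimately show ?thesis by (simp add: tendsto_cong)
qed

lemma conformal_slit_map_unique:
  assumes t: "0 \<le> t" and f: "conformal_slit_map t f" and z: "z \<in> exterior"
  shows "f z = slit_fun t z"
proof -
  note sf = conformal_slit_map_slit_fun[OF t]
  obtain \<phi> where \<phi>: "\<phi> holomorphic_on ball 0 (1 / 1)" "\<phi> 0 = 0"
    "deriv \<phi> 0 = complex_of_real (exp t) / complex_of_real (exp t)"
    "\<And>u. norm u < 1 / 1 \<Longrightarrow> norm (\<phi> u) < 1"
    "\<And>u. norm u < 1 / 1 \<Longrightarrow> u \<noteq> 0 \<Longrightarrow> \<phi> u \<noteq> 0 \<and> slit_fun t (1 / \<phi> u) = f (1 / u)"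
    by (rule exterior_subordination[of "slit_fun t" "4 * exp t" "of_real (exp t)" f 1 "of_real (exp t)"])
       (use f sf conformal_slit_map_lim[OF f] conformal_slit_map_lim[OF sf] norm_slit_fun_bounds(2)[OF t]
         in \<open>auto simp: conformal_slit_map_def exterior_def\<close>)
  have d1: "deriv \<phi> 0 = 1" using \<phi>(3) by simp
  obtain \<alpha> where \<alpha>: "\<And>u. norm u < 1 \<Longrightarrow> \<phi> u = \<alpha> * u"
    using Schwarz_Lemma(3)[of \<phi> 0] \<phi> d1 by auto
  have "deriv \<phi> 0 = deriv (\<lambda>u. \<alpha> * u) 0"
  proof (rule deriv_cong_ev)
    show "\<forall>\<^sub>F u in nhds 0. \<phi> u = \<alpha> * u"
      using \<alpha> by (auto simp: eventually_nhds intro!: exI[of _ "ball 0 1"])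
  qed simp
  then have "\<alpha> = 1" using d1 by simp
  have z1: "norm (1 / z) < 1" "1 / z \<noteq> 0" using z by (auto simp: exterior_def norm_divide divide_less_eq)
  show ?thesis using \<phi>(5)[of "1 / z"] \<alpha>[OF z1(1)] z1 \<open>\<alpha> = 1\<close> by simp
qed

lemma slit_map_eq:
  assumes t: "0 \<le> t"
  shows "slit_map t z = (if norm z < 1 then 0 else slit_fun t z)"
proof -
  define F where "F z = (if norm z < 1 then 0 else slit_fun t z)" for z
  have eq: "F z = slit_fun t z" if "1 \<le> norm z" for z using that by (simp add: F_def)
  have ext: "F z = slit_fun t z" if "z \<in> exterior" for z using that by (simp add: F_def exterior_def)
  have "slit_map t = F"
    unfolding slit_map_def
  proof (rule the_equality)
    have "conformal_slit_map t F"
    proof -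
      note c = conformal_slit_map_slit_fun[OF t, unfolded conformal_slit_map_def]
      have "(\<lambda>z. F z - complex_of_real (exp t) * z) \<in> O[at_infinity](\<lambda>_. 1)
          \<longleftrightarrow> (\<lambda>z. slit_fun t z - complex_of_real (exp t) * z) \<in> O[at_infinity](\<lambda>_. 1)"
        by (rule landau_o.big.in_cong) (use eq in \<open>auto simp: eventually_at_infinity\<close>)
      moreover have "F holomorphic_on exterior"
        by (rule holomorphic_transform[of "slit_fun t"]) (use c ext in auto)
      moreover have "inj_on F exterior"
        using c inj_on_cong[of exterior F "slit_fun t"] ext by simp
      moreover have "F ` exterior = slit_fun t ` exterior" using ext by (rule image_cong[OF refl])
      ultimately show ?thesis using c by (simp add: conformal_slit_map_def)
    qed
    moreover have "continuous_on {z. 1 \<le> norm z} F"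
      using continuous_on_slit_fun[of t] by (rule continuous_on_eq) (auto simp: eq)
    ultimately show "conformal_slit_map t F \<and> continuous_on {z. 1 \<le> norm z} F \<and> (\<forall>z. norm z < 1 \<longrightarrow> F z = 0)"
      by (simp add: F_def)
  next
    fix f assume f: "conformal_slit_map t f \<and> continuous_on {z. 1 \<le> norm z} f \<and> (\<forall>z. norm z < 1 \<longrightarrow> f z = 0)"
    show "f = F"
    proof
      fix z
      show "f z = F z"
      proof (cases "norm z < 1")
        case False
        have sub: "closure exterior \<subseteq> {z. 1 \<le> norm z}"
          by (rule closure_minimal) (auto simp: exterior_def intro!: closed_Collect_le continuous_intros)
        have "f z - slit_fun t z = 0"
        proof (rule continuous_constant_on_closure[where S = exterior and f = "\<lambda>z. f z - slit_fun t z"])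
          show "continuous_on (closure exterior) (\<lambda>z. f z - slit_fun t z)"
            using f by (intro continuous_intros continuous_on_subset[OF _ sub] continuous_on_slit_fun) auto
        qed (use f conformal_slit_map_unique[OF t] mem_closure_exterior False in auto)
        then show ?thesis using False by (simp add: F_def)
      qed (use f in \<open>simp add: F_def\<close>)
    qed
  qed
  then show ?thesis by (simp add: F_def)
qed

lemma slit_map_eq_slit_fun: "0 \<le> t \<Longrightarrow> 1 \<le> norm z \<Longrightarrow> slit_map t z = slit_fun t z"
  by (simp add: slit_map_eq)

lemma
  assumes t: "0 \<le> t" and z: "1 \<le> norm z"
  shows norm_slit_map_ge: "norm z \<le> norm (slit_map t z)"
    and norm_slit_map_le: "norm (slit_map t z) \<le> 4 * exp t * norm z"
    and norm_slit_map_add_inverse_le: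
      "norm (slit_map t z) + 1 / norm (slit_map t z) + 2 \<le> exp t * (norm z + 1 / norm z + 2)"
    and slit_map_neq_0: "slit_map t z \<noteq> 0"
    and koebe_slit_map: "koebe (slit_map t z) = of_real (exp t) * koebe z"
proof -
  have "z \<noteq> 0" using z by auto
  then show "norm z \<le> norm (slit_map t z)" "norm (slit_map t z) \<le> 4 * exp t * norm z"
    "norm (slit_map t z) + 1 / norm (slit_map t z) + 2 \<le> exp t * (norm z + 1 / norm z + 2)"
    "slit_map t z \<noteq> 0" "koebe (slit_map t z) = of_real (exp t) * koebe z"
    using norm_slit_fun_bounds[OF assms] norm_slit_fun_le_slit_fun_norm[OF assms] koebe_slit_fun[OF t]
    by (auto simp: slit_map_eq_slit_fun[OF assms])
qed

lemma norm_slit_map_le_slit_length: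
  assumes "0 \<le> t" "0 \<le> s" "1 \<le> norm z" "norm z \<le> 1 + slit_length s"
  shows "norm (slit_map t z) \<le> 1 + slit_length (s + t)"
proof -
  have f1: "1 \<le> norm (slit_map t z)" using norm_slit_map_ge[of t z] assms by simp
  have "norm z + 1 / norm z + 2 \<le> 4 * exp s"
    using add_inverse_mono[OF assms(3,4)] one_plus_slit_length(3)[OF assms(2)] by simp
  then have "exp t * (norm z + 1 / norm z + 2) \<le> exp t * (4 * exp s)" by (intro mult_left_mono) auto
  then have "norm (slit_map t z) + 1 / norm (slit_map t z) + 2 \<le> 4 * exp (s + t)"
    using norm_slit_map_add_inverse_le[OF assms(1,3)] by (simp only: exp_add mult_ac)
  also have "\<dots> = (1 + slit_length (s + t)) + 1 / (1 + slit_length (s + t)) + 2"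
    using one_plus_slit_length(3)[of "s + t"] assms by simp
  finally have "norm (slit_map t z) + 1 / norm (slit_map t z) \<le> (1 + slit_length (s + t)) + 1 / (1 + slit_length (s + t))"
    by (rule add_le_imp_le_right)
  then show ?thesis
    by (rule add_inverse_le_imp_le[rotated 2]) (use f1 slit_length_nonneg[of "s + t"] assms in linarith)+
qed

lemma conformal_slit_map_slit_map: "0 \<le> t \<Longrightarrow> conformal_slit_map t (slit_map t)"
  unfolding conformal_slit_map_def
proof (intro conjI)
  assume t: "0 \<le> t"
  note c = conformal_slit_map_slit_fun[OF t, unfolded conformal_slit_map_def]
  have eq: "slit_map t z = slit_fun t z" if "z \<in> exterior" for z
    using that slit_map_eq_slit_fun[OF t, of z] by (simp add: exterior_def)
  show "slit_map t holomorphic_on exterior"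
    by (rule holomorphic_transform[of "slit_fun t"]) (use c eq in auto)
  show "inj_on (slit_map t) exterior"
    using c inj_on_cong[of exterior "slit_map t" "slit_fun t"] eq by simp
  show "slit_map t ` exterior = exterior - slit t"
    using c image_cong[OF refl eq, of exterior] by simp
  have "(\<lambda>z. slit_map t z - complex_of_real (exp t) * z) \<in> O[at_infinity](\<lambda>_. 1)
      \<longleftrightarrow> (\<lambda>z. slit_fun t z - complex_of_real (exp t) * z) \<in> O[at_infinity](\<lambda>_. 1)"
    by (rule landau_o.big.in_cong)
       (use slit_map_eq_slit_fun[OF t] in \<open>auto simp: eventually_at_infinity\<close>)
  then show "(\<lambda>z. slit_map t z - complex_of_real (exp t) * z) \<in> O[at_infinity](\<lambda>_. 1)" using c by simp
qed

lemma continuous_on_slit_map: "0 \<le> t \<Longrightarrow> continuous_on {z. 1 \<le> norm z} (slit_map t)"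
  using continuous_on_slit_fun[of t] by (rule continuous_on_eq) (auto simp: slit_map_eq_slit_fun)

lemma slit_map_exterior: "0 \<le> t \<Longrightarrow> 1 < norm z \<Longrightarrow> 1 < norm (slit_map t z)"
  using norm_slit_map_ge[of t z] by simp

lemma koebe_inj_exterior:
  assumes "1 < norm z" "1 \<le> norm w" "koebe z = koebe w"
  shows "z = w"
proof -
  have "z * w \<noteq> 1"
  proof
    assume "z * w = 1"
    then have "norm z * norm w = 1" by (metis norm_mult norm_one)
    moreover have "norm z * 1 \<le> norm z * norm w" using assms by (intro mult_left_mono) auto
    ultimately show False using assms by simp
  qed
  moreover have "z \<noteq> 0" "w \<noteq> 0" using assms by auto
  ultimately show ?thesis using assms koebe_eq_iff by blast
qed

lemma slit_map_eqI:
  assumes "0 \<le> t" "1 < norm z" "1 \<le> norm w" "koebe w = of_real (exp t) * koebe z"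
  shows "slit_map t z = w"
proof (rule koebe_inj_exterior)
  show "1 < norm (slit_map t z)" by (rule slit_map_exterior[OF assms(1,2)])
  show "koebe (slit_map t z) = koebe w" using koebe_slit_map[of t z] assms by simp
qed fact

lemma slit_map_0 [simp]: "1 < norm z \<Longrightarrow> slit_map 0 z = z"
  by (rule slit_map_eqI) auto

lemma slit_map_add:
  assumes "0 \<le> s" "0 \<le> t" "1 < norm z"
  shows "slit_map s (slit_map t z) = slit_map (s + t) z"
proof (rule slit_map_eqI[symmetric])
  have 1: "1 < norm (slit_map t z)" by (rule slit_map_exterior[OF assms(2,3)])
  show "1 \<le> norm (slit_map s (slit_map t z))" using slit_map_exterior[OF assms(1) 1] by simp
  show "koebe (slit_map s (slit_map t z)) = of_real (exp (s + t)) * koebe z"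
    using koebe_slit_map[OF assms(1), of "slit_map t z"] koebe_slit_map[OF assms(2), of z] 1 assms
    by (simp add: exp_add)
qed (use assms in auto)

lemma slit_map_mem_slit_iff:
  assumes t: "0 \<le> t" and x: "\<bar>x\<bar> \<le> pi"
  shows "slit_map t (cis x) \<in> slit t \<longleftrightarrow> \<bar>x\<bar> < arc_angle t"
proof -
  have "cos (x / 2) = cos (\<bar>x\<bar> / 2)" by (simp add: abs_if)
  have c0: "0 \<le> cos (\<bar>x\<bar> / 2)" using x by (intro cos_ge_zero) auto
  define k where "k = exp t * (4 * (cos (\<bar>x\<bar> / 2))\<^sup>2)"
  have K: "koebe (slit_map t (cis x)) = of_real k"
    using koebe_slit_map[OF t, of "cis x"] by (simp add: koebe_of_cis k_def \<open>cos (x / 2) = _\<close>)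
  have "(cos (\<bar>x\<bar> / 2))\<^sup>2 \<le> 1" using c0 by (simp add: power_le_one)
  then have k4: "k \<le> 4 * exp t" unfolding k_def by simp
  have "1 \<le> norm (slit_map t (cis x))" using norm_slit_map_ge[OF t, of "cis x"] by simp
  then have "slit_map t (cis x) \<in> slit t \<longleftrightarrow> 4 < k"
    using mem_slit_iff[OF t] K k4 by auto
  also have "\<dots> \<longleftrightarrow> exp (- t) < (cos (\<bar>x\<bar> / 2))\<^sup>2"
    by (simp add: k_def exp_minus field_simps)
  also have "exp (- t) = (cos (arc_angle t / 2))\<^sup>2"
    unfolding cos_arc_angle_half[OF t] by (simp add: power2_eq_square flip: exp_add)
  also have "(cos (arc_angle t / 2))\<^sup>2 < (cos (\<bar>x\<bar> / 2))\<^sup>2 \<longleftrightarrow> cos (arc_angle t / 2) < cos (\<bar>x\<bar> / 2)"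
    using c0 cos_arc_angle_half[OF t] power_strict_mono[of "cos (arc_angle t / 2)" "cos (\<bar>x\<bar> / 2)" 2]
      power2_less_imp_less[of "cos (arc_angle t / 2)" "cos (\<bar>x\<bar> / 2)"] by auto
  also have "\<dots> \<longleftrightarrow> \<bar>x\<bar> < arc_angle t"
    using arc_angle_bounds[OF t] x by (subst cos_mono_less_eq) auto
  finally show ?thesis .
qed

lemma ex_cis_eq:
  assumes "norm z = 1"
  obtains x where "z = cis x" "- pi < x" "x \<le> pi"
proof (rule that)
  have "z \<noteq> 0" using assms by auto
  then show "z = cis (Arg z)" using cis_Arg[of z] assms by (simp add: sgn_eq)
qed (use Arg_bounded[of z] in auto)

lemma slit_preimage:
  assumes t: "0 \<le> t"
  shows "{z. 1 \<le> norm z \<and> slit_map t z \<in> slit t} = {cis x | x. \<bar>x\<bar> < arc_angle t}"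
proof (intro equalityI subsetI)
  fix z assume "z \<in> {z. 1 \<le> norm z \<and> slit_map t z \<in> slit t}"
  then have z: "1 \<le> norm z" "slit_map t z \<in> slit t" by auto
  then have "norm z = 1" using slit_fun_mem_slit_imp[OF t] slit_map_eq_slit_fun[OF t] by simp
  then obtain x where x: "z = cis x" "- pi < x" "x \<le> pi" by (rule ex_cis_eq)
  then show "z \<in> {cis x | x. \<bar>x\<bar> < arc_angle t}" using slit_map_mem_slit_iff[OF t, of x] z by auto
next
  fix z assume "z \<in> {cis x | x. \<bar>x\<bar> < arc_angle t}"
  then obtain x where "z = cis x" "\<bar>x\<bar> < arc_angle t" by auto
  then show "z \<in> {z. 1 \<le> norm z \<and> slit_map t z \<in> slit t}"
    using slit_map_mem_slit_iff[OF t, of x] arc_angle_bounds[OF t] by auto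
qed

lemma cis_arc_subset_imp_le:
  assumes "{cis x | x. \<bar>x\<bar> < a} \<subseteq> {cis x | x. \<bar>x\<bar> < b}" "0 < a" "a \<le> pi" "0 < b" "b \<le> pi"
  shows "a \<le> b"
proof (rule ccontr)
  assume "\<not> a \<le> b"
  then have "cis b \<in> {cis x | x. \<bar>x\<bar> < a}" using assms by auto
  then obtain y where y: "cis b = cis y" "\<bar>y\<bar> < b" using assms by auto
  then have "cos b = cos \<bar>y\<bar>" by (metis cis.sel(1) cos_abs_real)
  then show False using cos_monotone_0_pi[of "\<bar>y\<bar>" b] y assms by simp
qed

lemma slit_angle_eq:
  assumes t: "0 < t"
  shows "slit_angle t = arc_angle t"
  unfolding slit_angle_def
proof (rule the_equality)
  show "0 < arc_angle t \<and> arc_angle t < pi \<and>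
      {z. 1 \<le> norm z \<and> slit_map t z \<in> slit t} = {cis x | x. \<bar>x\<bar> < arc_angle t}"
    using slit_preimage[of t] arc_angle_pos[OF t] arc_angle_bounds[of t] t by auto
next
  fix b assume b: "0 < b \<and> b < pi \<and> {z. 1 \<le> norm z \<and> slit_map t z \<in> slit t} = {cis x | x. \<bar>x\<bar> < b}"
  then have "{cis x | x. \<bar>x\<bar> < b} = {cis x | x. \<bar>x\<bar> < arc_angle t}"
    using slit_preimage[of t] t by auto
  then have "{cis x | x. \<bar>x\<bar> < b} \<subseteq> {cis x | x. \<bar>x\<bar> < arc_angle t}"
    "{cis x | x. \<bar>x\<bar> < arc_angle t} \<subseteq> {cis x | x. \<bar>x\<bar> < b}" by simp_all
  then show "b = arc_angle t"
    using cis_arc_subset_imp_le[of b "arc_angle t"] cis_arc_subset_imp_le[of "arc_angle t" b]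
      b arc_angle_pos[OF t] arc_angle_bounds[of t] t by linarith
qed

lemma slit_map_arc_angle:
  assumes t: "0 \<le> t" and x: "x = arc_angle t \<or> x = - arc_angle t"
  shows "slit_map t (cis x) = 1"
proof -
  have "koebe (cis x) = of_real (4 * (cos (arc_angle t / 2))\<^sup>2)"
    using x by (auto simp: koebe_of_cis)
  also have "(cos (arc_angle t / 2))\<^sup>2 = exp (- t)"
    unfolding cos_arc_angle_half[OF t] by (simp add: power2_eq_square flip: exp_add)
  finally have "koebe (slit_map t (cis x)) = of_real (exp t) * of_real (4 * exp (- t))"
    using koebe_slit_map[OF t, of "cis x"] by simp
  also have "\<dots> = 4" by (simp add: exp_minus)
  finally have "koebe (slit_map t (cis x)) - 4 = 0" by simp
  moreover have "slit_map t (cis x) \<noteq> 0" using slit_map_neq_0[OF t, of "cis x"] by simp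
  ultimately show ?thesis using koebe_minus_4_eq by fastforce
qed

lemma slit_map_sector:
  assumes t: "0 \<le> t" and \<rho>: "1 < \<rho>" and x: "\<bar>x\<bar> < pi"
  obtains y where "slit_map t (of_real \<rho> * cis x) = of_real (norm (slit_map t (of_real \<rho> * cis x))) * cis y"
    "min 0 x \<le> y" "y \<le> max 0 x"
proof -
  define z where "z = of_real \<rho> * cis x"
  define w where "w = slit_map t z"
  have z: "norm z = \<rho>" "Re z = \<rho> * cos x" "Im z = \<rho> * sin x" using \<rho> by (auto simp: z_def norm_mult)
  have z1: "1 \<le> norm z" "z \<noteq> 0" using z \<rho> by auto
  have w1: "1 < norm w" using slit_map_exterior[OF t, of z] z \<rho> by (simp add: w_def)
  then have w0: "w \<noteq> 0" by auto
  have q: "koebe w = of_real (exp t) * koebe z" unfolding w_def by (rule koebe_slit_map[OF t z1(1)])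
  have E: "1 \<le> exp t" using t by simp
  have "norm (koebe w - 4) \<le> norm (of_real (exp t - 1) * koebe z) + norm (koebe z - 4)"
    unfolding q using norm_triangle_ineq[of "of_real (exp t - 1) * koebe z" "koebe z - 4"]
    by (simp add: algebra_simps)
  also have "norm (of_real (exp t - 1) * koebe z) = exp t * norm (koebe z) - norm (koebe z)"
    using E by (simp only: norm_mult norm_of_real) (simp add: algebra_simps)
  also have "exp t * norm (koebe z) = norm (koebe w)" by (simp add: q norm_mult)
  finally have "4 * (Re z / norm z) \<le> 4 * (Re w / norm w)"
    using koebe_hyperbola[OF w0] koebe_hyperbola[OF z1(2)] by simp
  then have c: "cos x \<le> Re w / norm w" using z \<rho> by simp
  have wy: "w = of_real (norm w) * cis (Arg w)" using w0 by (simp add: cis_Arg sgn_eq)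
  have "Re w = norm w * cos (Arg w)" "Im w = norm w * sin (Arg w)"
    using arg_cong[OF wy, of Re] arg_cong[OF wy, of Im] by simp_all
  then have c': "cos \<bar>x\<bar> \<le> cos \<bar>Arg w\<bar>" and Iw: "Im w = norm w * sin (Arg w)" using c w0 by auto
  have A: "- pi < Arg w" "Arg w \<le> pi" using Arg_bounded[of w] by auto
  have ax: "\<bar>Arg w\<bar> \<le> \<bar>x\<bar>"
    using c' A x cos_monotone_0_pi[of "\<bar>x\<bar>" "\<bar>Arg w\<bar>"] by fastforce
  have im: "Im (koebe v) = Im v * (1 - 1 / (norm v)\<^sup>2)" for v
    by (simp add: koebe_def Im_divide cmod_power2 algebra_simps)
  have "Im w * (1 - 1 / (norm w)\<^sup>2) = exp t * (Im z * (1 - 1 / (norm z)\<^sup>2))"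
    using im[of w] im[of z] q by simp
  moreover have "0 < 1 - 1 / (norm w)\<^sup>2" "0 < 1 - 1 / (norm z)\<^sup>2"
    using w1 z \<rho> by (auto simp: divide_less_eq one_less_power)
  ultimately have sg: "0 < Im w \<longleftrightarrow> 0 < Im z" "Im w < 0 \<longleftrightarrow> Im z < 0"
    by (smt (verit) exp_gt_zero zero_less_mult_iff, smt (verit) exp_gt_zero mult_less_0_iff)
  have "min 0 x \<le> Arg w \<and> Arg w \<le> max 0 x"
  proof (cases "x = 0")
    case False
    consider "0 < x" | "x < 0" using False by linarith
    then show ?thesis
    proof cases
      case 1
      then have "0 < sin x" using x by (intro sin_gt_zero) auto
      then have "0 < Im w" using sg z \<rho> by simp
      then have "0 < sin (Arg w)" using Iw w1 by (simp add: zero_less_mult_iff)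
      then have "0 < Arg w" using A sin_ge_zero[of "- Arg w"] by force
      then show ?thesis using 1 ax by simp
    next
      case 2
      then have "sin x < 0" using x sin_gt_zero[of "- x"] by simp
      then have "Im w < 0" using sg z \<rho> by (simp add: mult_less_0_iff)
      then have "sin (Arg w) < 0" using Iw w1 by (simp add: mult_less_0_iff)
      then have "Arg w < 0" using A sin_ge_zero[of "Arg w"] by force
      then show ?thesis using 2 ax by simp
    qed
  qed (use ax in auto)
  then show ?thesis using that[of "Arg w"] wy by (simp add: w_def z_def)
qed

lemma norm_deriv_slit_map:
  assumes t: "0 \<le> t" and z: "1 < norm z"
  shows "norm (deriv (slit_map t) z) =
    norm (slit_map t z) / norm z * sqrt (norm (koebe z - 4) / norm (koebe z - of_real (4 * exp (- t))))"
    and "koebe z \<noteq> of_real (4 * exp (- t))"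
proof -
  define w where "w = slit_map t z"
  define E where "E = complex_of_real (exp t)"
  define d where "d = deriv (slit_map t) z"
  have z0: "z \<noteq> 0" using z by auto
  have "1 < norm w" using slit_map_exterior[OF t z] by (simp add: w_def)
  then have w0: "w \<noteq> 0" by auto
  have op: "open exterior" unfolding exterior_def by (rule open_norm_greater)
  have zi: "z \<in> exterior" using z by (simp add: exterior_def)
  have d: "(slit_map t has_field_derivative d) (at z)"
    using conformal_slit_map_slit_map[OF t] op zi unfolding d_def conformal_slit_map_def
    by (auto intro: holomorphic_derivI)
  have "((\<lambda>z. slit_map t z + 1 / slit_map t z + 2) has_field_derivative d - d / w\<^sup>2) (at z)"
    using d w0 by (auto intro!: derivative_eq_intros simp: w_def power2_eq_square field_simps)
  moreover have "((\<lambda>z. E * (z + 1 / z + 2)) has_field_derivative E * (1 - 1 / z\<^sup>2)) (at z)"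
    using z0 by (auto intro!: derivative_eq_intros simp: power2_eq_square)
  then have "((\<lambda>z. slit_map t z + 1 / slit_map t z + 2) has_field_derivative E * (1 - 1 / z\<^sup>2)) (at z)"
    by (rule has_field_derivative_transform_within_open[OF _ op zi])
       (use koebe_slit_map[OF t] in \<open>auto simp: exterior_def koebe_def E_def\<close>)
  ultimately have eq: "d - d / w\<^sup>2 = E * (1 - 1 / z\<^sup>2)" by (rule DERIV_unique)
  define p where "p = koebe z"
  have kw: "koebe w = E * p" using koebe_slit_map[OF t, of z] z by (simp add: w_def p_def E_def)
  have sq: "(v - 1 / v)\<^sup>2 = koebe v * (koebe v - 4)" if "v \<noteq> 0" for v
    using that by (simp add: koebe_def field_simps power2_eq_square)
  have "d / w * z * (w - 1 / w) = z * (d - d / w\<^sup>2)" using w0 by (simp add: field_simps power2_eq_square)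
  also have "\<dots> = E * (z - 1 / z)" unfolding eq using z0 by (simp add: field_simps power2_eq_square)
  finally have "(d / w * z)\<^sup>2 * (w - 1 / w)\<^sup>2 = E\<^sup>2 * (z - 1 / z)\<^sup>2" by (simp flip: power_mult_distrib)
  then have m: "(d / w * z)\<^sup>2 * (E * p * (E * p - 4)) = E\<^sup>2 * (p * (p - 4))"
    unfolding sq[OF w0] sq[OF z0] kw p_def .
  have nz: "koebe v \<noteq> of_real r" if "1 < norm v" "0 \<le> r" "r \<le> 4" for v r
    using norm_eq_1_if_koebe_mem[of v r] that by auto
  have p0: "p \<noteq> 0" using nz[of z 0] z by (simp add: p_def)
  show pe: "koebe z \<noteq> of_real (4 * exp (- t))" using nz[of z "4 * exp (- t)"] z t by simp
  have Ei: "of_real (4 * exp (- t)) = 4 / E" by (simp add: E_def exp_minus field_simps)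
  have E0: "E \<noteq> 0" by (simp add: E_def)
  have "(d / w * z)\<^sup>2 * (p - 4 / E) = p - 4"
  proof -
    have "E\<^sup>2 * p * (X * (p - 4 / E)) = X * (E * p * (E * p - 4))" for X
      using E0 by (simp add: field_simps power2_eq_square)
    then have "E\<^sup>2 * p * ((d / w * z)\<^sup>2 * (p - 4 / E)) = (d / w * z)\<^sup>2 * (E * p * (E * p - 4))" .
    also have "\<dots> = E\<^sup>2 * p * (p - 4)" unfolding m by simp
    finally show ?thesis using E0 p0 by simp
  qed
  then have "(norm (d / w * z))\<^sup>2 * norm (p - 4 / E) = norm (p - 4)" by (metis norm_mult norm_power)
  moreover have "norm (p - 4 / E) \<noteq> 0" using pe unfolding p_def Ei by simp
  ultimately have "(norm (d / w * z))\<^sup>2 = norm (p - 4) / norm (p - 4 / E)" by (simp add: field_simps)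
  then have "norm (d / w * z) = sqrt (norm (p - 4) / norm (p - 4 / E))" by (metis norm_ge_zero real_sqrt_abs abs_of_nonneg)
  then have "norm d * norm z / norm w = sqrt (norm (p - 4) / norm (p - 4 / E))" by (simp add: norm_mult norm_divide)
  then have "norm d = norm w / norm z * sqrt (norm (p - 4) / norm (p - 4 / E))" using w0 z0 by (simp add: field_simps)
  then show "norm (deriv (slit_map t) z) =
    norm (slit_map t z) / norm z * sqrt (norm (koebe z - 4) / norm (koebe z - of_real (4 * exp (- t))))"
    unfolding Ei by (simp add: d_def w_def p_def)
qed

section \<open>Rotated slit maps and cluster maps\<close>

lemma norm_cis_mult [simp]: "norm (cis x * z) = norm z"
  by (simp add: norm_mult)

lemma cis_minus_cis: "cis (- x) * (cis x * z) = z" "cis x * (cis (- x) * z) = z"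
  by (simp_all add: cis_mult flip: mult.assoc)

lemma norm_cis_minus_1_le: "norm (cis x - 1) \<le> \<bar>x\<bar>"
  using dist_exp_i_1[of x] abs_sin_x_le_abs_x[of "x / 2"] by (simp add: cis_conv_exp)

lemma cis_minus_eq: "cis x = cis y \<Longrightarrow> cis (- x) = cis (- y)"
  by (metis cis_cnj)

lemma rotated_slit_map_cong: "cis x = cis y \<Longrightarrow> rotated_slit_map t x = rotated_slit_map t y"
  using cis_minus_eq[of x y] by (simp add: rotated_slit_map_def[abs_def])

lemma norm_rotated_slit_map: "norm (rotated_slit_map t x z) = norm (slit_map t (cis (- x) * z))"
  by (simp add: rotated_slit_map_def)

lemma norm_rotated_slit_map_ge: "0 \<le> t \<Longrightarrow> 1 \<le> norm z \<Longrightarrow> norm z \<le> norm (rotated_slit_map t x z)"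
  using norm_slit_map_ge[of t "cis (- x) * z"] by (simp add: norm_rotated_slit_map)

lemma rotated_slit_map_add:
  "0 \<le> s \<Longrightarrow> 0 \<le> t \<Longrightarrow> 1 < norm z \<Longrightarrow>
    rotated_slit_map s x (rotated_slit_map t x z) = rotated_slit_map (s + t) x z"
  by (simp add: rotated_slit_map_def cis_minus_cis slit_map_add)

lemma rotated_slit_map_conformal:
  assumes t: "0 \<le> t"
  shows "rotated_slit_map t x holomorphic_on exterior" "inj_on (rotated_slit_map t x) exterior"
    "rotated_slit_map t x ` exterior = exterior - (\<lambda>z. cis x * z) ` slit t"
    "((\<lambda>z. rotated_slit_map t x z / z) \<longlongrightarrow> of_real (exp t)) at_infinity"
proof -
  have rot: "(\<lambda>z. cis y * z) ` exterior = exterior" for y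
  proof (intro equalityI subsetI)
    fix z assume "z \<in> exterior"
    then show "z \<in> (\<lambda>z. cis y * z) ` exterior"
      by (intro image_eqI[of _ _ "cis (- y) * z"]) (auto simp: exterior_def cis_minus_cis)
  qed (auto simp: exterior_def)
  have eq: "rotated_slit_map t x = (\<lambda>z. cis x * z) \<circ> slit_map t \<circ> (\<lambda>z. cis (- x) * z)"
    by (auto simp: rotated_slit_map_def)
  note c = conformal_slit_map_slit_map[OF t, unfolded conformal_slit_map_def]
  show "rotated_slit_map t x holomorphic_on exterior"
    unfolding eq o_def
    by (intro holomorphic_intros holomorphic_on_compose_gen[OF _ conjunct1[OF c], unfolded o_def])
       (auto simp: exterior_def)
  have inj: "inj_on (\<lambda>z. cis y * z) S" for y S by (simp add: inj_on_def)
  then show "inj_on (rotated_slit_map t x) exterior"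
    unfolding eq using c rot[of "- x"]
    by (intro comp_inj_on inj) auto
  have "rotated_slit_map t x ` exterior = (\<lambda>z. cis x * z) ` (exterior - slit t)"
    unfolding eq image_comp[symmetric] rot using c by simp
  also have "\<dots> = exterior - (\<lambda>z. cis x * z) ` slit t"
    using inj[of x UNIV] by (simp add: image_set_diff rot)
  finally show "rotated_slit_map t x ` exterior = exterior - (\<lambda>z. cis x * z) ` slit t" .
  have "filterlim (\<lambda>z. cis (- x) * z) at_infinity at_infinity"
    by (rule tendsto_mult_filterlim_at_infinity[OF tendsto_const]) (auto intro: filterlim_ident)
  from filterlim_compose[OF conformal_slit_map_lim[OF conformal_slit_map_slit_map[OF t]] this]
  have "((\<lambda>z. slit_map t (cis (- x) * z) / (cis (- x) * z)) \<longlongrightarrow> of_real (exp t)) at_infinity" .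
  moreover have "slit_map t (cis (- x) * z) / (cis (- x) * z) = rotated_slit_map t x z / z" for z
    by (simp add: rotated_slit_map_def cis_inverse[symmetric] divide_simps del: cis_inverse)
  ultimately show "((\<lambda>z. rotated_slit_map t x z / z) \<longlongrightarrow> of_real (exp t)) at_infinity" by simp
qed

lemma foldr_comp_conv: "foldr (\<lambda>i g. h i \<circ> g) xs g = foldr (\<lambda>i g. h i \<circ> g) xs id \<circ> g"
  by (induction xs) (auto simp: o_assoc)

lemma cluster_map_0 [simp]: "cluster_map c \<theta> 0 z = z"
  by (simp add: cluster_map_def compose_from_to_def)

lemma cluster_map_Suc: "cluster_map c \<theta> (Suc n) z = cluster_map c \<theta> n (rotated_slit_map c (\<theta> (Suc n)) z)"
proof -
  have "[1..<Suc (Suc n)] = [1..<Suc n] @ [Suc n]" by simp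
  then have "cluster_map c \<theta> (Suc n) = foldr (\<lambda>i g. rotated_slit_map c (\<theta> i) \<circ> g) [1..<Suc n]
      (rotated_slit_map c (\<theta> (Suc n)))"
    by (simp add: cluster_map_def compose_from_to_def)
  then show ?thesis
    by (subst (asm) foldr_comp_conv) (simp add: cluster_map_def compose_from_to_def)
qed

lemma cluster_map_cong:
  "(\<And>i. 1 \<le> i \<Longrightarrow> i \<le> n \<Longrightarrow> \<theta> i = \<theta>' i) \<Longrightarrow> cluster_map c \<theta> n z = cluster_map c \<theta>' n z"
  by (induction n arbitrary: z) (auto simp: cluster_map_Suc)

lemma rotated_slit_map_exterior: "0 \<le> t \<Longrightarrow> 1 < norm z \<Longrightarrow> 1 < norm (rotated_slit_map t x z)"
  using norm_rotated_slit_map_ge[of t z x] by simp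

lemma norm_cluster_map_ge: "0 \<le> c \<Longrightarrow> 1 \<le> norm z \<Longrightarrow> norm z \<le> norm (cluster_map c \<theta> n z)"
proof (induction n arbitrary: z)
  case (Suc n)
  have "norm z \<le> norm (rotated_slit_map c (\<theta> (Suc n)) z)"
    using Suc.prems by (intro norm_rotated_slit_map_ge)
  then show ?case using Suc.IH[of "rotated_slit_map c (\<theta> (Suc n)) z"] Suc.prems
    by (simp add: cluster_map_Suc)
qed simp

lemma cluster_map_conformal:
  assumes c: "0 \<le> c"
  shows "cluster_map c \<theta> n holomorphic_on exterior" "inj_on (cluster_map c \<theta> n) exterior"
    "\<And>z. z \<in> exterior \<Longrightarrow> norm (cluster_map c \<theta> n z) \<le> (4 * exp c) ^ n * norm z"
    "((\<lambda>z. cluster_map c \<theta> n z / z) \<longlongrightarrow> of_real (exp (c * n))) at_infinity"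
proof -
  have "cluster_map c \<theta> n holomorphic_on exterior \<and> inj_on (cluster_map c \<theta> n) exterior \<and>
    (\<forall>z \<in> exterior. norm (cluster_map c \<theta> n z) \<le> (4 * exp c) ^ n * norm z) \<and>
    ((\<lambda>z. cluster_map c \<theta> n z / z) \<longlongrightarrow> of_real (exp (c * n))) at_infinity"
  proof (induction n)
    case 0
    have "cluster_map c \<theta> 0 = (\<lambda>z. z)" by auto
    moreover have "((\<lambda>z::complex. z / z) \<longlongrightarrow> 1) at_infinity"
      by (rule tendsto_eventually) (use eventually_not_equal_at_infinity[of 0] in \<open>auto elim: eventually_mono\<close>)
    ultimately show ?case by (auto intro!: holomorphic_intros)
  next
    case (Suc n)
    define F where "F = rotated_slit_map c (\<theta> (Suc n))"
    note F = rotated_slit_map_conformal[OF c, of "\<theta> (Suc n)", folded F_def]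
    have eq: "cluster_map c \<theta> (Suc n) = cluster_map c \<theta> n \<circ> F"
      by (auto simp: cluster_map_Suc F_def)
    have sub: "F ` exterior \<subseteq> exterior" using F(3) by auto
    have "cluster_map c \<theta> n \<circ> F holomorphic_on exterior"
      by (rule holomorphic_on_compose_gen[OF F(1) _ sub]) (use Suc in blast)
    moreover have "inj_on (cluster_map c \<theta> n \<circ> F) exterior"
      using F(2) Suc sub by (auto intro!: comp_inj_on intro: inj_on_subset)
    moreover have "norm ((cluster_map c \<theta> n \<circ> F) z) \<le> (4 * exp c) ^ Suc n * norm z" if z: "z \<in> exterior" for z
    proof -
      have "norm (F z) \<le> 4 * exp c * norm z"
        unfolding F_def norm_rotated_slit_map using norm_slit_map_le[OF c, of "cis (- \<theta> (Suc n)) * z"] z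
        by (simp add: exterior_def)
      then have "(4 * exp c) ^ n * norm (F z) \<le> (4 * exp c) ^ n * (4 * exp c * norm z)"
        by (intro mult_left_mono) auto
      moreover have "norm (cluster_map c \<theta> n (F z)) \<le> (4 * exp c) ^ n * norm (F z)"
        using Suc sub z by auto
      ultimately have "norm (cluster_map c \<theta> n (F z)) \<le> (4 * exp c) ^ n * (4 * exp c * norm z)" by linarith
      then show ?thesis by (simp only: o_def power_Suc2 mult.assoc)
    qed
    moreover have "((\<lambda>z. (cluster_map c \<theta> n \<circ> F) z / z) \<longlongrightarrow> of_real (exp (c * Suc n))) at_infinity"
    proof -
      have "filterlim (\<lambda>z. F z / z * z) at_infinity at_infinity"
        by (rule tendsto_mult_filterlim_at_infinity[OF F(4)]) (auto intro: filterlim_ident)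
      moreover have "\<forall>\<^sub>F z in at_infinity. F z / z * z = F z"
        using eventually_not_equal_at_infinity[of 0] by eventually_elim simp
      ultimately have Finf: "filterlim F at_infinity at_infinity"
        by (rule filterlim_mono_eventually[OF _ order_refl order_refl])
      have "((\<lambda>z. cluster_map c \<theta> n (F z) / F z) \<longlongrightarrow> of_real (exp (c * n))) at_infinity"
        using filterlim_compose[OF _ Finf] Suc by blast
      then have "((\<lambda>z. cluster_map c \<theta> n (F z) / F z * (F z / z)) \<longlongrightarrow>
          of_real (exp (c * n)) * of_real (exp c)) at_infinity"
        by (intro tendsto_mult F(4))
      moreover have "complex_of_real (exp (c * n)) * of_real (exp c) = of_real (exp (c * Suc n))"
        by (simp add: exp_add distrib_left flip: of_real_mult)
      moreover have "\<forall>\<^sub>F z in at_infinity. cluster_map c \<theta> n (F z) / F z * (F z / z) = (cluster_map c \<theta> n \<circ> F) z / z"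
        using filterlim_at_infinity_imp_eventually_ne[OF Finf, of 0] by eventually_elim simp
      ultimately show ?thesis by (auto intro: Lim_transform_eventually)
    qed
    ultimately show ?case unfolding eq by blast
  qed
  then show "cluster_map c \<theta> n holomorphic_on exterior" "inj_on (cluster_map c \<theta> n) exterior"
    "\<And>z. z \<in> exterior \<Longrightarrow> norm (cluster_map c \<theta> n z) \<le> (4 * exp c) ^ n * norm z"
    "((\<lambda>z. cluster_map c \<theta> n z / z) \<longlongrightarrow> of_real (exp (c * n))) at_infinity" by blast+
qed

lemma norm_cluster_map_le_slit_length:
  assumes "0 \<le> c" "0 \<le> s" "1 \<le> norm z" "norm z \<le> 1 + slit_length s"
  shows "norm (cluster_map c \<theta> n z) \<le> 1 + slit_length (s + c * n)"
  using assms
proof (induction n arbitrary: z s)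
  case (Suc n)
  have "norm (rotated_slit_map c (\<theta> (Suc n)) z) \<le> 1 + slit_length (s + c)"
    using norm_slit_map_le_slit_length[of c s "cis (- \<theta> (Suc n)) * z"] Suc.prems
    by (simp add: norm_rotated_slit_map)
  moreover have "1 \<le> norm (rotated_slit_map c (\<theta> (Suc n)) z)"
    using norm_rotated_slit_map_ge[of c z "\<theta> (Suc n)"] Suc.prems by linarith
  ultimately have "norm (cluster_map c \<theta> n (rotated_slit_map c (\<theta> (Suc n)) z)) \<le> 1 + slit_length ((s + c) + c * n)"
    using Suc.prems by (intro Suc.IH) auto
  then show ?case by (simp add: cluster_map_Suc algebra_simps)
qed simp

lemma cluster_eq:
  assumes c: "0 \<le> c"
  shows "cluster c \<theta> n = cball 0 1 \<union> (\<Union>j<n. (\<lambda>y. cluster_map c \<theta> j (cis (\<theta> (Suc j)) * y)) ` slit c)"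
proof (induction n)
  case 0
  have "cluster_map c \<theta> 0 ` exterior = exterior" by (simp add: image_def)
  then show ?case by (auto simp: cluster_def exterior_def)
next
  case (Suc n)
  define S where "S = (\<lambda>z. cis (\<theta> (Suc n)) * z) ` slit c"
  have S: "S \<subseteq> exterior" by (auto simp: S_def slit_def exterior_def norm_mult)
  have "cluster_map c \<theta> (Suc n) ` exterior = cluster_map c \<theta> n ` (rotated_slit_map c (\<theta> (Suc n)) ` exterior)"
    by (simp add: cluster_map_Suc image_image)
  also have "\<dots> = cluster_map c \<theta> n ` (exterior - S)"
    unfolding rotated_slit_map_conformal(3)[OF c] S_def ..
  also have "\<dots> = cluster_map c \<theta> n ` exterior - cluster_map c \<theta> n ` S"
    using S by (intro inj_on_image_set_diff[OF cluster_map_conformal(2)[OF c]]) auto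
  finally have "cluster c \<theta> (Suc n) = cluster c \<theta> n \<union> cluster_map c \<theta> n ` S"
    by (auto simp: cluster_def)
  then show ?case unfolding Suc by (auto simp: S_def lessThan_Suc image_image)
qed

lemma cluster_mono: "0 \<le> c \<Longrightarrow> m \<le> n \<Longrightarrow> cluster c \<theta> m \<subseteq> cluster c \<theta> n"
  unfolding cluster_eq by (auto intro: order_less_le_trans)

section \<open>Parents\<close>

lemma has_parent_pred_iff:
  assumes c: "0 < c" and j: "1 \<le> j"
  shows "has_parent c \<theta> j (j - 1) \<longleftrightarrow>
    j = 1 \<or> (\<exists>x. cis (\<theta> j - \<theta> (j - 1)) = cis x \<and> \<bar>x\<bar> < arc_angle c)"
proof -
  note ang = slit_angle_eq[OF c]
  have base: "rotated_slit_map c (\<theta> j) (cis x) = cis (\<theta> j)"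
    if "x \<in> {\<theta> j + slit_angle c, \<theta> j - slit_angle c}" for x
  proof -
    have "cis (- \<theta> j) * cis x = cis (x - \<theta> j)" by (simp add: cis_mult)
    moreover have "slit_map c (cis (x - \<theta> j)) = 1"
      using that c by (intro slit_map_arc_angle) (auto simp: ang)
    ultimately show ?thesis by (simp add: rotated_slit_map_def)
  qed
  show ?thesis
  proof (cases "j = 1")
    case True
    then show ?thesis using base by (auto simp: has_parent_def cluster_map_Suc[of _ _ 0, simplified])
  next
    case False
    then obtain k where k: "j = Suc k" "1 \<le> k" using j by (cases j) auto
    have up: "[k..<Suc (Suc k)] = [k, Suc k]" by (simp add: upt_rec)
    have comp: "cis (- \<theta> k) * compose_from_to c \<theta> k j (cis x) = slit_map c (cis (\<theta> j - \<theta> k))"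
      if "x \<in> {\<theta> j + slit_angle c, \<theta> j - slit_angle c}" for x
    proof -
      have "compose_from_to c \<theta> k j (cis x) = rotated_slit_map c (\<theta> k) (rotated_slit_map c (\<theta> j) (cis x))"
        by (simp add: compose_from_to_def k(1) up)
      also have "\<dots> = rotated_slit_map c (\<theta> k) (cis (\<theta> j))" by (simp only: base[OF that])
      finally show ?thesis by (simp add: rotated_slit_map_def cis_minus_cis cis_mult)
    qed
    have "has_parent c \<theta> j (j - 1) \<longleftrightarrow> slit_map c (cis (\<theta> j - \<theta> k)) \<in> slit c"
      using k comp by (auto simp: has_parent_def)
    also have "\<dots> \<longleftrightarrow> cis (\<theta> j - \<theta> k) \<in> {z. 1 \<le> norm z \<and> slit_map c z \<in> slit c}" by simp
    also have "\<dots> \<longleftrightarrow> (\<exists>x. cis (\<theta> j - \<theta> k) = cis x \<and> \<bar>x\<bar> < arc_angle c)"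
      using c by (subst slit_preimage) auto
    finally show ?thesis using k by simp
  qed
qed

section \<open>Comparison with the straight slit\<close>

lemma exp_minus_1_le: "0 \<le> (c::real) \<Longrightarrow> c \<le> 1 \<Longrightarrow> exp c - 1 \<le> 2 * c"
  using exp_bound[of c] mult_left_le[of c c] by (simp add: power2_eq_square)

lemma norm_one_minus_inverse_ge:
  fixes z w a :: complex
  assumes "1 < r" "r \<le> norm z" "r \<le> norm w" "norm a = 1"
  shows "1 - 1 / r\<^sup>2 \<le> norm (1 - a / (z * w))" "0 < 1 - 1 / r\<^sup>2"
proof -
  have "r * r \<le> norm z * norm w" using assms by (intro mult_mono) auto
  then have "norm (a / (z * w)) \<le> 1 / r\<^sup>2"
    using assms by (simp add: norm_divide norm_mult power2_eq_square frac_le)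
  then show "1 - 1 / r\<^sup>2 \<le> norm (1 - a / (z * w))"
    using norm_triangle_ineq2[of 1 "a / (z * w)"] by simp
  show "0 < 1 - 1 / r\<^sup>2" using assms by (simp add: one_less_power divide_less_eq)
qed

context
  fixes r q :: real
  assumes r: "1 < r" and q: "q = 1 - 1 / r\<^sup>2"
begin

lemma q_pos: "0 < q"
  using r by (simp add: q one_less_power divide_less_eq)

lemma slit_map_displacement:
  assumes c: "0 \<le> c" "c \<le> 1" and z: "r \<le> norm z"
  shows "norm (slit_map c z - z) \<le> 8 * c / q * norm z" "norm (1 / slit_map c z - 1 / z) \<le> 8 * c / q"
proof -
  define w where "w = slit_map c z"
  have z1: "1 \<le> norm z" "z \<noteq> 0" using z r by auto
  have "norm z \<le> norm w" unfolding w_def by (rule norm_slit_map_ge[OF c(1) z1(1)])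
  then have w0: "w \<noteq> 0" "r \<le> norm w" "1 \<le> norm w" using z r by auto
  have "(w - z) * (1 - 1 / (w * z)) = of_real (exp c - 1) * koebe z"
    using koebe_diff[OF w0(1) z1(2)] koebe_slit_map[OF c(1) z1(1)] by (simp add: w_def algebra_simps)
  then have eq: "norm (w - z) * norm (1 - 1 / (w * z)) = \<bar>exp c - 1\<bar> * norm (koebe z)"
    by (metis norm_mult norm_of_real)
  have "norm (koebe z) \<le> norm (z + 1 / z) + 2" unfolding koebe_def using norm_triangle_ineq[of "z + 1 / z" 2] by simp
  also have "\<dots> \<le> norm z + norm (1 / z) + 2" using norm_triangle_ineq[of z "1 / z"] by simp
  also have "norm (1 / z) \<le> 1" using z1 by (simp add: norm_divide divide_le_eq)
  finally have k: "norm (koebe z) \<le> 4 * norm z" using z1 by simp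
  have "\<bar>exp c - 1\<bar> * norm (koebe z) \<le> (2 * c) * (4 * norm z)"
    using exp_minus_1_le[OF c] c k by (intro mult_mono) auto
  moreover have "norm (w - z) * q \<le> norm (w - z) * norm (1 - 1 / (w * z))"
    unfolding q using norm_one_minus_inverse_ge(1)[OF r w0(2) z, of 1] by (intro mult_left_mono) auto
  ultimately have *: "norm (w - z) \<le> 8 * c / q * norm z" using eq q_pos by (simp add: field_simps)
  then show "norm (slit_map c z - z) \<le> 8 * c / q * norm z" by (simp add: w_def)
  have "1 / w - 1 / z = (z - w) / (w * z)" using z1 w0 by (simp add: field_simps)
  then have "norm (1 / w - 1 / z) = norm (w - z) / norm z / norm w"
    by (simp add: norm_divide norm_mult norm_minus_commute mult.commute)
  also have "\<dots> \<le> (8 * c / q) / 1"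
  proof (rule frac_le)
    show "norm (w - z) / norm z \<le> 8 * c / q" using * z1 by (simp add: divide_le_eq)
  qed (use w0 c q_pos in auto)
  finally show "norm (1 / slit_map c z - 1 / z) \<le> 8 * c / q" by (simp add: w_def)
qed

lemma slit_map_lipschitz:
  assumes c: "0 \<le> c" "c \<le> 1" and z: "r \<le> norm z" and w: "r \<le> norm w"
  shows "norm (slit_map c z - slit_map c w) \<le> exp (c * (1 + 16 / q\<^sup>2)) * norm (z - w)"
proof -
  define Z where "Z = slit_map c z"
  define W where "W = slit_map c w"
  have z1: "1 \<le> norm z" "z \<noteq> 0" "1 \<le> norm w" "w \<noteq> 0" using z w r by auto
  have "norm z \<le> norm Z" "norm w \<le> norm W"
    unfolding Z_def W_def using c z1 by (auto intro: norm_slit_map_ge)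
  then have ZW: "r \<le> norm Z" "r \<le> norm W" "Z \<noteq> 0" "W \<noteq> 0" "1 \<le> norm Z" using z w r by auto
  have "(Z - W) * (1 - 1 / (Z * W)) = of_real (exp c) * ((z - w) * (1 - 1 / (z * w)))"
    unfolding koebe_diff[OF ZW(3,4), symmetric] koebe_diff[OF z1(2,4), symmetric]
    using koebe_slit_map[OF c(1) z1(1)] koebe_slit_map[OF c(1) z1(3)]
    by (simp add: Z_def W_def right_diff_distrib)
  then have eq: "norm (Z - W) * norm (1 - 1 / (Z * W)) = exp c * (norm (z - w) * norm (1 - 1 / (z * w)))"
    by (metis norm_mult norm_of_real abs_exp_cancel)
  define m where "m = norm (1 - 1 / (Z * W))"
  have m: "q \<le> m" "0 < m" using norm_one_minus_inverse_ge(1)[OF r ZW(1,2), of 1] q_pos by (auto simp: q m_def)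
  have "1 / (Z * W) - 1 / (z * w) = (1 / Z - 1 / z) * (1 / w) + (1 / Z) * (1 / W - 1 / w)"
    by (simp add: field_simps) (simp add: diff_divide_distrib algebra_simps)
  then have "norm (1 / (Z * W) - 1 / (z * w)) \<le> norm (1 / Z - 1 / z) * norm (1 / w) + norm (1 / Z) * norm (1 / W - 1 / w)"
    by (metis norm_mult norm_triangle_ineq)
  also have "\<dots> \<le> (8 * c / q) * 1 + 1 * (8 * c / q)"
    unfolding Z_def[symmetric] W_def[symmetric]
    using slit_map_displacement(2)[OF c z] slit_map_displacement(2)[OF c w] z1 ZW c q_pos
    by (intro add_mono mult_mono) (auto simp: Z_def W_def norm_divide divide_le_eq)
  finally have "norm (1 - 1 / (z * w)) \<le> m + 16 * c / q"
    using norm_triangle_ineq[of "1 - 1 / (Z * W)" "1 / (Z * W) - 1 / (z * w)"] by (simp add: m_def)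
  also have "\<dots> \<le> m * (1 + 16 * c / q\<^sup>2)"
  proof -
    have "16 * c / q = q * (16 * c / q\<^sup>2)" using q_pos by (simp add: power2_eq_square)
    also have "\<dots> \<le> m * (16 * c / q\<^sup>2)" using m c by (intro mult_right_mono) auto
    finally show ?thesis by (simp add: algebra_simps)
  qed
  also have "\<dots> \<le> m * exp (c * (16 / q\<^sup>2))"
    using m exp_ge_add_one_self[of "c * (16 / q\<^sup>2)"] by (intro mult_left_mono) (auto simp: mult.commute)
  finally have "norm (Z - W) * m \<le> exp c * (norm (z - w) * (m * exp (c * (16 / q\<^sup>2))))"
    unfolding eq[folded m_def] by (intro mult_left_mono) auto
  also have "\<dots> = (exp (c * (1 + 16 / q\<^sup>2)) * norm (z - w)) * m"
    by (simp add: distrib_left exp_add mult_ac)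
  finally show ?thesis using m by (simp add: Z_def W_def)
qed

lemma rotated_slit_map_lipschitz:
  assumes "0 \<le> c" "c \<le> 1" "r \<le> norm z" "r \<le> norm w"
  shows "norm (rotated_slit_map c x z - rotated_slit_map c x w) \<le> exp (c * (1 + 16 / q\<^sup>2)) * norm (z - w)"
proof -
  have "rotated_slit_map c x z - rotated_slit_map c x w = cis x * (slit_map c (cis (- x) * z) - slit_map c (cis (- x) * w))"
    by (simp add: rotated_slit_map_def algebra_simps)
  moreover have "cis (- x) * z - cis (- x) * w = cis (- x) * (z - w)" by (simp add: algebra_simps)
  ultimately show ?thesis
    using slit_map_lipschitz[of c "cis (- x) * z" "cis (- x) * w"] assms by simp
qed

lemma cluster_map_lipschitz:
  assumes c: "0 \<le> c" "c \<le> 1" and "r \<le> norm z" "r \<le> norm w"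
  shows "norm (cluster_map c \<theta> n z - cluster_map c \<theta> n w) \<le> exp (c * (1 + 16 / q\<^sup>2)) ^ n * norm (z - w)"
  using assms(3,4)
proof (induction n arbitrary: z w)
  case (Suc n)
  let ?F = "rotated_slit_map c (\<theta> (Suc n))"
  have "r \<le> norm (?F z)" "r \<le> norm (?F w)"
    using norm_rotated_slit_map_ge[OF c(1), of z] norm_rotated_slit_map_ge[OF c(1), of w] Suc.prems r
    by (meson less_le_trans less_imp_le order_trans)+
  then have "norm (cluster_map c \<theta> n (?F z) - cluster_map c \<theta> n (?F w))
      \<le> exp (c * (1 + 16 / q\<^sup>2)) ^ n * norm (?F z - ?F w)"
    by (rule Suc.IH)
  also have "\<dots> \<le> exp (c * (1 + 16 / q\<^sup>2)) ^ n * (exp (c * (1 + 16 / q\<^sup>2)) * norm (z - w))"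
    using rotated_slit_map_lipschitz[OF c Suc.prems] by (intro mult_left_mono) auto
  finally show ?case by (simp add: cluster_map_Suc mult_ac)
qed simp

lemma rotated_slit_map_angle_diff:
  assumes c: "0 \<le> c" "c \<le> 1" and z: "r \<le> norm z"
  shows "norm (rotated_slit_map c x z - rotated_slit_map c y z) \<le> c * ((8 + 16 / q) / q) * norm (cis x - cis y)"
proof -
  define a where "a = cis x"
  define b where "b = cis y"
  define X where "X = rotated_slit_map c x z"
  define Y where "Y = rotated_slit_map c y z"
  have ab: "norm a = 1" "norm b = 1" "a \<noteq> 0" "b \<noteq> 0" by (auto simp: a_def b_def)
  have z1: "1 \<le> norm z" "z \<noteq> 0" using z r by auto
  have "norm z \<le> norm X" "norm z \<le> norm Y"
    unfolding X_def Y_def using c z1 by (auto intro: norm_rotated_slit_map_ge)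
  then have XY: "r \<le> norm X" "r \<le> norm Y" "X \<noteq> 0" "Y \<noteq> 0" using z r by auto
  have rel: "W + (cis s)\<^sup>2 / W + 2 * cis s = of_real (exp c) * (z + (cis s)\<^sup>2 / z + 2 * cis s)"
    if W: "W = rotated_slit_map c s z" for s W
  proof -
    have "cis s * koebe (slit_map c (cis (- s) * z)) = of_real (exp c) * (cis s * koebe (cis (- s) * z))"
      using koebe_slit_map[OF c(1), of "cis (- s) * z"] z1 by simp
    moreover have "cis s * koebe v = cis s * v + (cis s)\<^sup>2 / (cis s * v) + 2 * cis s" if "v \<noteq> 0" for v
      using that by (simp add: koebe_def power2_eq_square field_simps)
    moreover have "slit_map c (cis (- s) * z) \<noteq> 0" using slit_map_neq_0[OF c(1), of "cis (- s) * z"] z1 by simp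
    ultimately show ?thesis using z1 by (simp add: W rotated_slit_map_def cis_minus_cis)
  qed
  have "(X - Y) * (1 - a\<^sup>2 / (X * Y)) = (X + a\<^sup>2 / X) - (Y + b\<^sup>2 / Y) - (a\<^sup>2 - b\<^sup>2) / Y"
    using XY by (simp add: field_simps power2_eq_square)
  also have "\<dots> = (a\<^sup>2 - b\<^sup>2) * (of_real (exp c) / z - 1 / Y) + 2 * of_real (exp c - 1) * (a - b)"
  proof -
    have *: "X + a\<^sup>2 / X = of_real (exp c) * (z + a\<^sup>2 / z + 2 * a) - 2 * a"
      "Y + b\<^sup>2 / Y = of_real (exp c) * (z + b\<^sup>2 / z + 2 * b) - 2 * b"
      using rel[OF X_def] rel[OF Y_def] by (simp_all add: a_def b_def eq_diff_eq)
    show ?thesis unfolding * by (simp add: algebra_simps add_divide_distrib diff_divide_distrib)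
  qed
  finally have "norm ((X - Y) * (1 - a\<^sup>2 / (X * Y))) \<le> norm (a\<^sup>2 - b\<^sup>2) * norm (of_real (exp c) / z - 1 / Y) + norm (2 * complex_of_real (exp c - 1)) * norm (a - b)"
    by (metis norm_mult norm_triangle_ineq)
  also have "norm (a\<^sup>2 - b\<^sup>2) \<le> 2 * norm (a - b)"
  proof -
    have "a\<^sup>2 - b\<^sup>2 = (a + b) * (a - b)" by (simp add: power2_eq_square algebra_simps)
    moreover have "norm (a + b) \<le> 2" using norm_triangle_ineq[of a b] ab by simp
    ultimately show ?thesis by (simp add: norm_mult mult_right_mono)
  qed
  also have "norm (of_real (exp c) / z - 1 / Y) \<le> 2 * c + 8 * c / q"
  proof -
    have "of_real (exp c) / z - 1 / Y = of_real (exp c - 1) / z + (1 / z - 1 / Y)" by (simp add: diff_divide_distrib)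
    then have "norm (of_real (exp c) / z - 1 / Y) \<le> norm (complex_of_real (exp c - 1) / z) + norm (1 / z - 1 / Y)"
      by (metis norm_triangle_ineq)
    also have "norm (complex_of_real (exp c - 1) / z) \<le> (2 * c) / 1"
      unfolding norm_divide norm_of_real using exp_minus_1_le[OF c] z1 c by (intro frac_le) auto
    also have "norm (1 / z - 1 / Y) \<le> 8 * c / q"
    proof -
      have "1 / Y - 1 / z = cis (- y) * (1 / slit_map c (cis (- y) * z) - 1 / (cis (- y) * z))"
        by (simp add: Y_def rotated_slit_map_def algebra_simps divide_simps cis_mult flip: cis_inverse)
      then have "norm (1 / Y - 1 / z) = norm (1 / slit_map c (cis (- y) * z) - 1 / (cis (- y) * z))" by simp
      then show ?thesis using slit_map_displacement(2)[OF c, of "cis (- y) * z"] z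
        by (simp add: norm_minus_commute)
    qed
    finally show ?thesis by simp
  qed
  also have "norm (2 * complex_of_real (exp c - 1)) \<le> 4 * c"
    unfolding norm_mult norm_of_real using exp_minus_1_le[OF c] c by simp
  finally have le: "norm (X - Y) * norm (1 - a\<^sup>2 / (X * Y)) \<le> 2 * norm (a - b) * (2 * c + 8 * c / q) + 4 * c * norm (a - b)"
    by (simp add: norm_mult mult_left_mono mult_right_mono)
  have "norm (X - Y) * q \<le> norm (X - Y) * norm (1 - a\<^sup>2 / (X * Y))"
    unfolding q using norm_one_minus_inverse_ge(1)[OF r XY(1,2), of "a\<^sup>2"] ab
    by (intro mult_left_mono) (auto simp: norm_power)
  also note le
  finally have "norm (X - Y) \<le> (2 * norm (a - b) * (2 * c + 8 * c / q) + 4 * c * norm (a - b)) / q"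
    using q_pos by (simp add: le_divide_eq)
  also have "\<dots> = c * ((8 + 16 / q) / q) * norm (a - b)" using q_pos by (simp add: field_simps)
  finally show ?thesis by (simp add: X_def Y_def a_def b_def)
qed

lemma cluster_map_close:
  assumes c: "0 \<le> c" "c \<le> 1" and z: "r \<le> norm z"
    and near: "\<And>j. 1 \<le> j \<Longrightarrow> j \<le> n \<Longrightarrow> norm (cis (\<theta> j) - cis x) \<le> \<epsilon>"
  shows "norm (cluster_map c \<theta> n z - rotated_slit_map (c * n) x z)
    \<le> n * exp (c * (1 + 16 / q\<^sup>2)) ^ n * (c * ((8 + 16 / q) / q) * \<epsilon>)"
  using z near
proof (induction n arbitrary: z)
  case 0
  then have "1 < norm z" using r by simp
  then show ?case by (simp add: rotated_slit_map_def cis_minus_cis)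
next
  case (Suc n)
  define L where "L = exp (c * (1 + 16 / q\<^sup>2))"
  define D where "D = c * ((8 + 16 / q) / q) * \<epsilon>"
  let ?F = "rotated_slit_map c (\<theta> (Suc n)) z" and ?G = "rotated_slit_map c x z"
  have z1: "1 < norm z" using Suc.prems r by simp
  have FG: "r \<le> norm ?F" "r \<le> norm ?G"
    using norm_rotated_slit_map_ge[OF c(1), of z] z1 Suc.prems(1) by (meson less_imp_le order_trans)+
  have L: "1 \<le> L" using c q_pos by (simp add: L_def)
  have "0 \<le> \<epsilon>" by (rule order_trans[OF norm_ge_zero Suc.prems(2)[of "Suc n"]]) auto
  then have D: "0 \<le> D" using c q_pos by (simp add: D_def)
  have "rotated_slit_map (c * n) x ?G = rotated_slit_map (c * Suc n) x z"
    using rotated_slit_map_add[of "c * n" c z x] c z1 by (simp add: algebra_simps)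
  moreover have "norm (cluster_map c \<theta> n ?G - rotated_slit_map (c * n) x ?G) \<le> n * L ^ n * D"
    using Suc.IH[OF FG(2)] Suc.prems(2) by (simp add: L_def D_def)
  moreover have "norm (cluster_map c \<theta> n ?F - cluster_map c \<theta> n ?G) \<le> L ^ n * D"
  proof -
    have "norm (cluster_map c \<theta> n ?F - cluster_map c \<theta> n ?G) \<le> L ^ n * norm (?F - ?G)"
      unfolding L_def by (rule cluster_map_lipschitz[OF c FG])
    also have "norm (?F - ?G) \<le> c * ((8 + 16 / q) / q) * norm (cis (\<theta> (Suc n)) - cis x)"
      by (rule rotated_slit_map_angle_diff[OF c Suc.prems(1)])
    also have "\<dots> \<le> D" unfolding D_def using c q_pos Suc.prems(2)[of "Suc n"] by (intro mult_left_mono) auto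
    finally show ?thesis using L by (simp add: mult_left_mono)
  qed
  ultimately have "norm (cluster_map c \<theta> (Suc n) z - rotated_slit_map (c * Suc n) x z) \<le> L ^ n * D + n * L ^ n * D"
    using norm_triangle_ineq[of "cluster_map c \<theta> n ?F - cluster_map c \<theta> n ?G" "cluster_map c \<theta> n ?G - rotated_slit_map (c * n) x ?G"]
    by (simp add: cluster_map_Suc)
  also have "\<dots> = Suc n * L ^ n * D" by (simp add: algebra_simps)
  also have "\<dots> \<le> Suc n * L ^ Suc n * D"
    using L D by (intro mult_right_mono mult_left_mono power_increasing) auto
  finally show ?case by (simp only: L_def D_def)
qed

lemma rotated_slit_map_time_diff:
  assumes "0 \<le> s" "s \<le> t" "t - s \<le> 1" and z: "r \<le> norm z"
  shows "norm (rotated_slit_map t x z - rotated_slit_map s x z) \<le> 8 * (t - s) / q * (4 * exp s * norm z)"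
proof -
  define w where "w = slit_map s (cis (- x) * z)"
  have z1: "1 < norm (cis (- x) * z)" using z r by simp
  have w: "norm z \<le> norm w" "norm w \<le> 4 * exp s * norm z"
    using norm_slit_map_ge[of s "cis (- x) * z"] norm_slit_map_le[of s "cis (- x) * z"] assms z1 by (auto simp: w_def)
  have "rotated_slit_map t x z - rotated_slit_map s x z = cis x * (slit_map (t - s) w - w)"
    using slit_map_add[of "t - s" s "cis (- x) * z"] assms z1 by (simp add: rotated_slit_map_def w_def algebra_simps)
  then have "norm (rotated_slit_map t x z - rotated_slit_map s x z) \<le> 8 * (t - s) / q * norm w"
    using slit_map_displacement(1)[of "t - s" w] assms w by simp
  also have "\<dots> \<le> 8 * (t - s) / q * (4 * exp s * norm z)"
    using w assms q_pos by (intro mult_left_mono) auto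
  finally show ?thesis .
qed

end

section \<open>Clusters with almost constant angles\<close>

definition angles_near :: "real \<Rightarrow> (nat \<Rightarrow> real) \<Rightarrow> nat \<Rightarrow> bool" where
  "angles_near \<epsilon> \<theta> n \<longleftrightarrow> (\<forall>j\<in>{1..n}. \<exists>\<delta>. \<bar>\<delta>\<bar> \<le> \<epsilon> \<and> cis (\<theta> j) = cis (\<theta> 1 + \<delta>))"

definition sector :: "real \<Rightarrow> real \<Rightarrow> real \<Rightarrow> complex set" where
  "sector x \<epsilon> m = {of_real \<rho> * cis (x + \<phi>) | \<rho> \<phi>. 1 < \<rho> \<and> \<rho> \<le> m \<and> \<bar>\<phi>\<bar> \<le> \<epsilon>}"

lemma angles_near_mono: "angles_near \<epsilon> \<theta> n \<Longrightarrow> m \<le> n \<Longrightarrow> angles_near \<epsilon> \<theta> m"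
  by (auto simp: angles_near_def)

lemma angles_nearE:
  assumes "angles_near \<epsilon> \<theta> n" "1 \<le> j" "j \<le> n"
  obtains \<delta> where "\<bar>\<delta>\<bar> \<le> \<epsilon>" "cis (\<theta> j) = cis (\<theta> 1 + \<delta>)"
  using assms unfolding angles_near_def by (meson atLeastAtMost_iff)

lemma angles_near_norm_le:
  assumes "angles_near \<epsilon> \<theta> n" "1 \<le> j" "j \<le> n"
  shows "norm (cis (\<theta> j) - cis (\<theta> 1)) \<le> \<epsilon>"
proof -
  obtain \<delta> where d: "\<bar>\<delta>\<bar> \<le> \<epsilon>" "cis (\<theta> j) = cis (\<theta> 1 + \<delta>)" by (rule angles_nearE[OF assms])
  have "cis (\<theta> j) - cis (\<theta> 1) = cis (\<theta> 1) * (cis \<delta> - 1)"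
    by (simp add: d(2) cis_mult[symmetric] algebra_simps)
  then have "norm (cis (\<theta> j) - cis (\<theta> 1)) = norm (cis \<delta> - 1)" by simp
  then show ?thesis using norm_cis_minus_1_le[of \<delta>] d by linarith
qed

lemma rotated_slit_map_sector:
  assumes t: "0 \<le> t" and \<rho>: "1 < \<rho>" and \<epsilon>: "2 * \<epsilon> < pi" and \<phi>: "\<bar>\<phi>\<bar> \<le> \<epsilon>"
    and \<delta>: "\<bar>\<delta>\<bar> \<le> \<epsilon>" "cis y = cis (x + \<delta>)"
  defines "w \<equiv> rotated_slit_map t y (of_real \<rho> * cis (x + \<phi>))"
  shows "\<exists>\<psi>. \<bar>\<psi>\<bar> \<le> \<epsilon> \<and> w = of_real (norm w) * cis (x + \<psi>)"
proof -
  define v where "v = slit_map t (of_real \<rho> * cis (\<phi> - \<delta>))"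
  have "cis (- (x + \<delta>)) * (of_real \<rho> * cis (x + \<phi>)) = of_real \<rho> * (cis (- (x + \<delta>)) * cis (x + \<phi>))"
    by (simp add: mult_ac)
  also have "\<dots> = of_real \<rho> * cis (\<phi> - \<delta>)" by (simp add: cis_mult)
  finally have w: "w = cis (x + \<delta>) * v"
    unfolding w_def rotated_slit_map_cong[OF \<delta>(2)] rotated_slit_map_def v_def by (rule arg_cong)
  have "\<bar>\<phi> - \<delta>\<bar> < pi" using \<phi> \<delta>(1) \<epsilon> by linarith
  from slit_map_sector[OF t \<rho> this]
  obtain s where s: "v = of_real (norm v) * cis s" "min 0 (\<phi> - \<delta>) \<le> s" "s \<le> max 0 (\<phi> - \<delta>)"
    unfolding v_def by blast
  have "w = of_real (norm v) * (cis (x + \<delta>) * cis s)" unfolding w by (subst s(1)) (simp only: mult_ac)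
  also have "cis (x + \<delta>) * cis s = cis (x + (\<delta> + s))" by (simp add: cis_mult add.assoc)
  also have "norm v = norm w" by (simp add: w)
  finally have "w = of_real (norm w) * cis (x + (\<delta> + s))" .
  moreover have "\<bar>\<delta> + s\<bar> \<le> \<epsilon>" using s(2,3) \<phi> \<delta>(1) by (auto simp: min_def max_def split: if_splits)
  ultimately show ?thesis by blast
qed

lemma cluster_map_sector:
  assumes c: "0 \<le> c" and \<epsilon>: "2 * \<epsilon> < pi" and near: "angles_near \<epsilon> \<theta> n"
    and "1 < \<rho>" "\<bar>\<phi>\<bar> \<le> \<epsilon>"
  shows "\<exists>\<psi>. \<bar>\<psi>\<bar> \<le> \<epsilon> \<and> cluster_map c \<theta> n (of_real \<rho> * cis (\<theta> 1 + \<phi>)) =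
    of_real (norm (cluster_map c \<theta> n (of_real \<rho> * cis (\<theta> 1 + \<phi>)))) * cis (\<theta> 1 + \<psi>)"
  using assms(3-)
proof (induction n arbitrary: \<rho> \<phi>)
  case 0
  then show ?case by (auto simp: norm_mult)
next
  case (Suc n)
  define w where "w = rotated_slit_map c (\<theta> (Suc n)) (of_real \<rho> * cis (\<theta> 1 + \<phi>))"
  obtain \<delta> where \<delta>: "\<bar>\<delta>\<bar> \<le> \<epsilon>" "cis (\<theta> (Suc n)) = cis (\<theta> 1 + \<delta>)"
    by (rule angles_nearE[OF Suc.prems(1), of "Suc n"]) auto
  obtain \<psi> where \<psi>: "\<bar>\<psi>\<bar> \<le> \<epsilon>" "w = of_real (norm w) * cis (\<theta> 1 + \<psi>)"
    using rotated_slit_map_sector[OF c Suc.prems(2) \<epsilon> Suc.prems(3) \<delta>] by (auto simp: w_def)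
  have "1 < norm w" unfolding w_def using c Suc.prems by (intro rotated_slit_map_exterior) (auto simp: norm_mult)
  from Suc.IH[OF angles_near_mono[OF Suc.prems(1)] this \<psi>(1)]
  show ?case unfolding cluster_map_Suc w_def[symmetric] \<psi>(2)[symmetric] by simp
qed

lemma cluster_subset_sector:
  assumes c: "0 \<le> c" and \<epsilon>: "2 * \<epsilon> < pi" and near: "angles_near \<epsilon> \<theta> n"
  shows "cluster c \<theta> n \<subseteq> cball 0 1 \<union> sector (\<theta> 1) \<epsilon> (1 + slit_length (c * n))"
proof
  fix a assume "a \<in> cluster c \<theta> n"
  then consider "a \<in> cball 0 1"
    | j y where "j < n" "y \<in> slit c" "a = cluster_map c \<theta> j (cis (\<theta> (Suc j)) * y)"
    unfolding cluster_eq[OF c] by blast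
  then show "a \<in> cball 0 1 \<union> sector (\<theta> 1) \<epsilon> (1 + slit_length (c * n))"
  proof cases
    case (2 j y)
    then obtain \<rho> where \<rho>: "y = of_real \<rho>" "1 < \<rho>" "\<rho> \<le> 1 + slit_length c" by (auto simp: slit_def)
    obtain \<delta> where \<delta>: "\<bar>\<delta>\<bar> \<le> \<epsilon>" "cis (\<theta> (Suc j)) = cis (\<theta> 1 + \<delta>)"
      by (rule angles_nearE[OF near, of "Suc j"]) (use 2(1) in auto)
    have a: "a = cluster_map c \<theta> j (of_real \<rho> * cis (\<theta> 1 + \<delta>))"
      by (simp add: 2 \<rho> \<delta> mult.commute)
    have nj: "angles_near \<epsilon> \<theta> j" using angles_near_mono[OF near] 2(1) by simp
    obtain \<psi> where \<psi>: "\<bar>\<psi>\<bar> \<le> \<epsilon>" "a = of_real (norm a) * cis (\<theta> 1 + \<psi>)"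
      using cluster_map_sector[OF c \<epsilon> nj \<rho>(2) \<delta>(1)] by (auto simp: a)
    have z: "norm (of_real \<rho> * cis (\<theta> 1 + \<delta>)) = \<rho>" using \<rho> by (simp add: norm_mult)
    have "\<rho> \<le> norm a" unfolding a using norm_cluster_map_ge[OF c, of "of_real \<rho> * cis (\<theta> 1 + \<delta>)" \<theta> j] z \<rho> by simp
    moreover have "norm a \<le> 1 + slit_length (c + c * j)"
      unfolding a using c z \<rho> by (intro norm_cluster_map_le_slit_length) auto
    moreover have "c + c * j \<le> c * n"
    proof -
      have "c * (1 + real j) \<le> c * real n" using c 2(1) by (intro mult_left_mono) auto
      then show ?thesis by (simp add: algebra_simps)
    qed
    then have "slit_length (c + c * j) \<le> slit_length (c * n)" using c by (intro slit_length_mono) auto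
    ultimately have "a \<in> sector (\<theta> 1) \<epsilon> (1 + slit_length (c * n))"
      unfolding sector_def using \<psi> \<rho>(2) by (intro CollectI exI[of _ "norm a"] exI[of _ \<psi>]) auto
    then show ?thesis ..
  qed auto
qed

text \<open>
  Capacity comparison: a cluster inside a thin sector is covered by a slightly thickened slit disk,
  so the Schwarz lemma bounds its capacity \<open>c j\<close>. This is what forces the cluster to grow.
\<close>

lemma cluster_capacity_le:
  assumes c: "0 \<le> c" and \<tau>: "0 \<le> \<tau>" and \<epsilon>: "0 < \<epsilon>" "\<epsilon> \<le> 1 / 16"
    and sub: "cluster c \<theta> n \<subseteq> cball 0 1 \<union> sector x \<epsilon> (1 + slit_length \<tau>)"
  shows "c * n \<le> \<tau> + 4 * sqrt \<epsilon>"
proof -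
  define \<delta> where "\<delta> = 4 * sqrt \<epsilon>"
  have \<delta>: "0 < \<delta>" "\<delta> \<le> 1" "\<delta>\<^sup>2 = 16 * \<epsilon>"
  proof -
    show "0 < \<delta>" "\<delta>\<^sup>2 = 16 * \<epsilon>" using \<epsilon> by (auto simp: \<delta>_def power_mult_distrib)
    have "sqrt \<epsilon> \<le> sqrt ((1 / 4)\<^sup>2)" using \<epsilon> by (intro real_sqrt_le_mono) (simp add: power2_eq_square)
    then show "\<delta> \<le> 1" by (simp add: \<delta>_def)
  qed
  have notin: "rotated_slit_map \<tau> x z \<notin> cluster c \<theta> n" if z: "1 + \<delta> < norm z" for z
  proof
    define w where "w = slit_map \<tau> (cis (- x) * z)"
    assume "rotated_slit_map \<tau> x z \<in> cluster c \<theta> n"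
    moreover have z1: "1 < norm z" using z \<delta> by simp
    then have "1 < norm (rotated_slit_map \<tau> x z)" by (rule rotated_slit_map_exterior[OF \<tau>])
    ultimately have "rotated_slit_map \<tau> x z \<in> sector x \<epsilon> (1 + slit_length \<tau>)" using sub by auto
    then obtain \<rho> \<phi> where \<rho>: "rotated_slit_map \<tau> x z = of_real \<rho> * cis (x + \<phi>)" "1 < \<rho>" "\<rho> \<le> 1 + slit_length \<tau>" "\<bar>\<phi>\<bar> \<le> \<epsilon>"
      by (auto simp: sector_def)
    have "cis x * w = cis x * (of_real \<rho> * cis \<phi>)" using \<rho>(1) by (simp add: rotated_slit_map_def w_def mult_ac flip: cis_mult)
    then have w: "w = of_real \<rho> * cis \<phi>" by simp
    have w0: "w \<noteq> 0" using \<rho>(2) by (simp add: w)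
    define v where "v = cis (- x) * z"
    have v: "norm v = norm z" "v \<noteq> 0" using z1 by (auto simp: v_def)
    have kw: "koebe w = of_real (exp \<tau>) * koebe v" using koebe_slit_map[OF \<tau>, of v] z1 by (simp add: w_def v_def)
    define u where "u = \<rho> + 1 / \<rho> + 2"
    have u: "4 \<le> u" "u \<le> 4 * exp \<tau>" "\<rho> \<le> 4 * exp \<tau>"
    proof -
      show "4 \<le> u" using add_inverse_ge_2[of \<rho>] \<rho>(2) by (simp add: u_def)
      show *: "u \<le> 4 * exp \<tau>"
        using add_inverse_mono[of \<rho> "1 + slit_length \<tau>"] \<rho>(2,3) one_plus_slit_length(3)[OF \<tau>] by (simp add: u_def)
      have "0 \<le> 1 / \<rho>" using \<rho>(2) by simp
      then show "\<rho> \<le> 4 * exp \<tau>" using * unfolding u_def by linarith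
    qed
    have ku: "koebe (of_real \<rho>) = of_real u" by (simp add: koebe_def u_def)
    have "norm (koebe w - of_real u) = norm (w - of_real \<rho>) * norm (1 - 1 / (w * of_real \<rho>))"
      unfolding ku[symmetric] using koebe_diff[OF w0, of "of_real \<rho>"] \<rho>(2) by (simp add: norm_mult)
    also have "\<dots> \<le> (\<rho> * \<epsilon>) * 2"
    proof (rule mult_mono)
      have "w - of_real \<rho> = of_real \<rho> * (cis \<phi> - 1)" by (simp add: w algebra_simps)
      then have "norm (w - of_real \<rho>) = \<rho> * norm (cis \<phi> - 1)" using \<rho>(2) by (simp add: norm_mult)
      also have "\<dots> \<le> \<rho> * \<epsilon>" using norm_cis_minus_1_le[of \<phi>] \<rho>(2,4) by (intro mult_left_mono) auto
      finally show "norm (w - of_real \<rho>) \<le> \<rho> * \<epsilon>" .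
      have "norm (1 / (w * of_real \<rho>)) \<le> 1"
        using \<rho>(2) mult_mono[of 1 \<rho> 1 \<rho>] by (simp add: w norm_divide norm_mult divide_le_eq)
      then show "norm (1 - 1 / (w * of_real \<rho>)) \<le> 2"
        using norm_triangle_ineq4[of 1 "1 / (w * of_real \<rho>)"] by simp
    qed (use \<rho> \<epsilon> in auto)
    finally have d: "norm (koebe w - of_real u) \<le> 2 * (\<rho> * \<epsilon>)" by simp
    have "norm (koebe w) \<le> u + 2 * (\<rho> * \<epsilon>)"
      using norm_triangle_ineq[of "of_real u" "koebe w - of_real u"] d u by simp
    moreover have "norm (koebe w - of_real (4 * exp \<tau>)) \<le> (4 * exp \<tau> - u) + 2 * (\<rho> * \<epsilon>)"
    proof -
      have "norm (of_real u - of_real (4 * exp \<tau>) :: complex) = 4 * exp \<tau> - u"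
        using u by (simp only: flip: of_real_diff) (simp only: norm_of_real)
      then show ?thesis using norm_triangle_ineq[of "koebe w - of_real u" "of_real u - of_real (4 * exp \<tau>)"] d by simp
    qed
    moreover have "norm (koebe w) = exp \<tau> * norm (koebe v)" by (simp add: kw norm_mult)
    moreover have "norm (koebe w - of_real (4 * exp \<tau>)) = exp \<tau> * norm (koebe v - 4)"
    proof -
      have "koebe w - of_real (4 * exp \<tau>) = of_real (exp \<tau>) * (koebe v - 4)" by (simp add: kw algebra_simps)
      then show ?thesis by (simp add: norm_mult)
    qed
    ultimately have "exp \<tau> * (norm (koebe v) + norm (koebe v - 4)) \<le> 4 * exp \<tau> + 4 * (\<rho> * \<epsilon>)"
      by (simp add: distrib_left)
    also have "\<rho> * \<epsilon> \<le> (4 * exp \<tau>) * \<epsilon>" using u \<epsilon> by (intro mult_right_mono) auto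
    finally have "exp \<tau> * (norm (koebe v) + norm (koebe v - 4)) \<le> exp \<tau> * (4 + 16 * \<epsilon>)" by (simp add: algebra_simps)
    then have "norm (koebe v) + norm (koebe v - 4) \<le> 4 + 16 * \<epsilon>" by simp
    then have "2 * (norm z + 1 / norm z) \<le> 4 + \<delta>\<^sup>2" unfolding koebe_ellipse[OF v(2)] v(1) \<delta>(3) .
    also have "4 + \<delta>\<^sup>2 \<le> 2 * ((1 + \<delta>) + 1 / (1 + \<delta>))"
    proof -
      have "2 * ((1 + \<delta>) + 1 / (1 + \<delta>)) = 4 + \<delta>\<^sup>2 * (2 / (1 + \<delta>))"
        using \<delta> by (simp add: field_simps power2_eq_square)
      moreover have "\<delta>\<^sup>2 * 1 \<le> \<delta>\<^sup>2 * (2 / (1 + \<delta>))" using \<delta>(1,2) by (intro mult_left_mono) auto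
      ultimately show ?thesis by simp
    qed
    finally have "norm z + 1 / norm z \<le> (1 + \<delta>) + 1 / (1 + \<delta>)" by simp
    then have "norm z \<le> 1 + \<delta>" by (rule add_inverse_le_imp_le[rotated 2]) (use z1 \<delta> in linarith)+
    then show False using z by simp
  qed
  have "norm (complex_of_real (exp (c * n))) \<le> (1 + \<delta>) * norm (complex_of_real (exp \<tau>))"
  proof (rule exterior_subordination_bound)
    show "cluster_map c \<theta> n holomorphic_on exterior" "inj_on (cluster_map c \<theta> n) exterior"
      "((\<lambda>z. cluster_map c \<theta> n z / z) \<longlongrightarrow> of_real (exp (c * n))) at_infinity"
      "\<And>z. z \<in> exterior \<Longrightarrow> norm (cluster_map c \<theta> n z) \<le> (4 * exp c) ^ n * norm z"
      by (rule cluster_map_conformal[OF c] | assumption)+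
    show "rotated_slit_map \<tau> x holomorphic_on {z. 1 + \<delta> < norm z}"
      by (rule holomorphic_on_subset[OF rotated_slit_map_conformal(1)[OF \<tau>]]) (use \<delta> in \<open>auto simp: exterior_def\<close>)
    show "rotated_slit_map \<tau> x ` {z. 1 + \<delta> < norm z} \<subseteq> cluster_map c \<theta> n ` exterior"
      using notin by (auto simp: cluster_def)
    show "((\<lambda>z. rotated_slit_map \<tau> x z / z) \<longlongrightarrow> of_real (exp \<tau>)) at_infinity"
      by (rule rotated_slit_map_conformal(4)[OF \<tau>])
  qed (use \<delta> in auto)
  then have "exp (c * n) \<le> (1 + \<delta>) * exp \<tau>" by simp
  also have "\<dots> \<le> exp \<delta> * exp \<tau>" using exp_ge_add_one_self[of \<delta>] by (intro mult_right_mono) auto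
  finally have "exp (c * n) \<le> exp (\<delta> + \<tau>)" by (simp add: exp_add)
  then show ?thesis by (simp add: \<delta>_def)
qed

lemma continuous_on_slit_length: "continuous_on S slit_length"
  unfolding slit_length_def[abs_def] by (intro continuous_intros)

lemma ex_slit_length_eq:
  assumes "0 \<le> t" "1 \<le> y" "y \<le> 1 + slit_length t"
  obtains s where "0 \<le> s" "s \<le> t" "y = 1 + slit_length s"
proof -
  have "\<exists>s\<ge>0. s \<le> t \<and> slit_length s = y - 1"
    by (rule IVT') (use assms continuous_on_slit_length in auto)
  then show ?thesis using that by auto
qed

lemma infdist_le_slit_disk:
  fixes c t :: real
  assumes near: "angles_near \<epsilon> \<theta> n" and c: "0 \<le> c" and \<epsilon>: "2 * \<epsilon> < pi" "0 \<le> \<epsilon>" and t: "c * n \<le> t"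
    and a: "a \<in> cluster c \<theta> n"
  shows "infdist a (slit_disk t (\<theta> 1)) \<le> (1 + slit_length t) * \<epsilon>"
proof -
  have t0: "0 \<le> t" using c t by (meson mult_nonneg_nonneg of_nat_0_le_iff order_trans)
  have dt: "0 \<le> slit_length t" by (rule slit_length_nonneg[OF t0])
  consider "a \<in> cball 0 1" | "a \<in> sector (\<theta> 1) \<epsilon> (1 + slit_length (c * n))"
    using cluster_subset_sector[OF c \<epsilon>(1) near] a by blast
  then show ?thesis
  proof cases
    case 1
    then have "infdist a (slit_disk t (\<theta> 1)) = 0" by (intro infdist_zero) (simp add: slit_disk_def)
    then show ?thesis using dt \<epsilon> by simp
  next
    case 2
    then obtain \<rho> \<phi> where \<rho>: "a = of_real \<rho> * cis (\<theta> 1 + \<phi>)" "1 < \<rho>" "\<rho> \<le> 1 + slit_length (c * n)" "\<bar>\<phi>\<bar> \<le> \<epsilon>"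
      by (auto simp: sector_def)
    have \<rho>t: "\<rho> \<le> 1 + slit_length t" using \<rho>(3) slit_length_mono[of "c * n" t] t c by simp
    then have "cis (\<theta> 1) * of_real \<rho> \<in> slit_disk t (\<theta> 1)" using \<rho>(2) by (auto simp: slit_disk_def slit_def)
    then have "infdist a (slit_disk t (\<theta> 1)) \<le> dist a (cis (\<theta> 1) * of_real \<rho>)" by (rule infdist_le)
    also have "a - cis (\<theta> 1) * of_real \<rho> = cis (\<theta> 1) * (of_real \<rho> * (cis \<phi> - 1))"
      by (simp add: \<rho>(1) algebra_simps flip: cis_mult)
    then have "dist a (cis (\<theta> 1) * of_real \<rho>) = \<rho> * norm (cis \<phi> - 1)" using \<rho>(2) by (simp add: dist_norm norm_mult)
    also have "\<dots> \<le> (1 + slit_length t) * \<epsilon>" using norm_cis_minus_1_le[of \<phi>] \<rho>t \<rho>(2,4) by (intro mult_mono) auto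
    finally show ?thesis .
  qed
qed

lemma infdist_le_cluster:
  assumes c: "0 < c" and \<epsilon>: "0 < \<epsilon>" "\<epsilon> \<le> 1 / 16" and t: "0 \<le> t"
    and near: "angles_near \<epsilon> \<theta> (nat \<lfloor>t / c\<rfloor>)"
    and \<omega>: "\<And>s s'. 0 \<le> s' \<Longrightarrow> s' \<le> s \<Longrightarrow> s \<le> t \<Longrightarrow> s - s' \<le> c + 4 * sqrt \<epsilon> \<Longrightarrow> slit_length s - slit_length s' \<le> \<omega>"
    and b: "b \<in> slit_disk t (\<theta> 1)"
  shows "infdist b (cluster c \<theta> (nat \<lfloor>t / c\<rfloor>)) \<le> \<omega> + (1 + slit_length t) * \<epsilon>"
proof -
  have c0: "0 \<le> c" using c by simp
  have dt: "0 \<le> slit_length t" by (rule slit_length_nonneg[OF t])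
  have \<omega>0: "0 \<le> \<omega>" using \<omega>[of 0 0] c t \<epsilon> by (simp add: add_nonneg_nonneg)
  have disk: "cball 0 1 \<subseteq> cluster c \<theta> n" for n unfolding cluster_eq[OF c0] by blast
  consider "b \<in> cball 0 1" | y where "b = cis (\<theta> 1) * of_real y" "1 < y" "y \<le> 1 + slit_length t"
    using b by (auto simp: slit_disk_def slit_def)
  then show ?thesis
  proof cases
    case 1
    then have "infdist b (cluster c \<theta> (nat \<lfloor>t / c\<rfloor>)) = 0" using disk by (intro infdist_zero) blast
    then show ?thesis using dt \<epsilon> \<omega>0 by simp
  next
    case (2 y)
    obtain s where s: "0 \<le> s" "s \<le> t" "y = 1 + slit_length s"
      using ex_slit_length_eq[OF t, of y] 2 by auto
    show ?thesis
    proof (cases "s \<le> c + 4 * sqrt \<epsilon>")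
      case True
      have "cis (\<theta> 1) \<in> cluster c \<theta> (nat \<lfloor>t / c\<rfloor>)" by (rule subsetD[OF disk]) simp
      then have "infdist b (cluster c \<theta> (nat \<lfloor>t / c\<rfloor>)) \<le> dist b (cis (\<theta> 1))" by (rule infdist_le)
      also have "b - cis (\<theta> 1) = cis (\<theta> 1) * of_real (y - 1)" by (simp add: 2 algebra_simps)
      then have "dist b (cis (\<theta> 1)) = y - 1" using 2 by (simp only: dist_norm norm_cis_mult norm_of_real)
      also have "\<dots> \<le> \<omega>" using \<omega>[of 0 s] s True by simp
      finally show ?thesis using dt \<epsilon> by (simp add: add_increasing2)
    next
      case False
      define \<tau> where "\<tau> = s - c - 4 * sqrt \<epsilon>"
      define j where "j = nat \<lfloor>s / c\<rfloor>"
      have \<tau>: "0 \<le> \<tau>" "\<tau> \<le> s"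
        using False c real_sqrt_ge_zero[of \<epsilon>] \<epsilon> unfolding \<tau>_def by linarith+
      have j: "c * j \<le> s" "s < c * j + c"
      proof -
        have "real j = of_int \<lfloor>s / c\<rfloor>" using s c by (simp add: j_def)
        then have "real j \<le> s / c" "s / c < real j + 1" by linarith+
        then show "c * j \<le> s" "s < c * j + c" using c by (simp_all add: field_simps)
      qed
      have jn: "j \<le> nat \<lfloor>t / c\<rfloor>" unfolding j_def using s c by (intro nat_mono floor_mono divide_right_mono) auto
      have "\<not> cluster c \<theta> j \<subseteq> cball 0 1 \<union> sector (\<theta> 1) \<epsilon> (1 + slit_length \<tau>)"
        using cluster_capacity_le[OF c0 \<tau>(1) \<epsilon>, of \<theta> j "\<theta> 1"] j by (auto simp: \<tau>_def)
      moreover have "cluster c \<theta> j \<subseteq> cball 0 1 \<union> sector (\<theta> 1) \<epsilon> (1 + slit_length (c * j))"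
        using \<epsilon> pi_gt3 by (intro cluster_subset_sector[OF c0 _ angles_near_mono[OF near jn]]) auto
      ultimately obtain a where a: "a \<in> cluster c \<theta> j" "a \<in> sector (\<theta> 1) \<epsilon> (1 + slit_length (c * j))"
        "a \<notin> sector (\<theta> 1) \<epsilon> (1 + slit_length \<tau>)" by blast
      from a(2) obtain \<rho> \<phi> where \<rho>: "a = of_real \<rho> * cis (\<theta> 1 + \<phi>)" "1 < \<rho>" "\<rho> \<le> 1 + slit_length (c * j)" "\<bar>\<phi>\<bar> \<le> \<epsilon>"
        by (auto simp: sector_def)
      have \<rho>\<tau>: "1 + slit_length \<tau> < \<rho>"
      proof (rule ccontr)
        assume "\<not> 1 + slit_length \<tau> < \<rho>"
        then have "\<rho> \<le> 1 + slit_length \<tau>" by simp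
        then have "a \<in> sector (\<theta> 1) \<epsilon> (1 + slit_length \<tau>)"
          unfolding sector_def using \<rho>(1,2,4) by blast
        then show False using a(3) by blast
      qed
      have \<rho>y: "\<rho> \<le> y" using \<rho>(3) s(3) slit_length_mono[of "c * j" s] j c by simp
      have "a \<in> cluster c \<theta> (nat \<lfloor>t / c\<rfloor>)" using a(1) cluster_mono[OF c0 jn] by blast
      then have "infdist b (cluster c \<theta> (nat \<lfloor>t / c\<rfloor>)) \<le> dist b a" by (rule infdist_le)
      also have "b - a = cis (\<theta> 1) * (of_real (y - \<rho>) - of_real \<rho> * (cis \<phi> - 1))"
        by (simp add: \<rho>(1) 2 algebra_simps flip: cis_mult)
      then have "dist b a \<le> norm (complex_of_real (y - \<rho>)) + norm (of_real \<rho> * (cis \<phi> - 1))"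
        by (simp only: dist_norm norm_cis_mult norm_triangle_ineq4)
      also have "norm (complex_of_real (y - \<rho>)) \<le> \<omega>"
        unfolding norm_of_real using \<omega>[OF \<tau> s(2)] \<rho>\<tau> \<rho>y s(3) by (simp add: \<tau>_def)
      also have "norm (of_real \<rho> * (cis \<phi> - 1)) \<le> (1 + slit_length t) * \<epsilon>"
        unfolding norm_mult norm_of_real
        using norm_cis_minus_1_le[of \<phi>] \<rho>y 2(3) \<rho>(2,4) by (intro mult_mono) auto
      finally show ?thesis by simp
    qed
  qed
qed

lemma hausdorff_dist_cluster_le:
  assumes c: "0 < c" and \<epsilon>: "0 < \<epsilon>" "\<epsilon> \<le> 1 / 16" and t: "0 \<le> t"
    and near: "angles_near \<epsilon> \<theta> (nat \<lfloor>t / c\<rfloor>)"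
    and \<omega>: "\<And>s s'. 0 \<le> s' \<Longrightarrow> s' \<le> s \<Longrightarrow> s \<le> t \<Longrightarrow> s - s' \<le> c + 4 * sqrt \<epsilon> \<Longrightarrow> slit_length s - slit_length s' \<le> \<omega>"
  shows "hausdorff_dist (cluster c \<theta> (nat \<lfloor>t / c\<rfloor>)) (slit_disk t (\<theta> 1)) \<le> ennreal (\<omega> + (1 + slit_length t) * \<epsilon>)"
proof -
  have \<omega>0: "0 \<le> \<omega>" using \<omega>[of 0 0] c t \<epsilon> by (simp add: add_nonneg_nonneg)
  have "c * nat \<lfloor>t / c\<rfloor> \<le> t"
  proof -
    have "real (nat \<lfloor>t / c\<rfloor>) \<le> t / c" using t c by simp
    then show ?thesis using c by (simp add: field_simps)
  qed
  then have "infdist a (slit_disk t (\<theta> 1)) \<le> (1 + slit_length t) * \<epsilon>" if "a \<in> cluster c \<theta> (nat \<lfloor>t / c\<rfloor>)" for a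
    using infdist_le_slit_disk[OF near _ _ _ _ that] c \<epsilon> pi_gt3 by simp
  then show ?thesis
    unfolding hausdorff_dist_def using infdist_le_cluster[OF assms] \<omega>0
    by (intro sup_least SUP_least ennreal_leI) force+
qed

section \<open>Measurability of the error functionals\<close>

definition lsc :: "('a::topological_space \<Rightarrow> ennreal) \<Rightarrow> bool" where
  "lsc f \<longleftrightarrow> (\<forall>a. open {x. a < f x})"

lemma lsc_SUP: "(\<And>i. i \<in> I \<Longrightarrow> lsc (f i)) \<Longrightarrow> lsc (\<lambda>x. SUP i\<in>I. f i x)"
proof -
  assume "\<And>i. i \<in> I \<Longrightarrow> lsc (f i)"
  moreover have "{x. a < (SUP i\<in>I. f i x)} = (\<Union>i\<in>I. {x. a < f i x})" for a by (auto simp: less_SUP_iff)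
  ultimately show ?thesis by (auto simp: lsc_def)
qed

lemma lsc_continuous:
  assumes "continuous_on UNIV f" shows "lsc (\<lambda>x. ennreal (f x))"
  unfolding lsc_def
  using continuous_on_ennreal[OF assms] by (auto intro!: open_Collect_less continuous_intros)

lemma lsc_borel_measurable: "lsc f \<Longrightarrow> f \<in> borel_measurable borel"
  by (intro borel_measurableI_greater) (auto simp: lsc_def)

lemma continuous_on_rotated_slit_map:
  assumes "0 \<le> c" "continuous_on S f" "continuous_on S g" "\<And>x. x \<in> S \<Longrightarrow> 1 \<le> norm (g x)"
  shows "continuous_on S (\<lambda>x. rotated_slit_map c (f x) (g x))"
  unfolding rotated_slit_map_def
  by (intro continuous_intros continuous_on_compose2[OF continuous_on_slit_map[OF assms(1)]] assms)
     (use assms in auto)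

lemma continuous_on_cluster_map:
  assumes "0 \<le> c" "continuous_on UNIV g" "\<And>x. 1 \<le> norm (g x)"
  shows "continuous_on UNIV (\<lambda>\<theta> :: nat \<Rightarrow> real. cluster_map c \<theta> n (g \<theta>))"
  using assms(2,3)
proof (induction n arbitrary: g)
  case (Suc n)
  show ?case unfolding cluster_map_Suc
  proof (rule Suc.IH)
    show "continuous_on UNIV (\<lambda>\<theta>. rotated_slit_map c (\<theta> (Suc n)) (g \<theta>))"
      using Suc.prems assms(1)
      by (intro continuous_on_rotated_slit_map continuous_on_product_coordinates) auto
    show "1 \<le> norm (rotated_slit_map c (\<theta> (Suc n)) (g \<theta>))" for \<theta>
      using norm_rotated_slit_map_ge[OF assms(1), of "g \<theta>" "\<theta> (Suc n)"] Suc.prems(2)[of \<theta>] by linarith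
  qed
qed simp

lemma slit_disk_rotate: "slit_disk t x = (\<lambda>z. cis x * z) ` slit_disk t 0"
proof -
  have "(\<lambda>z. cis x * z) ` cball 0 1 = cball 0 1"
  proof (intro equalityI subsetI)
    fix z assume "z \<in> cball (0::complex) 1"
    then show "z \<in> (\<lambda>z. cis x * z) ` cball 0 1"
      by (intro image_eqI[of _ _ "cis (- x) * z"]) (auto simp: cis_minus_cis)
  qed auto
  then show ?thesis by (simp add: slit_disk_def image_Un image_image)
qed

lemma infdist_slit_disk_rotate: "infdist a (slit_disk t x) = infdist (cis (- x) * a) (slit_disk t 0)"
proof -
  have "slit_disk t 0 \<noteq> {}" by (auto simp: slit_disk_def)
  moreover have "dist a (cis x * z) = dist (cis (- x) * a) z" for z
  proof -
    have "cis (- x) * (a - cis x * z) = cis (- x) * a - z" by (simp add: right_diff_distrib cis_minus_cis)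
    then show ?thesis by (metis dist_norm norm_cis_mult)
  qed
  ultimately show ?thesis by (simp add: infdist_def slit_disk_rotate[of t x] image_image)
qed

lemma SUP_ennreal_closure:
  fixes f :: "'a::metric_space \<Rightarrow> real"
  assumes f: "continuous_on UNIV f" and T: "T \<subseteq> S" "S \<subseteq> closure T"
  shows "(SUP s\<in>S. ennreal (f s)) = (SUP s\<in>T. ennreal (f s))"
proof (rule antisym)
  show "(SUP s\<in>S. ennreal (f s)) \<le> (SUP s\<in>T. ennreal (f s))"
  proof (rule SUP_least)
    fix s assume "s \<in> S"
    then have "s \<in> closure T" using T(2) by blast
    then obtain x where x: "\<And>n. x n \<in> T" "x \<longlonglongrightarrow> s" unfolding closure_sequential by blast
    have "(\<lambda>n. ennreal (f (x n))) \<longlonglongrightarrow> ennreal (f s)"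
      using f x(2) by (intro tendsto_ennrealI continuous_on_tendsto_compose[OF f]) auto
    then show "ennreal (f s) \<le> (SUP s\<in>T. ennreal (f s))"
      by (rule LIMSEQ_le_const2) (intro exI[of _ 0] allI impI SUP_upper x(1))
  qed
qed (use T(1) in \<open>auto intro: SUP_subset_mono\<close>)

lemma borel_measurable_infdist_cluster:
  assumes c: "0 \<le> c"
  shows "(\<lambda>\<theta>. infdist (cis (\<theta> 1) * of_real s) (cluster c \<theta> n)) \<in> borel_measurable borel"
proof -
  have "open {\<theta>. infdist (cis (\<theta> 1) * of_real s) (cluster c \<theta> n) < r}" for r
  proof -
    have "infdist x A < r \<longleftrightarrow> (\<exists>a\<in>A. dist x a < r)" if "A \<noteq> {}" for x :: complex and A
      using that by (simp add: infdist_notempty cINF_less_iff bdd_below_image_dist)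
    moreover have "cluster c \<theta> n \<noteq> {}" for \<theta> unfolding cluster_eq[OF c] by auto
    ultimately have "{\<theta>. infdist (cis (\<theta> 1) * of_real s) (cluster c \<theta> n) < r} =
        (\<Union>a\<in>cball 0 1. {\<theta>. dist (cis (\<theta> 1) * of_real s) a < r}) \<union>
        (\<Union>j<n. \<Union>y\<in>slit c. {\<theta>. dist (cis (\<theta> 1) * of_real s) (cluster_map c \<theta> j (cis (\<theta> (Suc j)) * y)) < r})"
      unfolding cluster_eq[OF c] by auto
    moreover have "open {\<theta>. dist (cis (\<theta> 1) * of_real s) a < r}" for a
      by (intro open_Collect_less continuous_intros continuous_on_product_coordinates)
    moreover have "open {\<theta>. dist (cis (\<theta> 1) * of_real s) (cluster_map c \<theta> j (cis (\<theta> (Suc j)) * y)) < r}"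
      if "y \<in> slit c" for y j
      using that c
      by (intro open_Collect_less continuous_intros continuous_on_product_coordinates continuous_on_cluster_map)
         (auto simp: slit_def)
    ultimately show ?thesis by (simp only:) (intro open_Un open_UN ballI; blast)
  qed
  then show ?thesis by (intro borel_measurableI_less) auto
qed

lemma borel_measurable_hausdorff_dist_cluster:
  assumes c: "0 \<le> c"
  shows "(\<lambda>\<theta>. hausdorff_dist (cluster c \<theta> n) (slit_disk t (\<theta> 1))) \<in> borel_measurable borel"
proof -
  define I where "I = {..<n} \<times> slit c"
  define f where "f p \<theta> = infdist (cis (- \<theta> 1) * cluster_map c \<theta> (fst p) (cis (\<theta> (Suc (fst p))) * snd p)) (slit_disk t 0)"
    for p :: "nat \<times> complex" and \<theta> :: "nat \<Rightarrow> real"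
  have S1: "(SUP a\<in>cluster c \<theta> n. ennreal (infdist a (slit_disk t (\<theta> 1)))) = (SUP p\<in>I. ennreal (f p \<theta>))" for \<theta>
  proof (rule antisym)
    show "(SUP a\<in>cluster c \<theta> n. ennreal (infdist a (slit_disk t (\<theta> 1)))) \<le> (SUP p\<in>I. ennreal (f p \<theta>))"
    proof (rule SUP_least)
      fix a assume "a \<in> cluster c \<theta> n"
      then consider "a \<in> cball 0 1"
        | j y where "j < n" "y \<in> slit c" "a = cluster_map c \<theta> j (cis (\<theta> (Suc j)) * y)"
        unfolding cluster_eq[OF c] by blast
      then show "ennreal (infdist a (slit_disk t (\<theta> 1))) \<le> (SUP p\<in>I. ennreal (f p \<theta>))"
      proof cases
        case 1
        then have "infdist a (slit_disk t (\<theta> 1)) = 0" by (intro infdist_zero) (simp add: slit_disk_def)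
        then show ?thesis by simp
      next
        case (2 j y)
        then show ?thesis unfolding infdist_slit_disk_rotate[of _ _ "\<theta> 1"]
          by (intro SUP_upper2[of "(j, y)"]) (auto simp: I_def f_def)
      qed
    qed
    show "(SUP p\<in>I. ennreal (f p \<theta>)) \<le> (SUP a\<in>cluster c \<theta> n. ennreal (infdist a (slit_disk t (\<theta> 1))))"
    proof (rule SUP_least)
      fix p assume "p \<in> I"
      then have "cluster_map c \<theta> (fst p) (cis (\<theta> (Suc (fst p))) * snd p) \<in> cluster c \<theta> n"
        unfolding cluster_eq[OF c] I_def by force
      then show "ennreal (f p \<theta>) \<le> (SUP a\<in>cluster c \<theta> n. ennreal (infdist a (slit_disk t (\<theta> 1))))"
        unfolding infdist_slit_disk_rotate[of _ _ "\<theta> 1"]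
        by (rule SUP_upper2) (simp add: f_def)
    qed
  qed
  have "continuous_on UNIV (f p)" if "p \<in> I" for p
    unfolding f_def using that c
    by (intro continuous_intros continuous_on_infdist continuous_on_product_coordinates continuous_on_cluster_map)
       (auto simp: I_def slit_def)
  then have m1: "(\<lambda>\<theta>. SUP a\<in>cluster c \<theta> n. ennreal (infdist a (slit_disk t (\<theta> 1)))) \<in> borel_measurable borel"
    unfolding S1 by (intro lsc_borel_measurable lsc_SUP lsc_continuous)
  obtain D where D: "countable D" "D \<subseteq> {1<..1 + slit_length t}" "{1<..1 + slit_length t} \<subseteq> closure D"
    using separable by blast
  define g where "g \<theta> s = infdist (cis (\<theta> 1) * of_real s) (cluster c \<theta> n)" for \<theta> s
  have S2: "(SUP b\<in>slit_disk t (\<theta> 1). ennreal (infdist b (cluster c \<theta> n))) = (SUP s\<in>D. ennreal (g \<theta> s))" for \<theta>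
  proof -
    have "(SUP b\<in>slit_disk t (\<theta> 1). ennreal (infdist b (cluster c \<theta> n))) = (SUP s\<in>{1<..1 + slit_length t}. ennreal (g \<theta> s))"
    proof (rule antisym)
      show "(SUP b\<in>slit_disk t (\<theta> 1). ennreal (infdist b (cluster c \<theta> n))) \<le> (SUP s\<in>{1<..1 + slit_length t}. ennreal (g \<theta> s))"
      proof (rule SUP_least)
        fix b assume "b \<in> slit_disk t (\<theta> 1)"
        then consider "b \<in> cball 0 1" | s where "b = cis (\<theta> 1) * of_real s" "s \<in> {1<..1 + slit_length t}"
          by (auto simp: slit_disk_def slit_def)
        then show "ennreal (infdist b (cluster c \<theta> n)) \<le> (SUP s\<in>{1<..1 + slit_length t}. ennreal (g \<theta> s))"
        proof cases
          case 1
          then have "infdist b (cluster c \<theta> n) = 0" by (intro infdist_zero) (simp add: cluster_eq[OF c])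
          then show ?thesis by simp
        next
          case (2 s)
          then show ?thesis by (intro SUP_upper2[of s]) (auto simp: g_def)
        qed
      qed
      show "(SUP s\<in>{1<..1 + slit_length t}. ennreal (g \<theta> s)) \<le> (SUP b\<in>slit_disk t (\<theta> 1). ennreal (infdist b (cluster c \<theta> n)))"
      proof (rule SUP_least)
        fix s assume "s \<in> {1<..1 + slit_length t}"
        then show "ennreal (g \<theta> s) \<le> (SUP b\<in>slit_disk t (\<theta> 1). ennreal (infdist b (cluster c \<theta> n)))"
          by (intro SUP_upper2[of "cis (\<theta> 1) * of_real s"]) (auto simp: g_def slit_disk_def slit_def)
      qed
    qed
    also have "\<dots> = (SUP s\<in>D. ennreal (g \<theta> s))"
      unfolding g_def by (intro SUP_ennreal_closure[OF _ D(2,3)] continuous_intros continuous_on_infdist)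
    finally show ?thesis .
  qed
  have m2: "(\<lambda>\<theta>. SUP b\<in>slit_disk t (\<theta> 1). ennreal (infdist b (cluster c \<theta> n))) \<in> borel_measurable borel"
    unfolding S2 g_def
    using D(1) borel_measurable_infdist_cluster[OF c] by (intro borel_measurable_SUP measurable_compose[OF _ measurable_ennreal]) auto
  show ?thesis unfolding hausdorff_dist_def by (intro borel_measurable_sup m1 m2)
qed

section \<open>The angle weight\<close>

lemma exp_Complex_eq: "exp (Complex \<sigma> s) = of_real (exp \<sigma>) * cis s"
  and exp_Complex_polar: "norm (exp (Complex \<sigma> s)) = exp \<sigma>" "Re (exp (Complex \<sigma> s)) = exp \<sigma> * cos s"
  by (simp_all add: exp_eq_polar[of "Complex \<sigma> s"] norm_mult)

definition weight_ratio :: "real \<Rightarrow> real \<Rightarrow> real \<Rightarrow> real" where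
  "weight_ratio \<sigma> t s =
    norm (koebe (exp (Complex \<sigma> s)) - of_real (4 * exp (- t))) / norm (koebe (exp (Complex \<sigma> s)) - 4)"

lemma norm_koebe_exp_minus_4:
  "norm (koebe (exp (Complex \<sigma> s)) - 4) = 2 * cosh \<sigma> - 2 * cos s"
  by (simp add: norm_koebe_minus_4 exp_Complex_polar cosh_def exp_minus field_simps power2_eq_square)

lemma Re_koebe_exp: "Re (koebe (exp (Complex \<sigma> s))) = 2 * cosh \<sigma> * cos s + 2"
proof -
  have "1 / exp (Complex \<sigma> s) = of_real (exp (- \<sigma>)) * cis (- s)"
    unfolding exp_Complex_eq by (simp add: exp_minus cis_inverse[symmetric] field_simps del: cis_inverse)
  then have "Re (1 / exp (Complex \<sigma> s)) = exp (- \<sigma>) * cos s" by simp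
  then show ?thesis by (simp add: koebe_def exp_Complex_polar(2) cosh_def algebra_simps)
qed

lemma norm_koebe_exp_minus_4_pos: "0 < \<sigma> \<Longrightarrow> 0 < norm (koebe (exp (Complex \<sigma> s)) - 4)"
  unfolding norm_koebe_exp_minus_4
  using cosh_real_strict_mono[of 0 \<sigma>] cos_le_one[of s] by (simp del: cos_le_one)

lemma weight_ratio_pos:
  assumes "0 < \<sigma>" "0 \<le> t"
  shows "0 < weight_ratio \<sigma> t s"
proof -
  have "1 < norm (exp (Complex \<sigma> s))" using assms by (simp add: exp_Complex_polar(1))
  then show ?thesis
    unfolding weight_ratio_def
    using norm_deriv_slit_map(2)[OF assms(2), of "exp (Complex \<sigma> s)"] norm_koebe_exp_minus_4_pos[OF assms(1), of s]
    by (intro divide_pos_pos) simp_all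
qed

lemma angle_weight_eq:
  assumes "0 < \<sigma>" "0 \<le> t"
  shows "angle_weight \<eta> \<sigma> t s = (norm (slit_map t (exp (Complex \<sigma> s))) / exp \<sigma>) powr (- \<eta>) *
    weight_ratio \<sigma> t s powr (\<eta> / 2)"
proof -
  define A where "A = norm (koebe (exp (Complex \<sigma> s)) - 4)"
  define B where "B = norm (koebe (exp (Complex \<sigma> s)) - of_real (4 * exp (- t)))"
  define R where "R = norm (slit_map t (exp (Complex \<sigma> s))) / exp \<sigma>"
  have z: "1 < norm (exp (Complex \<sigma> s))" using assms by (simp add: exp_Complex_polar)
  have A: "0 < A" unfolding A_def by (rule norm_koebe_exp_minus_4_pos[OF assms(1)])
  have B: "0 < B" unfolding B_def using norm_deriv_slit_map(2)[OF assms(2) z] by simp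
  have "norm (deriv (slit_map t) (exp (Complex \<sigma> s))) = R * sqrt (A / B)"
    using norm_deriv_slit_map(1)[OF assms(2) z] by (simp add: R_def A_def B_def exp_Complex_polar)
  then have "angle_weight \<eta> \<sigma> t s = (R * (A / B) powr (1 / 2)) powr (- \<eta>)"
    using A B by (simp add: angle_weight_def powr_half_sqrt)
  also have "\<dots> = R powr (- \<eta>) * ((A / B) powr (1 / 2)) powr (- \<eta>)"
    by (rule powr_mult)
  also have "((A / B) powr (1 / 2)) powr (- \<eta>) = (A / B) powr (- (\<eta> / 2))" by (simp add: powr_powr)
  also have "\<dots> = (B / A) powr (\<eta> / 2)" using A B by (simp add: powr_minus powr_divide field_simps)
  finally show ?thesis by (simp add: R_def A_def B_def weight_ratio_def)
qed

lemma powr_le_powr_abs: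
  fixes R L a :: real
  assumes "1 \<le> R" "R \<le> L" shows "R powr a \<le> L powr \<bar>a\<bar>"
proof -
  have "R powr a \<le> R powr \<bar>a\<bar>" using assms by (intro powr_mono) auto
  also have "\<dots> \<le> L powr \<bar>a\<bar>" using assms by (intro powr_mono2) auto
  finally show ?thesis .
qed

lemma angle_weight_bounds:
  fixes \<eta> :: real
  assumes "0 < \<sigma>" "0 \<le> t" "t \<le> T"
  defines "K \<equiv> (4 * exp T) powr \<bar>\<eta>\<bar>"
  shows "weight_ratio \<sigma> t s powr (\<eta> / 2) / K \<le> angle_weight \<eta> \<sigma> t s"
    "angle_weight \<eta> \<sigma> t s \<le> K * weight_ratio \<sigma> t s powr (\<eta> / 2)"
proof -
  define R where "R = norm (slit_map t (exp (Complex \<sigma> s))) / exp \<sigma>"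
  have z: "1 \<le> norm (exp (Complex \<sigma> s))" using assms by (simp add: exp_Complex_polar)
  have R: "1 \<le> R" "R \<le> 4 * exp T"
  proof -
    show "1 \<le> R" using norm_slit_map_ge[OF assms(2) z] by (simp add: R_def exp_Complex_polar)
    have "R \<le> 4 * exp t" using norm_slit_map_le[OF assms(2) z] by (simp add: R_def exp_Complex_polar field_simps)
    then show "R \<le> 4 * exp T" using assms(3) by (meson exp_le_cancel_iff mult_left_mono order_trans zero_le_numeral)
  qed
  have up: "R powr (- \<eta>) \<le> K" using powr_le_powr_abs[OF R, of "- \<eta>"] by (simp add: K_def)
  have "R powr \<eta> \<le> K" using powr_le_powr_abs[OF R, of \<eta>] by (simp add: K_def)
  moreover have "0 < K" by (simp add: K_def)
  ultimately have lo: "1 / K \<le> R powr (- \<eta>)"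
    using R by (simp add: powr_minus field_simps)
  have eq: "angle_weight \<eta> \<sigma> t s = R powr (- \<eta>) * weight_ratio \<sigma> t s powr (\<eta> / 2)"
    using angle_weight_eq[OF assms(1,2)] by (simp add: R_def)
  show "weight_ratio \<sigma> t s powr (\<eta> / 2) / K \<le> angle_weight \<eta> \<sigma> t s"
    unfolding eq using mult_right_mono[OF lo, of "weight_ratio \<sigma> t s powr (\<eta> / 2)"] by simp
  show "angle_weight \<eta> \<sigma> t s \<le> K * weight_ratio \<sigma> t s powr (\<eta> / 2)"
    unfolding eq using up by (intro mult_right_mono) auto
qed

lemma angle_weight_pos: "0 < \<sigma> \<Longrightarrow> 0 \<le> t \<Longrightarrow> 0 < angle_weight \<eta> \<sigma> t s"
  using angle_weight_eq[of \<sigma> t \<eta> s] weight_ratio_pos[of \<sigma> t s]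
    slit_map_neq_0[of t "exp (Complex \<sigma> s)"] by (simp add: exp_Complex_polar)

lemma angle_weight_nonneg: "0 \<le> angle_weight \<eta> \<sigma> t s"
  by (simp add: angle_weight_def)

lemma continuous_on_angle_weight:
  assumes "0 < \<sigma>" "0 \<le> t"
  shows "continuous_on S (angle_weight \<eta> \<sigma> t)"
proof -
  have "continuous_on S (\<lambda>s. (norm (slit_map t (of_real (exp \<sigma>) * cis s)) / exp \<sigma>) powr (- \<eta>) *
    weight_ratio \<sigma> t s powr (\<eta> / 2))"
  proof (intro continuous_intros)
    show "continuous_on S (\<lambda>s. slit_map t (of_real (exp \<sigma>) * cis s))"
      by (intro continuous_on_compose2[OF continuous_on_slit_map[OF assms(2)]] continuous_intros)
         (use assms in \<open>auto simp: norm_mult\<close>)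
    show "continuous_on S (weight_ratio \<sigma> t)"
      unfolding weight_ratio_def exp_Complex_eq koebe_def
      using norm_koebe_exp_minus_4_pos[OF assms(1)]
      by (intro continuous_intros) (auto simp: koebe_def exp_Complex_eq)
    show "\<forall>s\<in>S. norm (slit_map t (of_real (exp \<sigma>) * cis s)) / exp \<sigma> \<noteq> 0"
    proof
      fix s
      show "norm (slit_map t (of_real (exp \<sigma>) * cis s)) / exp \<sigma> \<noteq> 0"
        using slit_map_neq_0[OF assms(2), of "of_real (exp \<sigma>) * cis s"] assms by (simp add: norm_mult)
    qed
    show "\<forall>s\<in>S. weight_ratio \<sigma> t s \<noteq> 0" using weight_ratio_pos[OF assms] by (metis less_irrefl)
  qed auto
  then show ?thesis
    unfolding angle_weight_eq[OF assms, abs_def] exp_Complex_eq .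
qed

lemma borel_measurable_angle_weight [measurable]:
  "0 < \<sigma> \<Longrightarrow> 0 \<le> t \<Longrightarrow> angle_weight \<eta> \<sigma> t \<in> borel_measurable borel"
  by (intro borel_measurable_continuous_onI continuous_on_angle_weight)

lemma angle_weight_cis_cong: "cis s = cis s' \<Longrightarrow> angle_weight \<eta> \<sigma> t s = angle_weight \<eta> \<sigma> t s'"
  by (simp add: angle_weight_def exp_Complex_eq)

lemma koebe_cnj: "koebe (cnj z) = cnj (koebe z)"
  by (simp add: koebe_def)

lemma slit_map_cnj: "0 \<le> t \<Longrightarrow> 1 < norm z \<Longrightarrow> slit_map t (cnj z) = cnj (slit_map t z)"
  using slit_map_exterior[of t z] koebe_slit_map[of t z] by (intro slit_map_eqI) (auto simp: koebe_cnj)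

lemma angle_weight_minus:
  assumes "0 < \<sigma>" "0 \<le> t"
  shows "angle_weight \<eta> \<sigma> t (- s) = angle_weight \<eta> \<sigma> t s"
proof -
  have cnj: "exp (Complex \<sigma> (- s)) = cnj (exp (Complex \<sigma> s))"
    by (simp add: exp_Complex_eq cis_cnj)
  have "norm (slit_map t (exp (Complex \<sigma> (- s)))) = norm (slit_map t (exp (Complex \<sigma> s)))"
    unfolding cnj using assms by (subst slit_map_cnj) (auto simp: exp_Complex_polar)
  moreover have "weight_ratio \<sigma> t (- s) = weight_ratio \<sigma> t s"
  proof -
    have "norm (cnj v - w) = norm (v - w)" if "cnj w = w" for v w
      using that by (metis complex_cnj_diff complex_mod_cnj)
    then show ?thesis unfolding weight_ratio_def cnj koebe_cnj by simp
  qed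
  ultimately show ?thesis by (simp add: angle_weight_eq[OF assms])
qed

subsection \<open>The law of an increment\<close>

definition angle_law :: "real \<Rightarrow> real \<Rightarrow> real \<Rightarrow> real measure" where
  "angle_law \<eta> \<sigma> t =
    density lborel (\<lambda>s. ennreal (angle_weight \<eta> \<sigma> t s / angle_partition \<eta> \<sigma> t) * indicator {- pi<..pi} s)"

lemma space_angle_law [simp]: "space (angle_law \<eta> \<sigma> t) = UNIV"
  and sets_angle_law [simp, measurable_cong]: "sets (angle_law \<eta> \<sigma> t) = sets borel"
  by (simp_all add: angle_law_def)

context
  fixes \<sigma> t \<eta> :: real
  assumes \<sigma>: "0 < \<sigma>" and t: "0 \<le> t"
begin

lemma borel_measurable_angle_weight': "angle_weight \<eta> \<sigma> t \<in> borel_measurable borel"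
  by (rule borel_measurable_angle_weight[OF \<sigma> t])

lemma angle_partition_eq:
  "ennreal (angle_partition \<eta> \<sigma> t) = (\<integral>\<^sup>+s. ennreal (angle_weight \<eta> \<sigma> t s) * indicator {- pi<..pi} s \<partial>lborel)"
proof -
  have int: "set_integrable lborel {- pi..pi} (angle_weight \<eta> \<sigma> t)"
    by (rule borel_integrable_atLeastAtMost'[OF continuous_on_angle_weight[OF \<sigma> t]])
  have "(\<integral>\<^sup>+s. ennreal (angle_weight \<eta> \<sigma> t s) * indicator {- pi<..pi} s \<partial>lborel) =
    (\<integral>\<^sup>+s. ennreal (indicator {- pi..pi} s *\<^sub>R angle_weight \<eta> \<sigma> t s) \<partial>lborel)"
    by (rule nn_integral_cong_AE) (use AE_lborel_singleton[of "- pi"] in eventually_elim, auto split: split_indicator)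
  also have "\<dots> = ennreal (angle_partition \<eta> \<sigma> t)"
    unfolding angle_partition_def set_lebesgue_integral_def
    using int by (intro nn_integral_eq_integral) (auto simp: set_integrable_def angle_weight_nonneg)
  finally show ?thesis ..
qed

lemma angle_partition_ge:
  assumes d: "\<And>s. a \<le> s \<Longrightarrow> s \<le> b \<Longrightarrow> d \<le> angle_weight \<eta> \<sigma> t s" and "- pi < a" "a \<le> b" "b \<le> pi"
  shows "d * (b - a) \<le> angle_partition \<eta> \<sigma> t"
proof (cases "0 \<le> d")
  case True
  have "ennreal (d * (b - a)) = (\<integral>\<^sup>+s. ennreal d * indicator {a..b} s \<partial>lborel)"
    using True assms by (simp add: nn_integral_cmult_indicator ennreal_mult)
  also have "\<dots> \<le> ennreal (angle_partition \<eta> \<sigma> t)"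
    unfolding angle_partition_eq
    by (rule nn_integral_mono) (use assms in \<open>auto split: split_indicator intro: ennreal_leI\<close>)
  finally have "ennreal (d * (b - a)) \<le> ennreal (angle_partition \<eta> \<sigma> t)" .
  moreover have "0 \<le> angle_partition \<eta> \<sigma> t"
    unfolding angle_partition_def set_lebesgue_integral_def
    by (rule integral_nonneg_AE) (simp add: angle_weight_nonneg)
  ultimately show ?thesis by simp
next
  case False
  have "0 \<le> angle_partition \<eta> \<sigma> t"
    unfolding angle_partition_def set_lebesgue_integral_def
    by (rule integral_nonneg_AE) (simp add: angle_weight_nonneg)
  moreover have "d * (b - a) \<le> 0" using False assms by (simp add: mult_nonpos_nonneg)
  ultimately show ?thesis by linarith
qed

lemma angle_partition_pos: "0 < angle_partition \<eta> \<sigma> t"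
proof -
  obtain m where m: "m \<in> {0..pi}" "\<And>s. s \<in> {0..pi} \<Longrightarrow> angle_weight \<eta> \<sigma> t m \<le> angle_weight \<eta> \<sigma> t s"
    using continuous_attains_inf[of "{0..pi}" "angle_weight \<eta> \<sigma> t"] continuous_on_angle_weight[OF \<sigma> t] by force
  have "0 < angle_weight \<eta> \<sigma> t m * (pi - 0)" using angle_weight_pos[OF \<sigma> t] by simp
  also have "\<dots> \<le> angle_partition \<eta> \<sigma> t" using m by (intro angle_partition_ge) auto
  finally show ?thesis .
qed

lemma nn_integral_angle_law:
  assumes [measurable]: "f \<in> borel_measurable borel"
  shows "(\<integral>\<^sup>+s. f s \<partial>angle_law \<eta> \<sigma> t) =
    (\<integral>\<^sup>+s. ennreal (angle_weight \<eta> \<sigma> t s / angle_partition \<eta> \<sigma> t) * indicator {- pi<..pi} s * f s \<partial>lborel)"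
  unfolding angle_law_def
  by (rule nn_integral_density) (use borel_measurable_angle_weight' in measurable)

lemma prob_space_angle_law: "prob_space (angle_law \<eta> \<sigma> t)"
proof
  note borel_measurable_angle_weight'[measurable]
  have "emeasure (angle_law \<eta> \<sigma> t) (space (angle_law \<eta> \<sigma> t)) = (\<integral>\<^sup>+s. 1 \<partial>angle_law \<eta> \<sigma> t)" by simp
  also have "\<dots> = (\<integral>\<^sup>+s. ennreal (1 / angle_partition \<eta> \<sigma> t) * (ennreal (angle_weight \<eta> \<sigma> t s) * indicator {- pi<..pi} s) \<partial>lborel)"
    using angle_partition_pos
    by (subst nn_integral_angle_law)
       (auto intro!: nn_integral_cong simp: ennreal_mult[symmetric] angle_weight_nonneg split: split_indicator)
  also have "\<dots> = ennreal (1 / angle_partition \<eta> \<sigma> t) * ennreal (angle_partition \<eta> \<sigma> t)"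
    unfolding angle_partition_eq by (rule nn_integral_cmult) measurable
  also have "\<dots> = 1" using angle_partition_pos by (simp add: ennreal_mult[symmetric])
  finally show "emeasure (angle_law \<eta> \<sigma> t) (space (angle_law \<eta> \<sigma> t)) = 1" .
qed

lemma angle_law_symmetric:
  assumes [measurable]: "f \<in> borel_measurable borel"
  shows "(\<integral>\<^sup>+s. f (- s) \<partial>angle_law \<eta> \<sigma> t) = (\<integral>\<^sup>+s. f s \<partial>angle_law \<eta> \<sigma> t)"
proof -
  note borel_measurable_angle_weight'[measurable]
  define g where "g s = ennreal (angle_weight \<eta> \<sigma> t s / angle_partition \<eta> \<sigma> t) * indicator {- pi<..pi} s * f s" for s
  have [measurable]: "g \<in> borel_measurable borel" unfolding g_def by measurable
  have "(\<integral>\<^sup>+s. f s \<partial>angle_law \<eta> \<sigma> t) = (\<integral>\<^sup>+s. g s \<partial>lborel)"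
    unfolding g_def by (rule nn_integral_angle_law) measurable
  also have "\<dots> = (\<integral>\<^sup>+s. g (- s) \<partial>lborel)"
    using nn_integral_real_affine[of g "- 1" 0] by simp
  also have "\<dots> = (\<integral>\<^sup>+s. ennreal (angle_weight \<eta> \<sigma> t s / angle_partition \<eta> \<sigma> t) * indicator {- pi<..pi} s * f (- s) \<partial>lborel)"
    by (rule nn_integral_cong_AE)
       (use AE_lborel_singleton[of "- pi"] AE_lborel_singleton[of pi] in eventually_elim,
        auto simp: g_def angle_weight_minus[OF \<sigma> t] split: split_indicator)
  also have "\<dots> = (\<integral>\<^sup>+s. f (- s) \<partial>angle_law \<eta> \<sigma> t)"
    by (rule nn_integral_angle_law[symmetric]) measurable
  finally show ?thesis ..
qed

lemma AE_angle_law: "AE s in angle_law \<eta> \<sigma> t. s \<in> {- pi<..pi}"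
  unfolding angle_law_def
  by (subst AE_density) (use borel_measurable_angle_weight' in \<open>auto split: split_indicator\<close>)

lemma emeasure_angle_law_le:
  assumes [measurable]: "S \<in> sets borel"
    and num: "(\<integral>\<^sup>+s. ennreal (angle_weight \<eta> \<sigma> t s) * indicator (S \<inter> {- pi<..pi}) s \<partial>lborel) \<le> ennreal n"
    and den: "d \<le> angle_partition \<eta> \<sigma> t" "0 < d" and n: "0 \<le> n"
  shows "emeasure (angle_law \<eta> \<sigma> t) S \<le> ennreal (n / d)"
proof -
  note borel_measurable_angle_weight'[measurable]
  have "emeasure (angle_law \<eta> \<sigma> t) S = (\<integral>\<^sup>+s. indicator S s \<partial>angle_law \<eta> \<sigma> t)" by simp
  also have "\<dots> = (\<integral>\<^sup>+s. ennreal (1 / angle_partition \<eta> \<sigma> t) * (ennreal (angle_weight \<eta> \<sigma> t s) * indicator (S \<inter> {- pi<..pi}) s) \<partial>lborel)"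
    using angle_partition_pos
    by (subst nn_integral_angle_law)
       (auto intro!: nn_integral_cong simp: ennreal_mult[symmetric] angle_weight_nonneg split: split_indicator)
  also have "\<dots> = ennreal (1 / angle_partition \<eta> \<sigma> t) * (\<integral>\<^sup>+s. ennreal (angle_weight \<eta> \<sigma> t s) * indicator (S \<inter> {- pi<..pi}) s \<partial>lborel)"
    by (rule nn_integral_cmult) measurable
  also have "\<dots> \<le> ennreal (1 / angle_partition \<eta> \<sigma> t) * ennreal n" by (rule mult_left_mono[OF num]) simp
  also have "\<dots> = ennreal (n / angle_partition \<eta> \<sigma> t)" using n angle_partition_pos by (simp add: ennreal_mult[symmetric])
  also have "\<dots> \<le> ennreal (n / d)" using n den by (intro ennreal_leI divide_left_mono) auto
  finally show ?thesis .
qed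

lemma angle_law_square_shift:
  "(\<integral>\<^sup>+s. ennreal ((y + s)\<^sup>2) \<partial>angle_law \<eta> \<sigma> t) = ennreal (y\<^sup>2) + (\<integral>\<^sup>+s. ennreal (s\<^sup>2) \<partial>angle_law \<eta> \<sigma> t)"
proof -
  interpret prob_space "angle_law \<eta> \<sigma> t" by (rule prob_space_angle_law)
  define I where "I = (\<integral>\<^sup>+s. ennreal ((y + s)\<^sup>2) \<partial>angle_law \<eta> \<sigma> t)"
  define J where "J = (\<integral>\<^sup>+s. ennreal (s\<^sup>2) \<partial>angle_law \<eta> \<sigma> t)"
  have "(\<integral>\<^sup>+s. ennreal ((y + - s)\<^sup>2) \<partial>angle_law \<eta> \<sigma> t) = I"
    unfolding I_def by (rule angle_law_symmetric) measurable
  then have "I + I = (\<integral>\<^sup>+s. ennreal ((y + s)\<^sup>2) + ennreal ((y + - s)\<^sup>2) \<partial>angle_law \<eta> \<sigma> t)"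
    by (subst nn_integral_add) (auto simp: I_def)
  also have "\<dots> = (\<integral>\<^sup>+s. 2 * (ennreal (y\<^sup>2) + ennreal (s\<^sup>2)) \<partial>angle_law \<eta> \<sigma> t)"
  proof (rule nn_integral_cong)
    fix s :: real
    have "ennreal ((y + s)\<^sup>2) + ennreal ((y + - s)\<^sup>2) = ennreal ((y + s)\<^sup>2 + (y + - s)\<^sup>2)"
      by (rule ennreal_plus[symmetric]) auto
    also have "(y + s)\<^sup>2 + (y + - s)\<^sup>2 = 2 * (y\<^sup>2 + s\<^sup>2)" by (simp add: power2_eq_square algebra_simps)
    also have "ennreal \<dots> = ennreal 2 * ennreal (y\<^sup>2 + s\<^sup>2)" by (rule ennreal_mult) auto
    finally show "ennreal ((y + s)\<^sup>2) + ennreal ((y + - s)\<^sup>2) = 2 * (ennreal (y\<^sup>2) + ennreal (s\<^sup>2))"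
      by simp
  qed
  also have "\<dots> = 2 * (ennreal (y\<^sup>2) + J)"
    by (simp add: nn_integral_cmult nn_integral_add J_def emeasure_space_1[simplified])
  finally have "2 * I = 2 * (ennreal (y\<^sup>2) + J)" by (simp add: mult_2)
  then have "I = ennreal (y\<^sup>2) + J" unfolding ennreal_mult_cancel_left by simp
  then show ?thesis by (simp add: I_def J_def)
qed

lemma angle_law_second_moment:
  assumes "0 \<le> x"
  shows "(\<integral>\<^sup>+s. ennreal (s\<^sup>2) \<partial>angle_law \<eta> \<sigma> t) \<le> ennreal (x\<^sup>2) + ennreal (pi\<^sup>2) * emeasure (angle_law \<eta> \<sigma> t) {s. x < \<bar>s\<bar>}"
proof -
  interpret prob_space "angle_law \<eta> \<sigma> t" by (rule prob_space_angle_law)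
  have "(\<integral>\<^sup>+s. ennreal (s\<^sup>2) \<partial>angle_law \<eta> \<sigma> t) \<le>
      (\<integral>\<^sup>+s. ennreal (x\<^sup>2) + ennreal (pi\<^sup>2) * indicator {s. x < \<bar>s\<bar>} s \<partial>angle_law \<eta> \<sigma> t)"
  proof (rule nn_integral_mono_AE, use AE_angle_law in eventually_elim)
    fix s assume s: "s \<in> {- pi<..pi}"
    show "ennreal (s\<^sup>2) \<le> ennreal (x\<^sup>2) + ennreal (pi\<^sup>2) * indicator {s. x < \<bar>s\<bar>} s"
    proof (cases "x < \<bar>s\<bar>")
      case True
      have "s\<^sup>2 \<le> pi\<^sup>2" using s abs_le_square_iff[of s pi] by auto
      then have "ennreal (s\<^sup>2) \<le> ennreal (x\<^sup>2) + ennreal (pi\<^sup>2)" by (simp add: ennreal_leI add_increasing flip: ennreal_plus)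
      then show ?thesis using True by simp
    next
      case False
      then have "s\<^sup>2 \<le> x\<^sup>2" using abs_le_square_iff[of s x] assms by auto
      then show ?thesis using False by (simp add: ennreal_leI)
    qed
  qed
  also have "\<dots> = ennreal (x\<^sup>2) + ennreal (pi\<^sup>2) * emeasure (angle_law \<eta> \<sigma> t) {s. x < \<bar>s\<bar>}"
    by (simp add: nn_integral_add nn_integral_cmult emeasure_space_1[simplified])
  finally show ?thesis .
qed

end

subsection \<open>Concentration at the tip\<close>

lemma nn_integral_abs_le:
  fixes g :: "real \<Rightarrow> ennreal"
  assumes [measurable]: "g \<in> borel_measurable borel"
  shows "(\<integral>\<^sup>+s. g \<bar>s\<bar> \<partial>lborel) \<le> 2 * (\<integral>\<^sup>+s. g s * indicator {0..} s \<partial>lborel)"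
proof -
  define h where "h s = g s * indicator {0..} s" for s
  have [measurable]: "h \<in> borel_measurable borel" unfolding h_def by measurable
  have "(\<integral>\<^sup>+s. g \<bar>s\<bar> \<partial>lborel) \<le> (\<integral>\<^sup>+s. h s + h (- s) \<partial>lborel)"
    by (rule nn_integral_mono) (auto simp: h_def abs_if split: split_indicator)
  also have "\<dots> = (\<integral>\<^sup>+s. h s \<partial>lborel) + (\<integral>\<^sup>+s. h (- s) \<partial>lborel)" by (rule nn_integral_add) measurable
  also have "(\<integral>\<^sup>+s. h (- s) \<partial>lborel) = (\<integral>\<^sup>+s. h s \<partial>lborel)"
    using nn_integral_real_affine[of h "- 1" 0] by simp
  finally show ?thesis by (simp add: h_def mult_2)
qed

lemma abs_le_2_abs_sin:
  assumes "\<bar>y\<bar> \<le> pi / 2" shows "\<bar>y\<bar> \<le> 2 * \<bar>sin y\<bar>"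
proof -
  have pos: "u \<le> 2 * sin u" if u: "0 < u" "u \<le> pi / 2" for u :: real
  proof -
    have "\<exists>z. 0 < z \<and> z < u / 2 \<and> sin (u / 2) - sin 0 = (u / 2 - 0) * cos z"
      using u by (intro MVT2) (auto intro!: derivative_eq_intros)
    then obtain z where z: "0 < z" "z < u / 2" "sin (u / 2) = u / 2 * cos z" by auto
    have c: "cos (pi / 4) \<le> cos z" "cos (pi / 4) \<le> cos (u / 2)"
      using z u by (auto intro!: cos_monotone_0_pi_le)
    have s2: "cos (pi / 4) * cos (pi / 4) = 1 / (2::real)" by (simp add: cos_45)
    have c0: "0 \<le> cos (pi / 4 :: real)" by (simp add: cos_45)
    have "u * (cos (pi / 4) * cos (pi / 4)) \<le> u * (cos z * cos (u / 2))"
      using c c0 u by (intro mult_left_mono mult_mono) auto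
    also have "\<dots> = sin u" using sin_double[of "u / 2"] by (simp add: z(3))
    finally show ?thesis by (simp add: s2)
  qed
  show ?thesis
  proof (cases "y = 0")
    case False
    have "\<bar>sin y\<bar> = \<bar>sin \<bar>y\<bar>\<bar>" by (simp add: abs_if)
    then show ?thesis using pos[of "\<bar>y\<bar>"] assms False by simp
  qed simp
qed

lemma two_minus_two_cos: "2 - 2 * cos s = 4 * (sin (s / 2))\<^sup>2" for s :: real
  using cos_double_sin[of "s / 2"] by simp

lemma norm_koebe_exp_minus_4_ge:
  assumes "\<bar>s\<bar> \<le> pi"
  shows "s\<^sup>2 / 4 \<le> norm (koebe (exp (Complex \<sigma> s)) - 4)"
proof -
  have "\<bar>s / 2\<bar> \<le> 2 * \<bar>sin (s / 2)\<bar>" using assms by (intro abs_le_2_abs_sin) auto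
  then have "\<bar>s / 2\<bar>\<^sup>2 \<le> (2 * \<bar>sin (s / 2)\<bar>)\<^sup>2" by (intro power_mono) auto
  then have "s\<^sup>2 / 4 \<le> 2 - 2 * cos s" unfolding two_minus_two_cos by (simp add: power_mult_distrib power_divide)
  then show ?thesis unfolding norm_koebe_exp_minus_4 using cosh_real_ge_1[of \<sigma>] by linarith
qed

lemma norm_four_minus: "0 \<le> t \<Longrightarrow> norm (4 - complex_of_real (4 * exp (- t))) = 4 * (1 - exp (- t))"
proof -
  assume "0 \<le> t"
  have "4 - complex_of_real (4 * exp (- t)) = of_real (4 * (1 - exp (- t)))" by simp
  then show ?thesis using \<open>0 \<le> t\<close> by (simp only: norm_of_real) simp
qed

lemma weight_ratio_le:
  assumes "0 < \<sigma>" "0 \<le> t" "\<bar>s\<bar> \<le> pi" "s \<noteq> 0"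
  shows "weight_ratio \<sigma> t s \<le> 1 + 16 * (1 - exp (- t)) / s\<^sup>2"
proof -
  define p where "p = koebe (exp (Complex \<sigma> s))"
  have A: "s\<^sup>2 / 4 \<le> norm (p - 4)" unfolding p_def by (rule norm_koebe_exp_minus_4_ge[OF assms(3)])
  have s2: "0 < s\<^sup>2 / 4" using assms by simp
  have A0: "0 < norm (p - 4)" using A s2 by linarith
  have "norm (p - of_real (4 * exp (- t))) \<le> norm (p - 4) + 4 * (1 - exp (- t))"
    using norm_triangle_ineq[of "p - 4" "4 - of_real (4 * exp (- t))"] norm_four_minus[OF assms(2)] by simp
  then have "weight_ratio \<sigma> t s \<le> (norm (p - 4) + 4 * (1 - exp (- t))) / norm (p - 4)"
    unfolding weight_ratio_def p_def[symmetric] using A0 by (intro divide_right_mono) auto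
  also have "\<dots> = 1 + 4 * (1 - exp (- t)) / norm (p - 4)" using A0 by (simp add: field_simps)
  also have "\<dots> \<le> 1 + 4 * (1 - exp (- t)) / (s\<^sup>2 / 4)"
    using A A0 s2 assms by (intro add_left_mono divide_left_mono) auto
  also have "\<dots> = 1 + 16 * (1 - exp (- t)) / s\<^sup>2" by simp
  finally show ?thesis .
qed

lemma weight_ratio_ge_near_0:
  assumes "0 < \<sigma>" "\<sigma> \<le> 1" "0 \<le> t" "\<sigma>\<^sup>2 \<le> 1 - exp (- t)" "\<bar>s\<bar> \<le> \<sigma>"
  shows "(1 - exp (- t)) / (3 * \<sigma>\<^sup>2) \<le> weight_ratio \<sigma> t s"
proof -
  define p where "p = koebe (exp (Complex \<sigma> s))"
  have "exp (- \<sigma>) \<le> 1 / (1 + \<sigma>)"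
    using exp_ge_add_one_self[of \<sigma>] assms by (simp add: exp_minus inverse_eq_divide frac_le)
  also have "\<dots> \<le> 1 - \<sigma> + \<sigma>\<^sup>2"
  proof -
    have "1 \<le> (1 - \<sigma> + \<sigma>\<^sup>2) * (1 + \<sigma>)" using assms by (simp add: power2_eq_square algebra_simps)
    then show ?thesis using assms by (simp add: divide_le_eq)
  qed
  finally have "2 * cosh \<sigma> \<le> 2 + 2 * \<sigma>\<^sup>2" using exp_bound[of \<sigma>] assms by (simp add: cosh_def)
  moreover have "2 - 2 * cos s \<le> s\<^sup>2"
  proof -
    have "\<bar>sin (s / 2)\<bar>\<^sup>2 \<le> \<bar>s / 2\<bar>\<^sup>2" using abs_sin_x_le_abs_x[of "s / 2"] by (intro power_mono) auto
    then show ?thesis unfolding two_minus_two_cos by (simp add: power_divide)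
  qed
  moreover have "s\<^sup>2 \<le> \<sigma>\<^sup>2" using assms abs_le_square_iff[of s \<sigma>] by simp
  ultimately have A: "norm (p - 4) \<le> 3 * \<sigma>\<^sup>2" unfolding p_def norm_koebe_exp_minus_4 by linarith
  have "4 * (1 - exp (- t)) \<le> norm (p - of_real (4 * exp (- t))) + norm (p - 4)"
    using norm_triangle_ineq4[of "p - of_real (4 * exp (- t))" "p - 4"] norm_four_minus[OF assms(3)]
    by (simp add: norm_minus_commute)
  moreover have "4 * b \<le> N + a \<Longrightarrow> a \<le> 3 * r \<Longrightarrow> r \<le> b \<Longrightarrow> b \<le> N" for a b r N :: real by linarith
  ultimately have B: "1 - exp (- t) \<le> norm (p - of_real (4 * exp (- t)))" using A assms(4) by metis
  show ?thesis unfolding weight_ratio_def p_def[symmetric]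
    using A B assms norm_koebe_exp_minus_4_pos[OF assms(1), of s]
    by (intro frac_le) (auto simp: p_def)
qed

lemma nn_integral_abs_powr_tail:
  assumes "1 < \<eta>" "0 < x"
  shows "(\<integral>\<^sup>+s. ennreal (\<bar>s\<bar> powr (- \<eta>)) * indicator {s. x < \<bar>s\<bar>} s \<partial>lborel) \<le> ennreal (2 * x powr (1 - \<eta>) / (\<eta> - 1))"
proof -
  have "(\<integral>\<^sup>+s. ennreal (\<bar>s\<bar> powr (- \<eta>)) * indicator {s. x < \<bar>s\<bar>} s \<partial>lborel)
      = (\<integral>\<^sup>+s. ennreal (\<bar>s\<bar> powr (- \<eta>)) * indicator {x<..} \<bar>s\<bar> \<partial>lborel)"
    by (rule nn_integral_cong) (auto split: split_indicator)
  also have "\<dots> \<le> 2 * (\<integral>\<^sup>+s. ennreal (s powr (- \<eta>)) * indicator {x<..} s * indicator {0..} s \<partial>lborel)"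
    by (rule nn_integral_abs_le[of "\<lambda>s. ennreal (s powr (- \<eta>)) * indicator {x<..} s"]) measurable
  also have "(\<integral>\<^sup>+s. ennreal (s powr (- \<eta>)) * indicator {x<..} s * indicator {0..} s \<partial>lborel)
      \<le> (\<integral>\<^sup>+s. ennreal (indicator {x..} s * s powr (- \<eta>)) \<partial>lborel)"
    by (rule nn_integral_mono) (auto split: split_indicator)
  also have "\<dots> = ennreal (- (x powr (- \<eta> + 1)) / (- \<eta> + 1))"
    by (rule nn_integral_has_integral_lebesgue[OF _ has_integral_powr_to_inf]) (use assms in auto)
  also have "- (x powr (- \<eta> + 1)) / (- \<eta> + 1) = x powr (1 - \<eta>) / (\<eta> - 1)"
    using assms by (simp add: field_simps)
  finally show ?thesis
    using assms ennreal_mult[of 2 "x powr (1 - \<eta>) / (\<eta> - 1)"] by (simp add: mult_left_mono)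
qed

lemma nn_integral_abs_powr_near_0:
  assumes "m < 1" "0 < b"
  shows "(\<integral>\<^sup>+s. ennreal (\<bar>s\<bar> powr (- m)) * indicator {s. \<bar>s\<bar> < b} s \<partial>lborel) \<le> ennreal (2 * b powr (1 - m) / (1 - m))"
proof -
  have "(\<integral>\<^sup>+s. ennreal (\<bar>s\<bar> powr (- m)) * indicator {s. \<bar>s\<bar> < b} s \<partial>lborel)
      = (\<integral>\<^sup>+s. ennreal (\<bar>s\<bar> powr (- m)) * indicator {..<b} \<bar>s\<bar> \<partial>lborel)"
    by (rule nn_integral_cong) (auto split: split_indicator)
  also have "\<dots> \<le> 2 * (\<integral>\<^sup>+s. ennreal (s powr (- m)) * indicator {..<b} s * indicator {0..} s \<partial>lborel)"
    by (rule nn_integral_abs_le[of "\<lambda>s. ennreal (s powr (- m)) * indicator {..<b} s"]) measurable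
  also have "(\<integral>\<^sup>+s. ennreal (s powr (- m)) * indicator {..<b} s * indicator {0..} s \<partial>lborel)
      \<le> (\<integral>\<^sup>+s. ennreal (indicator {0..b} s * s powr (- m)) \<partial>lborel)"
    by (rule nn_integral_mono) (auto split: split_indicator)
  also have "\<dots> = ennreal (b powr (- m + 1) / (- m + 1))"
    by (rule nn_integral_has_integral_lebesgue[OF _ has_integral_powr_from_0]) (use assms in auto)
  also have "b powr (- m + 1) / (- m + 1) = b powr (1 - m) / (1 - m)" by (simp add: add.commute)
  finally show ?thesis
    using assms ennreal_mult[of 2 "b powr (1 - m) / (1 - m)"] by (simp add: mult_left_mono)
qed

lemma angle_law_tail:
  fixes \<eta> T :: real
  assumes \<eta>: "1 < \<eta>"
  obtains C where "0 < C"
    "\<And>\<sigma> t x. 0 < t \<Longrightarrow> t \<le> T \<Longrightarrow> 0 < \<sigma> \<Longrightarrow> \<sigma> \<le> 1 \<Longrightarrow> \<sigma>\<^sup>2 \<le> 1 - exp (- t) \<Longrightarrow> 0 < x \<Longrightarrow>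
      emeasure (angle_law \<eta> \<sigma> t) {s. x < \<bar>s\<bar>} \<le>
        ennreal (C * (\<sigma> powr (\<eta> - 1) * ((1 - exp (- t)) powr (- \<eta> / 2) + x powr (1 - \<eta>))))"
proof
  define K where "K = (4 * exp T) powr \<bar>\<eta>\<bar>"
  define G where "G = pi + 4 powr \<eta> / (\<eta> - 1)"
  define C where "C = K\<^sup>2 * 6 powr (\<eta> / 2) * G"
  have K: "0 < K" by (simp add: K_def)
  have G: "0 < G" unfolding G_def using \<eta> by (intro add_pos_pos divide_pos_pos) auto
  show "0 < C" using K G by (simp add: C_def)
  fix \<sigma> t x :: real
  assume t: "0 < t" "t \<le> T" and \<sigma>: "0 < \<sigma>" "\<sigma> \<le> 1" "\<sigma>\<^sup>2 \<le> 1 - exp (- t)" and x: "0 < x"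
  define b where "b = 1 - exp (- t)"
  have b: "0 < b" using t by (simp add: b_def)
  have t0: "0 \<le> t" using t by simp
  note bounds = angle_weight_bounds[OF \<sigma>(1) t0 t(2), where \<eta> = \<eta>, folded K_def]
  note borel_measurable_angle_weight[OF \<sigma>(1) t0, measurable]
  define n where "n = K * 2 powr (\<eta> / 2) * (2 * pi + 4 powr \<eta> * b powr (\<eta> / 2) * (2 * x powr (1 - \<eta>) / (\<eta> - 1)))"
  define d where "d = (b / (3 * \<sigma>\<^sup>2)) powr (\<eta> / 2) / K * (\<sigma> - - \<sigma>)"
  have w: "angle_weight \<eta> \<sigma> t s \<le> K * 2 powr (\<eta> / 2) * (1 + 4 powr \<eta> * b powr (\<eta> / 2) * \<bar>s\<bar> powr (- \<eta>))"
    if s: "\<bar>s\<bar> \<le> pi" "s \<noteq> 0" for s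
  proof -
    define y where "y = 16 * b / s\<^sup>2"
    have y: "0 < y" using b s by (simp add: y_def)
    have "weight_ratio \<sigma> t s powr (\<eta> / 2) \<le> (2 * max 1 y) powr (\<eta> / 2)"
      using weight_ratio_le[OF \<sigma>(1) t0 s] weight_ratio_pos[OF \<sigma>(1) t0, of s] \<eta>
      by (intro powr_mono2) (auto simp: y_def b_def)
    also have "\<dots> = 2 powr (\<eta> / 2) * max 1 y powr (\<eta> / 2)" by (rule powr_mult)
    also have "max 1 y powr (\<eta> / 2) \<le> 1 + y powr (\<eta> / 2)" by (simp add: max_def)
    also have "y powr (\<eta> / 2) = 4 powr \<eta> * b powr (\<eta> / 2) * \<bar>s\<bar> powr (- \<eta>)"
    proof -
      have "y = (4 powr 2) * b * (\<bar>s\<bar> powr (-2))"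
        using s by (simp add: y_def powr_minus powr_realpow power2_abs divide_inverse)
      then have "y powr (\<eta> / 2) = (4 powr 2) powr (\<eta> / 2) * b powr (\<eta> / 2) * (\<bar>s\<bar> powr (-2)) powr (\<eta> / 2)"
        using b by (simp only:) (subst powr_mult; simp add: powr_mult)+
      then show ?thesis by (simp add: powr_powr)
    qed
    finally have "weight_ratio \<sigma> t s powr (\<eta> / 2) \<le> 2 powr (\<eta> / 2) * (1 + 4 powr \<eta> * b powr (\<eta> / 2) * \<bar>s\<bar> powr (- \<eta>))"
      by simp
    then have "K * weight_ratio \<sigma> t s powr (\<eta> / 2) \<le> K * (2 powr (\<eta> / 2) * (1 + 4 powr \<eta> * b powr (\<eta> / 2) * \<bar>s\<bar> powr (- \<eta>)))"
      using K by (intro mult_left_mono) auto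
    then show ?thesis using bounds(2)[of s] by simp
  qed
  have "emeasure (angle_law \<eta> \<sigma> t) {s. x < \<bar>s\<bar>} \<le> ennreal (n / d)"
  proof (rule emeasure_angle_law_le[OF \<sigma>(1) t0])
    define c1 where "c1 = K * 2 powr (\<eta> / 2)"
    define c2 where "c2 = 4 powr \<eta> * b powr (\<eta> / 2)"
    have c: "0 \<le> c1" "0 \<le> c2" using K by (auto simp: c1_def c2_def)
    have "(\<integral>\<^sup>+s. ennreal (angle_weight \<eta> \<sigma> t s) * indicator ({s. x < \<bar>s\<bar>} \<inter> {- pi<..pi}) s \<partial>lborel)
      \<le> (\<integral>\<^sup>+s. ennreal c1 * (indicator {- pi<..pi} s + ennreal c2 * (ennreal (\<bar>s\<bar> powr (- \<eta>)) * indicator {s. x < \<bar>s\<bar>} s)) \<partial>lborel)"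
    proof (rule nn_integral_mono)
      fix s :: real
      define v where "v = \<bar>s\<bar> powr (- \<eta>)"
      have e: "ennreal (c1 * (1 + c2 * v)) = ennreal c1 * (1 + ennreal c2 * ennreal v)"
        using c by (simp add: ennreal_mult v_def)
      have "angle_weight \<eta> \<sigma> t s \<le> c1 * (1 + c2 * v)" if "x < \<bar>s\<bar>" "- pi < s" "s \<le> pi"
        using w[of s] that x by (auto simp: c1_def c2_def v_def)
      then have "ennreal (angle_weight \<eta> \<sigma> t s) \<le> ennreal c1 * (1 + ennreal c2 * ennreal v)" if "x < \<bar>s\<bar>" "- pi < s" "s \<le> pi"
        unfolding e[symmetric] using that by (intro ennreal_leI) auto
      then show "ennreal (angle_weight \<eta> \<sigma> t s) * indicator ({s. x < \<bar>s\<bar>} \<inter> {- pi<..pi}) s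
          \<le> ennreal c1 * (indicator {- pi<..pi} s + ennreal c2 * (ennreal (\<bar>s\<bar> powr (- \<eta>)) * indicator {s. x < \<bar>s\<bar>} s))"
        by (auto split: split_indicator simp: v_def)
    qed
    also have "\<dots> = ennreal c1 * (ennreal (2 * pi) + ennreal c2 * (\<integral>\<^sup>+s. ennreal (\<bar>s\<bar> powr (- \<eta>)) * indicator {s. x < \<bar>s\<bar>} s \<partial>lborel))"
      by (simp add: nn_integral_cmult nn_integral_add)
    also have "\<dots> \<le> ennreal c1 * (ennreal (2 * pi) + ennreal c2 * ennreal (2 * x powr (1 - \<eta>) / (\<eta> - 1)))"
      by (intro mult_left_mono add_left_mono nn_integral_abs_powr_tail \<eta> x) auto
    also have "\<dots> = ennreal n"
      using c \<eta> by (simp add: n_def c1_def[symmetric] c2_def[symmetric] flip: ennreal_mult ennreal_plus)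
    finally show "(\<integral>\<^sup>+s. ennreal (angle_weight \<eta> \<sigma> t s) * indicator ({s. x < \<bar>s\<bar>} \<inter> {- pi<..pi}) s \<partial>lborel) \<le> ennreal n" .
    show "0 \<le> n" unfolding n_def using K \<eta> by (intro mult_nonneg_nonneg add_nonneg_nonneg divide_nonneg_nonneg) auto
    show "0 < d" using K b \<sigma> by (simp add: d_def)
    show "d \<le> angle_partition \<eta> \<sigma> t"
      unfolding d_def
    proof (rule angle_partition_ge[OF \<sigma>(1) t0])
      fix s assume s: "- \<sigma> \<le> s" "s \<le> \<sigma>"
      have "(b / (3 * \<sigma>\<^sup>2)) powr (\<eta> / 2) \<le> weight_ratio \<sigma> t s powr (\<eta> / 2)"
        using weight_ratio_ge_near_0[OF \<sigma>(1,2) t0 \<sigma>(3), of s] s b \<sigma> \<eta> by (intro powr_mono2) (auto simp: b_def)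
      then have "(b / (3 * \<sigma>\<^sup>2)) powr (\<eta> / 2) / K \<le> weight_ratio \<sigma> t s powr (\<eta> / 2) / K"
        using K by (intro divide_right_mono) auto
      then show "(b / (3 * \<sigma>\<^sup>2)) powr (\<eta> / 2) / K \<le> angle_weight \<eta> \<sigma> t s" using bounds(1)[of s] by linarith
    qed (use \<sigma> pi_gt3 in auto)
  qed measurable
  also have "n / d \<le> C * (\<sigma> powr (\<eta> - 1) * (b powr (- \<eta> / 2) + x powr (1 - \<eta>)))"
  proof -
    have "(b / (3 * \<sigma>\<^sup>2)) powr (\<eta> / 2) = b powr (\<eta> / 2) / (3 powr (\<eta> / 2) * \<sigma> powr \<eta>)"
    proof -
      have "\<sigma>\<^sup>2 = \<sigma> powr 2" using \<sigma> by (simp add: powr_realpow)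
      then have "(3 * \<sigma>\<^sup>2) powr (\<eta> / 2) = 3 powr (\<eta> / 2) * \<sigma> powr \<eta>" by (simp only: powr_mult powr_powr) simp
      then show ?thesis using b \<sigma> by (simp add: powr_divide)
    qed
    then have d: "d = 2 * b powr (\<eta> / 2) * \<sigma> powr (1 - \<eta>) / (3 powr (\<eta> / 2) * K)"
      using \<sigma> by (simp add: d_def powr_diff mult_ac)
    have b': "b powr (- \<eta> / 2) = 1 / b powr (\<eta> / 2)"
      unfolding minus_divide_left[symmetric] powr_minus inverse_eq_divide ..
    have \<sigma>': "\<sigma> powr (\<eta> - 1) = 1 / \<sigma> powr (1 - \<eta>)" using \<sigma> by (simp add: powr_diff)
    have six: "6 powr (\<eta> / 2) = 2 powr (\<eta> / 2) * 3 powr (\<eta> / 2)" using powr_mult[of 2 3 "\<eta> / 2"] by simp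
    have "n / d = K\<^sup>2 * 6 powr (\<eta> / 2) * (\<sigma> powr (\<eta> - 1) * (pi * b powr (- \<eta> / 2) + 4 powr \<eta> / (\<eta> - 1) * x powr (1 - \<eta>)))"
      unfolding n_def d b' \<sigma>' six using K b \<sigma> \<eta> by (simp add: field_simps power2_eq_square)
    also have "\<dots> \<le> K\<^sup>2 * 6 powr (\<eta> / 2) * (\<sigma> powr (\<eta> - 1) * (G * (b powr (- \<eta> / 2) + x powr (1 - \<eta>))))"
    proof -
      have "pi * b powr (- \<eta> / 2) \<le> G * b powr (- \<eta> / 2)" using \<eta> by (intro mult_right_mono) (auto simp: G_def)
      moreover have "4 powr \<eta> / (\<eta> - 1) * x powr (1 - \<eta>) \<le> G * x powr (1 - \<eta>)" by (intro mult_right_mono) (auto simp: G_def)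
      ultimately have "pi * b powr (- \<eta> / 2) + 4 powr \<eta> / (\<eta> - 1) * x powr (1 - \<eta>) \<le> G * (b powr (- \<eta> / 2) + x powr (1 - \<eta>))"
        unfolding distrib_left by (rule add_mono)
      then show ?thesis by (intro mult_left_mono) auto
    qed
    also have "\<dots> = C * (\<sigma> powr (\<eta> - 1) * (b powr (- \<eta> / 2) + x powr (1 - \<eta>)))" by (simp only: C_def mult_ac)
    finally show ?thesis .
  qed
  finally show "emeasure (angle_law \<eta> \<sigma> t) {s. x < \<bar>s\<bar>} \<le>
        ennreal (C * (\<sigma> powr (\<eta> - 1) * ((1 - exp (- t)) powr (- \<eta> / 2) + x powr (1 - \<eta>))))"
    by (simp add: b_def ennreal_leI)
qed

subsection \<open>Small arcs\<close>

lemma angle_law_small_arc: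
  fixes \<eta> T :: real
  assumes \<eta>: "\<eta> < 1" and T: "0 < T"
  obtains C b0 where "0 < C" "0 < b0"
    "\<And>\<sigma> t b. T / 2 \<le> t \<Longrightarrow> t \<le> T \<Longrightarrow> 0 < \<sigma> \<Longrightarrow> 0 < b \<Longrightarrow> b \<le> b0 \<Longrightarrow>
      emeasure (angle_law \<eta> \<sigma> t) {s. \<bar>s\<bar> < b} \<le> ennreal (C * b powr (1 - max \<eta> 0))"
proof
  define K where "K = (4 * exp T) powr \<bar>\<eta>\<bar>"
  define m where "m = max \<eta> 0"
  define E where "E = exp (- T / 2)"
  define M where "M = max (32 powr (\<eta> / 2)) ((1 + 4 / (2 - 2 * E)) powr (- \<eta> / 2))"
  define \<mu> where "\<mu> = exp (- T) / 2"
  define s0 where "s0 = arccos (- 1 + \<mu>)"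
  define M2 where "M2 = min (\<mu> powr (\<eta> / 2)) (3 powr (\<eta> / 2))"
  define d where "d = M2 / K * (pi - s0)"
  define C where "C = K * M * (2 / (1 - m)) / d"
  define b0 where "b0 = arccos E"
  have K: "0 < K" by (simp add: K_def)
  have m: "m < 1" "0 \<le> m" using \<eta> by (auto simp: m_def)
  have E: "0 < E" "E < 1" using T by (auto simp: E_def)
  have M: "0 < M" by (simp add: M_def less_max_iff_disj)
  have \<mu>: "0 < \<mu>" "\<mu> \<le> 1 / 2" using T by (auto simp: \<mu>_def)
  have M2: "0 < M2" using \<mu> by (simp add: M2_def)
  have s0: "0 \<le> s0" "s0 < pi" "cos s0 = - 1 + \<mu>"
    using \<mu> arccos_less_arccos[of "- 1" "- 1 + \<mu>"] by (auto simp: s0_def intro: arccos_lbound)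
  have d: "0 < d" using M2 K s0 by (simp add: d_def)
  show "0 < C" using K M m d by (simp add: C_def)
  show "0 < b0" using E arccos_less_arccos[of E 1] by (simp add: b0_def)
  have b0: "b0 \<le> pi" "cos b0 = E" using E by (auto simp: b0_def cos_arccos intro: arccos_ubound)
  fix \<sigma> t b :: real
  assume t: "T / 2 \<le> t" "t \<le> T" and \<sigma>: "0 < \<sigma>" and b: "0 < b" "b \<le> b0"
  have t0: "0 \<le> t" using t T by simp
  note bounds = angle_weight_bounds[OF \<sigma> t0 t(2), where \<eta> = \<eta>, folded K_def]
  note borel_measurable_angle_weight[OF \<sigma> t0, measurable]
  have et: "exp (- t) \<le> E" "2 * \<mu> \<le> exp (- t)" using t by (auto simp: E_def \<mu>_def)
  have ch: "1 \<le> cosh \<sigma>" by (rule cosh_real_ge_1)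
  have w: "angle_weight \<eta> \<sigma> t s \<le> K * M * \<bar>s\<bar> powr (- m)" if s: "\<bar>s\<bar> < b" "s \<noteq> 0" for s
  proof -
    have sp: "\<bar>s\<bar> \<le> pi" using s b b0 by simp
    have "weight_ratio \<sigma> t s powr (\<eta> / 2) \<le> M * \<bar>s\<bar> powr (- m)"
    proof (cases "0 \<le> \<eta>")
      case True
      have "s\<^sup>2 \<le> 4\<^sup>2" using sp pi_less_4 abs_le_square_iff[of s 4] by simp
      then have "s\<^sup>2 + 16 * (1 - exp (- t)) \<le> 32" using exp_gt_zero[of "- t"] by (simp del: exp_gt_zero)
      then have "(s\<^sup>2 + 16 * (1 - exp (- t))) / s\<^sup>2 \<le> 32 / s\<^sup>2" by (rule divide_right_mono) simp
      then have "1 + 16 * (1 - exp (- t)) / s\<^sup>2 \<le> 32 / s\<^sup>2" using s by (simp add: add_divide_distrib)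
      then have "weight_ratio \<sigma> t s \<le> 32 * \<bar>s\<bar> powr (-2)"
        using weight_ratio_le[OF \<sigma> t0 sp s(2)] s(2) by (simp add: powr_minus powr_realpow divide_inverse)
      then have "weight_ratio \<sigma> t s powr (\<eta> / 2) \<le> (32 * \<bar>s\<bar> powr (-2)) powr (\<eta> / 2)"
        using weight_ratio_pos[OF \<sigma> t0, of s] True by (intro powr_mono2) auto
      also have "\<dots> = 32 powr (\<eta> / 2) * \<bar>s\<bar> powr (- \<eta>)" by (simp add: powr_mult powr_powr)
      also have "\<dots> \<le> M * \<bar>s\<bar> powr (- \<eta>)" by (intro mult_right_mono) (auto simp: M_def)
      finally show ?thesis using True by (simp add: m_def)
    next
      case False
      define p where "p = koebe (exp (Complex \<sigma> s))"
      have "E \<le> cos \<bar>s\<bar>" unfolding b0(2)[symmetric] using s b b0 by (intro cos_monotone_0_pi_le) auto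
      then have c: "E \<le> cos s" by simp
      have "E * 1 \<le> cos s * cosh \<sigma>" using c ch E by (intro mult_mono) auto
      then have "2 * E + 2 \<le> Re p" by (simp add: p_def Re_koebe_exp mult.commute)
      then have "2 - 2 * E \<le> Re (p - of_real (4 * exp (- t)))" using et by simp
      also have "\<dots> \<le> norm (p - of_real (4 * exp (- t)))" by (rule complex_Re_le_cmod)
      finally have B: "2 - 2 * E \<le> norm (p - of_real (4 * exp (- t)))" .
      have "norm (p - 4) \<le> norm (p - of_real (4 * exp (- t))) + 4"
        using norm_triangle_ineq4[of "p - of_real (4 * exp (- t))" "4 - of_real (4 * exp (- t))"] norm_four_minus[OF t0]
        by simp (smt (verit) exp_gt_zero)
      then have "norm (p - 4) / norm (p - of_real (4 * exp (- t))) \<le> (norm (p - of_real (4 * exp (- t))) + 4) / norm (p - of_real (4 * exp (- t)))"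
        by (intro divide_right_mono) auto
      also have "\<dots> = 1 + 4 / norm (p - of_real (4 * exp (- t)))" 
      proof -
        have *: "0 < N \<Longrightarrow> (N + 4) / N = 1 + 4 / N" for N :: real by (simp add: add_divide_distrib)
        show ?thesis by (rule *) (use B E in linarith)
      qed
      also have "\<dots> \<le> 1 + 4 / (2 - 2 * E)" using B E by (intro add_left_mono divide_left_mono mult_pos_pos) linarith+
      finally have "1 / weight_ratio \<sigma> t s \<le> 1 + 4 / (2 - 2 * E)" by (simp add: weight_ratio_def p_def)
      then have "(1 / weight_ratio \<sigma> t s) powr (- \<eta> / 2) \<le> (1 + 4 / (2 - 2 * E)) powr (- \<eta> / 2)"
        using False weight_ratio_pos[OF \<sigma> t0, of s] by (intro powr_mono2) auto
      also have "\<dots> \<le> M" by (simp add: M_def)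
      also have "(1 / weight_ratio \<sigma> t s) powr (- \<eta> / 2) = weight_ratio \<sigma> t s powr (\<eta> / 2)"
        using weight_ratio_pos[OF \<sigma> t0, of s] by (simp add: powr_divide powr_minus)
      finally show ?thesis using False s by (simp add: m_def)
    qed
    then have "K * weight_ratio \<sigma> t s powr (\<eta> / 2) \<le> K * (M * \<bar>s\<bar> powr (- m))" using K by (intro mult_left_mono) auto
    then show ?thesis using bounds(2)[of s] by simp
  qed
  have "emeasure (angle_law \<eta> \<sigma> t) {s. \<bar>s\<bar> < b} \<le> ennreal ((K * M * (2 * b powr (1 - m) / (1 - m))) / d)"
  proof (rule emeasure_angle_law_le[OF \<sigma> t0])
    have "(\<integral>\<^sup>+s. ennreal (angle_weight \<eta> \<sigma> t s) * indicator ({s. \<bar>s\<bar> < b} \<inter> {- pi<..pi}) s \<partial>lborel)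
      \<le> (\<integral>\<^sup>+s. ennreal (K * M) * (ennreal (\<bar>s\<bar> powr (- m)) * indicator {s. \<bar>s\<bar> < b} s) \<partial>lborel)"
      by (rule nn_integral_mono_AE, use AE_lborel_singleton[of 0] in eventually_elim)
         (use w K M in \<open>auto split: split_indicator simp flip: ennreal_mult intro!: ennreal_leI\<close>)
    also have "\<dots> = ennreal (K * M) * (\<integral>\<^sup>+s. ennreal (\<bar>s\<bar> powr (- m)) * indicator {s. \<bar>s\<bar> < b} s \<partial>lborel)"
      by (rule nn_integral_cmult) measurable
    also have "\<dots> \<le> ennreal (K * M) * ennreal (2 * b powr (1 - m) / (1 - m))"
      by (intro mult_left_mono nn_integral_abs_powr_near_0 m b) auto
    also have "\<dots> = ennreal (K * M * (2 * b powr (1 - m) / (1 - m)))" using K M m by (simp flip: ennreal_mult)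
    finally show "(\<integral>\<^sup>+s. ennreal (angle_weight \<eta> \<sigma> t s) * indicator ({s. \<bar>s\<bar> < b} \<inter> {- pi<..pi}) s \<partial>lborel)
      \<le> ennreal (K * M * (2 * b powr (1 - m) / (1 - m)))" .
    show "0 \<le> K * M * (2 * b powr (1 - m) / (1 - m))" using K M m by simp
    show "0 < d" by (rule d)
    show "d \<le> angle_partition \<eta> \<sigma> t"
      unfolding d_def
    proof (rule angle_partition_ge[OF \<sigma> t0])
      fix s assume s: "s0 \<le> s" "s \<le> pi"
      define p where "p = koebe (exp (Complex \<sigma> s))"
      define X where "X = 2 * cosh \<sigma>"
      have X: "2 \<le> X" using ch by (simp add: X_def)
      have c: "cos s \<le> - 1 + \<mu>" unfolding s0(3)[symmetric] using s s0 by (intro cos_monotone_0_pi_le) auto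
      have A: "norm (p - 4) = X - 2 * cos s" unfolding p_def norm_koebe_exp_minus_4 X_def ..
      have A2: "2 \<le> norm (p - 4)" "norm (p - 4) \<le> X + 2" using X c \<mu> cos_ge_minus_one[of s] unfolding A by linarith+
      have "norm (p - of_real (4 * exp (- t))) \<le> norm (p - 4) + 4"
        using norm_triangle_ineq[of "p - 4" "4 - of_real (4 * exp (- t))"] norm_four_minus[OF t0] exp_gt_zero[of "- t"] by (simp del: exp_gt_zero)
      then have up: "weight_ratio \<sigma> t s \<le> 3" unfolding weight_ratio_def p_def[symmetric] using A2 by (simp add: divide_le_eq)
      have "X * cos s \<le> X * (- 1 + \<mu>)" using c X by (intro mult_left_mono) auto
      then have Rp: "Re p \<le> 2 - X + X * \<mu>" by (simp add: p_def Re_koebe_exp X_def algebra_simps)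
      have "\<mu> * norm (p - 4) \<le> \<mu> * (X + 2)" using A2 \<mu> by (intro mult_left_mono) auto
      also have "\<dots> \<le> 4 * exp (- t) - (2 - X + X * \<mu>)"
      proof -
        have "2 * (1 - 2 * \<mu>) \<le> X * (1 - 2 * \<mu>)" using X \<mu> by (intro mult_right_mono) auto
        then show ?thesis using et(2) \<mu> by (simp add: algebra_simps)
      qed
      also have "\<dots> \<le> - Re (p - of_real (4 * exp (- t)))" using Rp by simp
      also have "\<dots> \<le> norm (p - of_real (4 * exp (- t)))" using abs_Re_le_cmod[of "p - of_real (4 * exp (- t))"] by linarith
      finally have lo: "\<mu> \<le> weight_ratio \<sigma> t s"
        unfolding weight_ratio_def p_def[symmetric] using A2(1)
        by (subst pos_le_divide_eq) linarith+
      have "M2 \<le> weight_ratio \<sigma> t s powr (\<eta> / 2)"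
      proof (cases "0 \<le> \<eta>")
        case True
        then have "\<mu> powr (\<eta> / 2) \<le> weight_ratio \<sigma> t s powr (\<eta> / 2)" using lo \<mu> by (intro powr_mono2) auto
        then show ?thesis by (simp add: M2_def)
      next
        case False
        then have "3 powr (\<eta> / 2) \<le> weight_ratio \<sigma> t s powr (\<eta> / 2)"
          using up weight_ratio_pos[OF \<sigma> t0, of s] by (intro powr_mono2') auto
        then show ?thesis by (simp add: M2_def)
      qed
      then have "M2 / K \<le> weight_ratio \<sigma> t s powr (\<eta> / 2) / K" using K by (intro divide_right_mono) auto
      then show "M2 / K \<le> angle_weight \<eta> \<sigma> t s" using bounds(1)[of s] by linarith
    qed (use s0 in auto)
  qed measurable
  also have "(K * M * (2 * b powr (1 - m) / (1 - m))) / d = C * b powr (1 - m)" by (simp add: C_def)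
  finally show "emeasure (angle_law \<eta> \<sigma> t) {s. \<bar>s\<bar> < b} \<le> ennreal (C * b powr (1 - max \<eta> 0))"
    by (simp add: m_def)
qed

section \<open>Increments of the angle process\<close>

definition wrap :: "real \<Rightarrow> real" where
  "wrap u = u - 2 * pi * of_int \<lceil>(u - pi) / (2 * pi)\<rceil>"

lemma wrap_measurable [measurable]: "wrap \<in> borel_measurable borel"
  unfolding wrap_def by measurable

lemma cis_add_2pi_int: "cis (u + 2 * pi * of_int n) = cis u"
  by (simp add: complex_eq_iff cos_int_2pin sin_int_2pin cos_add sin_add)

lemma wrap_bounds: "- pi < wrap u" "wrap u \<le> pi"
proof -
  define v where "v = (u - pi) / (2 * pi)"
  have u: "u = 2 * pi * v + pi" by (simp add: v_def)
  have "v \<le> of_int \<lceil>v\<rceil>" "of_int \<lceil>v\<rceil> < v + 1" by linarith+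
  then have "2 * pi * v \<le> 2 * pi * of_int \<lceil>v\<rceil>" "2 * pi * of_int \<lceil>v\<rceil> < 2 * pi * (v + 1)" by auto
  then show "- pi < wrap u" "wrap u \<le> pi"
    unfolding wrap_def v_def[symmetric] using u by (simp_all add: algebra_simps)
qed

lemma cis_wrap: "cis (wrap u) = cis u"
  using cis_add_2pi_int[of u "- \<lceil>(u - pi) / (2 * pi)\<rceil>"] by (simp add: wrap_def)

lemma wrap_eq_Arg: "wrap u = Arg (cis u)"
  using Arg_cis[of "wrap u"] wrap_bounds[of u] by (simp add: cis_wrap)

lemma wrap_ident: "- pi < s \<Longrightarrow> s \<le> pi \<Longrightarrow> wrap s = s"
  by (simp add: wrap_eq_Arg Arg_cis)

lemma nn_integral_period:
  fixes h :: "real \<Rightarrow> ennreal"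
  assumes [measurable]: "h \<in> borel_measurable borel" and per: "\<And>s s'. cis s = cis s' \<Longrightarrow> h s = h s'"
  shows "(\<integral>\<^sup>+x. h (x - y) * indicator {- pi<..pi} x \<partial>lborel) = (\<integral>\<^sup>+s. h s * indicator {- pi<..pi} s \<partial>lborel)"
proof -
  define m where "m = \<lfloor>y / (2 * pi)\<rfloor>"
  define a where "a = y - 2 * pi * of_int m"
  have a: "0 \<le> a" "a < 2 * pi"
  proof -
    define v where "v = y / (2 * pi)"
    have y: "y = 2 * pi * v" by (simp add: v_def)
    have "of_int \<lfloor>v\<rfloor> \<le> v" "v < of_int \<lfloor>v\<rfloor> + 1" by linarith+
    then have "2 * pi * of_int \<lfloor>v\<rfloor> \<le> 2 * pi * v" "2 * pi * v < 2 * pi * (of_int \<lfloor>v\<rfloor> + 1)" by auto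
    then show "0 \<le> a" "a < 2 * pi" unfolding a_def m_def v_def[symmetric] using y by (simp_all add: algebra_simps)
  qed
  have h: "h (x - y) = h (x - a)" for x
  proof (rule per)
    have "x - a = (x - y) + 2 * pi * of_int m" by (simp add: a_def)
    then show "cis (x - y) = cis (x - a)" by (simp only: cis_add_2pi_int)
  qed
  have h2: "h (s - 2 * pi) = h s" for s
    using cis_add_2pi_int[of s "- 1"] by (intro per) simp
  have "(\<integral>\<^sup>+x. h (x - y) * indicator {- pi<..pi} x \<partial>lborel) = (\<integral>\<^sup>+x. h (x - a) * indicator {- pi<..pi} x \<partial>lborel)"
    by (simp add: h)
  also have "\<dots> = (\<integral>\<^sup>+s. h s * indicator {- pi<..pi} (s + a) \<partial>lborel)"
    using nn_integral_real_affine[of "\<lambda>x. h (x - a) * indicator {- pi<..pi} x" 1 a] by (simp add: add.commute)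
  also have "\<dots> = (\<integral>\<^sup>+s. h s * indicator {- pi<..pi - a} s + h s * indicator {- pi - a<..- pi} s \<partial>lborel)"
    by (rule nn_integral_cong) (use a in \<open>auto split: split_indicator\<close>)
  also have "\<dots> = (\<integral>\<^sup>+s. h s * indicator {- pi<..pi - a} s \<partial>lborel) + (\<integral>\<^sup>+s. h s * indicator {- pi - a<..- pi} s \<partial>lborel)"
    by (rule nn_integral_add) measurable
  also have "(\<integral>\<^sup>+s. h s * indicator {- pi - a<..- pi} s \<partial>lborel) = (\<integral>\<^sup>+s. h (s - 2 * pi) * indicator {- pi - a<..- pi} (s - 2 * pi) \<partial>lborel)"
    using nn_integral_real_affine[of "\<lambda>s. h s * indicator {- pi - a<..- pi} s" 1 "- 2 * pi"] by (simp add: add.commute)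
  also have "\<dots> = (\<integral>\<^sup>+s. h s * indicator {pi - a<..pi} s \<partial>lborel)"
    by (rule nn_integral_cong) (auto simp: h2 split: split_indicator)
  also have "(\<integral>\<^sup>+s. h s * indicator {- pi<..pi - a} s \<partial>lborel) + (\<integral>\<^sup>+s. h s * indicator {pi - a<..pi} s \<partial>lborel)
      = (\<integral>\<^sup>+s. h s * indicator {- pi<..pi - a} s + h s * indicator {pi - a<..pi} s \<partial>lborel)"
    by (rule nn_integral_add[symmetric]) measurable
  also have "\<dots> = (\<integral>\<^sup>+s. h s * indicator {- pi<..pi} s \<partial>lborel)"
    by (rule nn_integral_cong) (use a in \<open>auto split: split_indicator\<close>)
  finally show ?thesis .
qed

declare One_nat_def [simp del]

context markov_slit_model
begin

abbreviation hist_space :: "nat \<Rightarrow> (nat \<Rightarrow> real) measure" where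
  "hist_space k \<equiv> PiM {1..<k} (\<lambda>_. borel)"

definition hist :: "nat \<Rightarrow> 'w \<Rightarrow> nat \<Rightarrow> real" where
  "hist k \<omega> = (\<lambda>i\<in>{1..<k}. \<theta> i \<omega>)"

lemma hist_measurable [measurable]: "hist k \<in> measurable M (hist_space k)"
  unfolding hist_def by (intro measurable_restrict angle_measurable) auto

context
  fixes k :: nat assumes k: "2 \<le> k"
begin

definition capacity_before :: real where "capacity_before = c * real (k - 1)"

lemma capacity_before_pos: "0 < capacity_before"
  using c_pos k by (simp add: capacity_before_def)

lemma angle_k_measurable [measurable]: "\<theta> k \<in> borel_measurable M"
  using angle_measurable[of k] k by simp

lemma angle_pred_measurable [measurable]: "\<theta> (k - 1) \<in> borel_measurable M"
  using angle_measurable[of "k - 1"] k by simp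

lemma hist_pred: "hist k \<omega> (k - 1) = \<theta> (k - 1) \<omega>"
proof -
  have "k - 1 \<in> {1..<k}" using k by auto
  then show ?thesis unfolding hist_def by (rule restrict_apply')
qed

lemma angle_density_eq: "angle_density \<eta> c \<sigma> k x y =
    angle_weight \<eta> \<sigma> capacity_before (x - y) / angle_partition \<eta> \<sigma> capacity_before"
  by (simp add: angle_density_def capacity_before_def)

lemma angle_weight_meas [measurable]: "angle_weight \<eta> \<sigma> capacity_before \<in> borel_measurable borel"
  using borel_measurable_angle_weight \<sigma>_pos capacity_before_pos by simp

lemma angle_density_nonneg: "0 \<le> angle_density \<eta> c \<sigma> k x y"
  unfolding angle_density_eq
  using angle_weight_nonneg angle_partition_pos[OF \<sigma>_pos less_imp_le[OF capacity_before_pos], of \<eta>] by simp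

lemma angle_density_measurable [measurable]:
  "(\<lambda>p. angle_density \<eta> c \<sigma> k (fst p) (snd p)) \<in> borel_measurable (borel \<Otimes>\<^sub>M borel)"
  unfolding angle_density_eq by measurable

definition angle_kernel :: "real \<Rightarrow> real set \<Rightarrow> ennreal" where
  "angle_kernel y A = (\<integral>\<^sup>+x. ennreal (angle_density \<eta> c \<sigma> k x y) * indicator {- pi<..pi} x * indicator A x \<partial>lborel)"

lemma angle_kernel_eq:
  assumes [measurable]: "A \<in> sets borel"
  shows "angle_kernel y A = ennreal (LINT x:A \<inter> {- pi<..pi}|lborel. angle_density \<eta> c \<sigma> k x y)"
proof -
  have "continuous_on {- pi..pi} (\<lambda>x. angle_density \<eta> c \<sigma> k x y)"
    unfolding angle_density_eq
    using angle_partition_pos[OF \<sigma>_pos less_imp_le[OF capacity_before_pos], of \<eta>]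
    by (intro continuous_intros continuous_on_compose2[OF continuous_on_angle_weight[OF \<sigma>_pos less_imp_le[OF capacity_before_pos], of UNIV]]) auto
  then have "set_integrable lborel {- pi..pi} (\<lambda>x. angle_density \<eta> c \<sigma> k x y)"
    by (rule borel_integrable_atLeastAtMost')
  then have int: "set_integrable lborel (A \<inter> {- pi<..pi}) (\<lambda>x. angle_density \<eta> c \<sigma> k x y)"
    by (rule set_integrable_subset) auto
  have "angle_kernel y A = (\<integral>\<^sup>+x. ennreal (indicator (A \<inter> {- pi<..pi}) x *\<^sub>R angle_density \<eta> c \<sigma> k x y) \<partial>lborel)"
    unfolding angle_kernel_def by (rule nn_integral_cong) (auto split: split_indicator)
  also have "\<dots> = ennreal (LINT x:A \<inter> {- pi<..pi}|lborel. angle_density \<eta> c \<sigma> k x y)"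
    unfolding set_lebesgue_integral_def
    using int by (intro nn_integral_eq_integral) (auto simp: set_integrable_def angle_density_nonneg)
  finally show ?thesis .
qed

lemma joint_rectangle:
  assumes B: "B \<in> sets (hist_space k)" and A: "A \<in> sets borel"
  shows "emeasure M (hist k -` B \<inter> \<theta> k -` A \<inter> space M) =
    (\<integral>\<^sup>+\<omega>. indicator B (hist k \<omega>) * angle_kernel (\<theta> (k - 1) \<omega>) A \<partial>M)"
proof -
  define F where "F = vimage_algebra (space M) (hist k) (hist_space k)"
  have [measurable]: "A \<in> sets borel" "B \<in> sets (hist_space k)" by fact+
  have "subalgebra M F"
    unfolding subalgebra_def F_def
    using hist_measurable[of k] measurable_sets[OF hist_measurable[of k]]
    by (auto simp: sets_vimage_algebra2 measurable_def)
  then interpret finite_measure_subalgebra M F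
    by unfold_locales
  define S where "S = hist k -` B \<inter> space M"
  define E where "E = \<theta> k -` A \<inter> space M"
  have S: "S \<in> sets F" unfolding F_def S_def using B by (rule in_vimage_algebra)
  have [measurable]: "S \<in> sets M" "E \<in> sets M" unfolding S_def E_def by measurable
  have int: "integrable M (indicator E :: 'w \<Rightarrow> real)"
    by (rule integrable_real_indicator) (auto simp: emeasure_eq_measure)
  have cond: "AE \<omega> in M. real_cond_exp M F (indicator E) \<omega> =
      (LINT x:A \<inter> {- pi<..pi}|lborel. angle_density \<eta> c \<sigma> k x (\<theta> (k - 1) \<omega>))"
    using next_angle[OF k A] unfolding F_def E_def hist_def[abs_def] .
  have nn: "0 \<le> (LINT x:A \<inter> {- pi<..pi}|lborel. angle_density \<eta> c \<sigma> k x y)" for y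
    unfolding set_lebesgue_integral_def by (rule integral_nonneg_AE) (auto simp: angle_density_nonneg)
  have int2: "integrable M (\<lambda>\<omega>. indicator S \<omega> * real_cond_exp M F (indicator E) \<omega>)"
    using integrable_mult_indicator[OF _ real_cond_exp_int(1)[OF int], of S] by simp
  have "measure M (S \<inter> E) = (\<integral>\<omega>\<in>S. indicator E \<omega> \<partial>M)"
  proof -
    have "(\<integral>\<omega>\<in>S. indicator E \<omega> \<partial>M) = (\<integral>\<omega>. indicator (S \<inter> E) \<omega> \<partial>M)"
      unfolding set_lebesgue_integral_def by (rule Bochner_Integration.integral_cong) (auto split: split_indicator)
    also have "\<dots> = measure M (S \<inter> E)" by simp
    finally show ?thesis ..
  qed
  also have "\<dots> = (\<integral>\<omega>\<in>S. real_cond_exp M F (indicator E) \<omega> \<partial>M)" by (rule real_cond_exp_intA[OF int S])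
  finally have m: "measure M (S \<inter> E) = (\<integral>\<omega>. indicator S \<omega> * real_cond_exp M F (indicator E) \<omega> \<partial>M)"
    by (simp add: set_lebesgue_integral_def)
  have "emeasure M (S \<inter> E) = ennreal (\<integral>\<omega>. indicator S \<omega> * real_cond_exp M F (indicator E) \<omega> \<partial>M)"
    unfolding m[symmetric] by (rule emeasure_eq_measure)
  also have "\<dots> = (\<integral>\<^sup>+\<omega>. ennreal (indicator S \<omega> * real_cond_exp M F (indicator E) \<omega>) \<partial>M)"
  proof (rule nn_integral_eq_integral[OF int2, symmetric])
    show "AE \<omega> in M. 0 \<le> indicator S \<omega> * real_cond_exp M F (indicator E) \<omega>"
      using cond by eventually_elim (simp add: nn)
  qed
  also have "\<dots> = (\<integral>\<^sup>+\<omega>. indicator B (hist k \<omega>) * angle_kernel (\<theta> (k - 1) \<omega>) A \<partial>M)"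
  proof (rule nn_integral_cong_AE, use cond AE_space in eventually_elim)
    fix \<omega> assume *: "real_cond_exp M F (indicator E) \<omega> =
      (LINT x:A \<inter> {- pi<..pi}|lborel. angle_density \<eta> c \<sigma> k x (\<theta> (k - 1) \<omega>))" "\<omega> \<in> space M"
    show "ennreal (indicator S \<omega> * real_cond_exp M F (indicator E) \<omega>) = indicator B (hist k \<omega>) * angle_kernel (\<theta> (k - 1) \<omega>) A"
      unfolding *(1) angle_kernel_eq[OF A] using *(2) by (auto simp: S_def split: split_indicator)
  qed
  finally have "emeasure M (S \<inter> E) = (\<integral>\<^sup>+\<omega>. indicator B (hist k \<omega>) * angle_kernel (\<theta> (k - 1) \<omega>) A \<partial>M)" .
  moreover have "S \<inter> E = hist k -` B \<inter> \<theta> k -` A \<inter> space M" by (auto simp: S_def E_def)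
  ultimately show ?thesis by simp
qed

lemma nn_integral_next_angle:
  assumes H: "H \<in> borel_measurable (hist_space k \<Otimes>\<^sub>M borel)"
  shows "(\<integral>\<^sup>+\<omega>. H (hist k \<omega>, \<theta> k \<omega>) \<partial>M) =
    (\<integral>\<^sup>+\<omega>. (\<integral>\<^sup>+x. ennreal (angle_density \<eta> c \<sigma> k x (\<theta> (k - 1) \<omega>)) * indicator {- pi<..pi} x * H (hist k \<omega>, x) \<partial>lborel) \<partial>M)"
proof -
  define P where "P = hist_space k \<Otimes>\<^sub>M (borel :: real measure)"
  define J where "J = distr M P (\<lambda>\<omega>. (hist k \<omega>, \<theta> k \<omega>))"
  define dens where "dens p = ennreal (angle_density \<eta> c \<sigma> k (snd p) (fst p (k - 1))) * indicator {- pi<..pi} (snd p)" for p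
  define N where "N = distr M (hist_space k) (hist k)"
  define D where "D = density (N \<Otimes>\<^sub>M lborel) dens"
  have k1: "k - 1 \<in> {1..<k}" using k by auto
  have dens [measurable]: "dens \<in> borel_measurable (hist_space k \<Otimes>\<^sub>M borel)"
  proof -
    have "(\<lambda>p :: (nat \<Rightarrow> real) \<times> real. (snd p, fst p (k - 1))) \<in> measurable (hist_space k \<Otimes>\<^sub>M borel) (borel \<Otimes>\<^sub>M borel)"
      using measurable_component_singleton[OF k1, of "\<lambda>_. borel"] by measurable
    from measurable_compose[OF this angle_density_measurable]
    show ?thesis unfolding dens_def by simp
  qed
  have setsN [measurable_cong]: "sets N = sets (hist_space k)" by (simp add: N_def)
  have fubini: "(\<integral>\<^sup>+p. dens p * g p \<partial>(N \<Otimes>\<^sub>M lborel)) =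
      (\<integral>\<^sup>+\<omega>. (\<integral>\<^sup>+x. dens (hist k \<omega>, x) * g (hist k \<omega>, x) \<partial>lborel) \<partial>M)"
    if [measurable]: "g \<in> borel_measurable (hist_space k \<Otimes>\<^sub>M borel)" for g
  proof -
    have "(\<integral>\<^sup>+p. dens p * g p \<partial>(N \<Otimes>\<^sub>M lborel)) = (\<integral>\<^sup>+\<xi>. (\<integral>\<^sup>+x. dens (\<xi>, x) * g (\<xi>, x) \<partial>lborel) \<partial>N)"
      by (rule lborel.nn_integral_fst[symmetric]) measurable
    also have "\<dots> = (\<integral>\<^sup>+\<omega>. (\<integral>\<^sup>+x. dens (hist k \<omega>, x) * g (hist k \<omega>, x) \<partial>lborel) \<partial>M)"
      unfolding N_def by (rule nn_integral_distr) measurable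
    finally show ?thesis .
  qed
  have "J = D"
  proof (rule measure_eqI_generator_eq[where E = "{B \<times> A | B A. B \<in> sets (hist_space k) \<and> A \<in> sets (borel :: real measure)}"
        and \<Omega> = "space (hist_space k) \<times> space borel" and A = "\<lambda>_. space (hist_space k) \<times> space borel"])
    show "Int_stable {B \<times> A | B A. B \<in> sets (hist_space k) \<and> A \<in> sets (borel :: real measure)}"
      by (rule Int_stable_pair_measure_generator)
    show "{B \<times> A | B A. B \<in> sets (hist_space k) \<and> A \<in> sets (borel :: real measure)} \<subseteq> Pow (space (hist_space k) \<times> space borel)"
      using pair_measure_closed by blast
    show "sets J = sigma_sets (space (hist_space k) \<times> space borel) {B \<times> A | B A. B \<in> sets (hist_space k) \<and> A \<in> sets (borel :: real measure)}"
      by (simp add: J_def P_def sets_pair_measure)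
    have "sets D = sets (hist_space k \<Otimes>\<^sub>M (borel :: real measure))"
      unfolding D_def sets_density by (rule sets_pair_measure_cong) (auto simp: setsN)
    then show "sets D = sigma_sets (space (hist_space k) \<times> space borel) {B \<times> A | B A. B \<in> sets (hist_space k) \<and> A \<in> sets (borel :: real measure)}"
      by (simp only: sets_pair_measure)
    fix X assume "X \<in> {B \<times> A | B A. B \<in> sets (hist_space k) \<and> A \<in> sets (borel :: real measure)}"
    then obtain B A where X: "X = B \<times> A" and [measurable]: "B \<in> sets (hist_space k)" "A \<in> sets (borel :: real measure)" by auto
    have [measurable]: "X \<in> sets (hist_space k \<Otimes>\<^sub>M borel)" unfolding X by measurable
    have "emeasure J X = emeasure M (hist k -` B \<inter> \<theta> k -` A \<inter> space M)"
      unfolding J_def P_def by (subst emeasure_distr) (auto simp: X intro!: arg_cong[where f = "emeasure M"])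
    also have "\<dots> = (\<integral>\<^sup>+\<omega>. indicator B (hist k \<omega>) * angle_kernel (\<theta> (k - 1) \<omega>) A \<partial>M)"
      by (rule joint_rectangle) measurable
    also have "\<dots> = (\<integral>\<^sup>+\<omega>. (\<integral>\<^sup>+x. dens (hist k \<omega>, x) * indicator X (hist k \<omega>, x) \<partial>lborel) \<partial>M)"
    proof (rule nn_integral_cong)
      fix \<omega>
      show "indicator B (hist k \<omega>) * angle_kernel (\<theta> (k - 1) \<omega>) A = (\<integral>\<^sup>+x. dens (hist k \<omega>, x) * indicator X (hist k \<omega>, x) \<partial>lborel)"
        unfolding angle_kernel_def dens_def X
        by (auto simp: hist_pred indicator_def intro!: nn_integral_cong)
    qed
    also have "\<dots> = (\<integral>\<^sup>+p. dens p * indicator X p \<partial>(N \<Otimes>\<^sub>M lborel))"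
      by (rule fubini[symmetric]) measurable
    also have "\<dots> = emeasure D X"
      unfolding D_def by (rule emeasure_density[symmetric]) measurable
    finally show "emeasure J X = emeasure D X" .
  next
    show "emeasure J (space (hist_space k) \<times> space borel) \<noteq> \<infinity>" for i :: nat
    proof -
      have "prob_space J" unfolding J_def P_def by (rule prob_space_distr) measurable
      then interpret J: prob_space J .
      show ?thesis by simp
    qed
    show "range (\<lambda>_. space (hist_space k) \<times> space borel) \<subseteq> {B \<times> A | B A. B \<in> sets (hist_space k) \<and> A \<in> sets (borel :: real measure)}"
      by blast
  qed simp
  have "(\<integral>\<^sup>+\<omega>. H (hist k \<omega>, \<theta> k \<omega>) \<partial>M) = (\<integral>\<^sup>+p. H p \<partial>J)"
    unfolding J_def P_def by (rule nn_integral_distr[symmetric]) (use H in measurable)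
  also have "\<dots> = (\<integral>\<^sup>+p. dens p * H p \<partial>(N \<Otimes>\<^sub>M lborel))"
    unfolding \<open>J = D\<close> D_def by (rule nn_integral_density) (use H in measurable)
  also have "\<dots> = (\<integral>\<^sup>+\<omega>. (\<integral>\<^sup>+x. dens (hist k \<omega>, x) * H (hist k \<omega>, x) \<partial>lborel) \<partial>M)"
    by (rule fubini[OF H])
  finally show ?thesis by (simp add: dens_def hist_pred)
qed

lemma nn_integral_increment:
  assumes G: "G \<in> borel_measurable (hist_space k \<Otimes>\<^sub>M borel)"
  shows "(\<integral>\<^sup>+\<omega>. G (hist k \<omega>, wrap (\<theta> k \<omega> - \<theta> (k - 1) \<omega>)) \<partial>M) =
    (\<integral>\<^sup>+\<omega>. (\<integral>\<^sup>+s. G (hist k \<omega>, s) \<partial>angle_law \<eta> \<sigma> (c * real (k - 1))) \<partial>M)"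
proof -
  have k1: "k - 1 \<in> {1..<k}" using k by auto
  have cb: "0 \<le> capacity_before" using capacity_before_pos by simp
  define H where "H p = G (fst p, wrap (snd p - fst p (k - 1)))" for p
  have "(\<lambda>p :: (nat \<Rightarrow> real) \<times> real. (fst p, wrap (snd p - fst p (k - 1)))) \<in> measurable (hist_space k \<Otimes>\<^sub>M borel) (hist_space k \<Otimes>\<^sub>M borel)"
    using measurable_component_singleton[OF k1, of "\<lambda>_. borel"] by measurable
  from measurable_compose[OF this G]
  have H: "H \<in> borel_measurable (hist_space k \<Otimes>\<^sub>M borel)" unfolding H_def .
  have "(\<integral>\<^sup>+\<omega>. G (hist k \<omega>, wrap (\<theta> k \<omega> - \<theta> (k - 1) \<omega>)) \<partial>M) = (\<integral>\<^sup>+\<omega>. H (hist k \<omega>, \<theta> k \<omega>) \<partial>M)"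
    by (simp add: H_def hist_pred)
  also have "\<dots> = (\<integral>\<^sup>+\<omega>. (\<integral>\<^sup>+x. ennreal (angle_density \<eta> c \<sigma> k x (\<theta> (k - 1) \<omega>)) * indicator {- pi<..pi} x * H (hist k \<omega>, x) \<partial>lborel) \<partial>M)"
    by (rule nn_integral_next_angle[OF H])
  also have "\<dots> = (\<integral>\<^sup>+\<omega>. (\<integral>\<^sup>+s. G (hist k \<omega>, s) \<partial>angle_law \<eta> \<sigma> (c * real (k - 1))) \<partial>M)"
  proof (rule nn_integral_cong)
    fix \<omega> assume "\<omega> \<in> space M"
    then have hs: "hist k \<omega> \<in> space (hist_space k)" using measurable_space[OF hist_measurable] by blast
    have Gs [measurable]: "(\<lambda>s. G (hist k \<omega>, s)) \<in> borel_measurable borel"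
      using measurable_compose[OF measurable_Pair1'[OF hs] G] .
    define h where "h s = ennreal (angle_weight \<eta> \<sigma> capacity_before s / angle_partition \<eta> \<sigma> capacity_before) * G (hist k \<omega>, wrap s)" for s
    have [measurable]: "h \<in> borel_measurable borel"
      unfolding h_def using measurable_compose[OF wrap_measurable Gs] by measurable
    have "(\<integral>\<^sup>+x. ennreal (angle_density \<eta> c \<sigma> k x (\<theta> (k - 1) \<omega>)) * indicator {- pi<..pi} x * H (hist k \<omega>, x) \<partial>lborel)
        = (\<integral>\<^sup>+x. h (x - \<theta> (k - 1) \<omega>) * indicator {- pi<..pi} x \<partial>lborel)"
      by (simp add: h_def H_def hist_pred angle_density_eq mult_ac)
    also have "\<dots> = (\<integral>\<^sup>+s. h s * indicator {- pi<..pi} s \<partial>lborel)"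
    proof (rule nn_integral_period)
      fix s s' :: real assume "cis s = cis s'"
      then show "h s = h s'" using angle_weight_cis_cong[of s s'] by (simp add: h_def wrap_eq_Arg)
    qed measurable
    also have "\<dots> = (\<integral>\<^sup>+s. ennreal (angle_weight \<eta> \<sigma> capacity_before s / angle_partition \<eta> \<sigma> capacity_before) * indicator {- pi<..pi} s * G (hist k \<omega>, s) \<partial>lborel)"
      by (rule nn_integral_cong) (auto simp: h_def wrap_ident split: split_indicator)
    also have "\<dots> = (\<integral>\<^sup>+s. G (hist k \<omega>, s) \<partial>angle_law \<eta> \<sigma> capacity_before)"
      by (rule nn_integral_angle_law[OF \<sigma>_pos cb Gs, symmetric])
    finally show "(\<integral>\<^sup>+x. ennreal (angle_density \<eta> c \<sigma> k x (\<theta> (k - 1) \<omega>)) * indicator {- pi<..pi} x * H (hist k \<omega>, x) \<partial>lborel)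
        = (\<integral>\<^sup>+s. G (hist k \<omega>, s) \<partial>angle_law \<eta> \<sigma> (c * real (k - 1)))"
      by (simp add: capacity_before_def)
  qed
  finally show ?thesis .
qed

lemma emeasure_increment:
  assumes [measurable]: "S \<in> sets borel"
  shows "emeasure M {\<omega> \<in> space M. wrap (\<theta> k \<omega> - \<theta> (k - 1) \<omega>) \<in> S} = emeasure (angle_law \<eta> \<sigma> (c * real (k - 1))) S"
proof -
  have [measurable]: "{\<omega> \<in> space M. wrap (\<theta> k \<omega> - \<theta> (k - 1) \<omega>) \<in> S} \<in> sets M" by measurable
  have "emeasure M {\<omega> \<in> space M. wrap (\<theta> k \<omega> - \<theta> (k - 1) \<omega>) \<in> S} =
      (\<integral>\<^sup>+\<omega>. indicator {\<omega> \<in> space M. wrap (\<theta> k \<omega> - \<theta> (k - 1) \<omega>) \<in> S} \<omega> \<partial>M)"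
    by simp
  also have "\<dots> = (\<integral>\<^sup>+\<omega>. indicator S (wrap (\<theta> k \<omega> - \<theta> (k - 1) \<omega>)) \<partial>M)"
    by (rule nn_integral_cong) (auto split: split_indicator)
  also have "\<dots> = (\<integral>\<^sup>+\<omega>. (\<integral>\<^sup>+s. indicator S s \<partial>angle_law \<eta> \<sigma> (c * real (k - 1))) \<partial>M)"
    using nn_integral_increment[of "\<lambda>p. indicator S (snd p)"] by simp
  also have "\<dots> = emeasure (angle_law \<eta> \<sigma> (c * real (k - 1))) S"
    by (simp add: emeasure_space_1)
  finally show ?thesis .
qed

end

section \<open>Staying close to the first angle\<close>

text \<open>
  Freezing the walk once it has left \<open>(- \<epsilon>, \<epsilon>)\<close> replaces a maximal inequality: the final value
  alone tells whether the walk ever left the interval.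
\<close>

fun stopped_walk :: "real \<Rightarrow> (nat \<Rightarrow> real) \<Rightarrow> nat \<Rightarrow> real" where
  "stopped_walk \<epsilon> \<xi> 0 = 0"
| "stopped_walk \<epsilon> \<xi> (Suc j) = (if \<epsilon> \<le> \<bar>stopped_walk \<epsilon> \<xi> j\<bar> then stopped_walk \<epsilon> \<xi> j
    else stopped_walk \<epsilon> \<xi> j + wrap (\<xi> (Suc (Suc j)) - \<xi> (Suc j)))"

lemma stopped_walk_cong:
  "(\<And>i. 1 \<le> i \<Longrightarrow> i \<le> Suc j \<Longrightarrow> \<xi> i = \<xi>' i) \<Longrightarrow> stopped_walk \<epsilon> \<xi> j = stopped_walk \<epsilon> \<xi>' j"
  by (induction j) auto

lemma stopped_walk_measurable:
  "{1..Suc j} \<subseteq> I \<Longrightarrow> (\<lambda>\<xi>. stopped_walk \<epsilon> \<xi> j) \<in> borel_measurable (PiM I (\<lambda>_. borel))"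
proof (induction j)
  case (Suc j)
  then have [measurable]: "(\<lambda>\<xi>. stopped_walk \<epsilon> \<xi> j) \<in> borel_measurable (PiM I (\<lambda>_. borel))"
    by (intro Suc.IH) auto
  have "Suc (Suc j) \<in> I" "Suc j \<in> I" using Suc.prems by auto
  then have [measurable]: "(\<lambda>\<xi>. \<xi> (Suc (Suc j))) \<in> borel_measurable (PiM I (\<lambda>_. borel :: real measure))"
    "(\<lambda>\<xi>. \<xi> (Suc j)) \<in> borel_measurable (PiM I (\<lambda>_. borel :: real measure))"
    by (auto intro: measurable_component_singleton)
  show ?case unfolding stopped_walk.simps by measurable
qed simp

lemma stopped_walk_hist: "stopped_walk \<epsilon> (hist (j + 2) \<omega>) j = stopped_walk \<epsilon> (\<lambda>i. \<theta> i \<omega>) j"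
  by (rule stopped_walk_cong) (auto simp: hist_def)

lemma stopped_walk_small:
  assumes "\<bar>stopped_walk \<epsilon> \<xi> n\<bar> < \<epsilon>"
  shows "angles_near \<epsilon> \<xi> (Suc n)"
proof -
  have "\<forall>j\<le>n. \<bar>stopped_walk \<epsilon> \<xi> j\<bar> < \<epsilon> \<and> cis (\<xi> (Suc j)) = cis (\<xi> 1 + stopped_walk \<epsilon> \<xi> j)"
    using assms
  proof (induction n)
    case (Suc n)
    have small: "\<bar>stopped_walk \<epsilon> \<xi> n\<bar> < \<epsilon>"
      using Suc.prems by (auto split: if_splits)
    note IH = Suc.IH[OF small]
    have "cis (\<xi> 1 + stopped_walk \<epsilon> \<xi> (Suc n)) = cis (\<xi> 1 + stopped_walk \<epsilon> \<xi> n) * cis (wrap (\<xi> (Suc (Suc n)) - \<xi> (Suc n)))"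
      using small by (simp add: cis_mult add.assoc)
    also have "cis (\<xi> 1 + stopped_walk \<epsilon> \<xi> n) = cis (\<xi> (Suc n))" using IH by simp
    also have "cis (\<xi> (Suc n)) * cis (wrap (\<xi> (Suc (Suc n)) - \<xi> (Suc n))) = cis (\<xi> (Suc (Suc n)))"
      by (simp add: cis_wrap cis_mult)
    finally show ?case using IH Suc.prems by (auto simp: le_Suc_eq simp del: stopped_walk.simps)
  qed (simp add: One_nat_def)
  then show ?thesis
    unfolding angles_near_def
  proof (intro ballI)
    fix j assume *: "\<forall>j\<le>n. \<bar>stopped_walk \<epsilon> \<xi> j\<bar> < \<epsilon> \<and> cis (\<xi> (Suc j)) = cis (\<xi> 1 + stopped_walk \<epsilon> \<xi> j)" and "j \<in> {1..Suc n}"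
    then obtain i where "j = Suc i" "i \<le> n" by (cases j) auto
    then show "\<exists>\<delta>. \<bar>\<delta>\<bar> \<le> \<epsilon> \<and> cis (\<xi> j) = cis (\<xi> 1 + \<delta>)" using * by (intro exI[of _ "stopped_walk \<epsilon> \<xi> i"]) auto
  qed
qed

lemma stopped_walk_borel [measurable]: "(\<lambda>\<omega>. stopped_walk \<epsilon> (\<lambda>i. \<theta> i \<omega>) j) \<in> borel_measurable M"
proof -
  have "{1..Suc j} \<subseteq> {1..<j + 2}" by auto
  from measurable_compose[OF hist_measurable[of "j + 2"] stopped_walk_measurable[OF this, of \<epsilon>]]
  show ?thesis by (simp only: stopped_walk_hist)
qed

lemma stopped_walk_second_moment:
  "(\<integral>\<^sup>+\<omega>. ennreal ((stopped_walk \<epsilon> (\<lambda>i. \<theta> i \<omega>) n)\<^sup>2) \<partial>M) \<le>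
    (\<Sum>j<n. \<integral>\<^sup>+s. ennreal (s\<^sup>2) \<partial>angle_law \<eta> \<sigma> (c * real (Suc j)))"
proof (induction n)
  case (Suc n)
  define k where "k = n + 2"
  have k: "2 \<le> k" "real (k - 1) = real (Suc n)" "k = Suc (Suc n)" "k - 1 = Suc n" by (auto simp: k_def)
  define L where "L = angle_law \<eta> \<sigma> (c * real (Suc n))"
  define V where "V = (\<integral>\<^sup>+s. ennreal (s\<^sup>2) \<partial>L)"
  have cp: "0 \<le> c * real (Suc n)" using c_pos by simp
  interpret L: prob_space L unfolding L_def by (rule prob_space_angle_law[OF \<sigma>_pos cp])
  define W where "W \<xi> = stopped_walk \<epsilon> \<xi> n" for \<xi>
  define G where "G p = ennreal ((if \<epsilon> \<le> \<bar>W (fst p)\<bar> then W (fst p) else W (fst p) + snd p)\<^sup>2)" for p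
  have Wm: "W \<in> borel_measurable (hist_space k)"
    unfolding W_def k_def by (rule stopped_walk_measurable) auto
  have [measurable]: "(\<lambda>p. W (fst p)) \<in> borel_measurable (hist_space k \<Otimes>\<^sub>M borel)"
    by (rule measurable_compose[OF measurable_fst Wm])
  have G: "G \<in> borel_measurable (hist_space k \<Otimes>\<^sub>M borel)" unfolding G_def by measurable
  have Wh: "W (hist k \<omega>) = stopped_walk \<epsilon> (\<lambda>i. \<theta> i \<omega>) n" for \<omega> unfolding W_def k_def by (rule stopped_walk_hist)
  have "(\<integral>\<^sup>+\<omega>. ennreal ((stopped_walk \<epsilon> (\<lambda>i. \<theta> i \<omega>) (Suc n))\<^sup>2) \<partial>M) =
      (\<integral>\<^sup>+\<omega>. G (hist k \<omega>, wrap (\<theta> k \<omega> - \<theta> (k - 1) \<omega>)) \<partial>M)"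
    unfolding G_def fst_conv snd_conv Wh k(4) unfolding k(3) by simp
  also have "\<dots> = (\<integral>\<^sup>+\<omega>. (\<integral>\<^sup>+s. G (hist k \<omega>, s) \<partial>L) \<partial>M)"
    unfolding L_def k(2)[symmetric] by (rule nn_integral_increment[OF k(1) G])
  also have "\<dots> \<le> (\<integral>\<^sup>+\<omega>. ennreal ((stopped_walk \<epsilon> (\<lambda>i. \<theta> i \<omega>) n)\<^sup>2) + V \<partial>M)"
  proof (rule nn_integral_mono)
    fix \<omega>
    have "(\<integral>\<^sup>+s. ennreal ((y + s)\<^sup>2) \<partial>L) = ennreal (y\<^sup>2) + V" for y
      unfolding L_def V_def by (rule angle_law_square_shift[OF \<sigma>_pos cp])
    then show "(\<integral>\<^sup>+s. G (hist k \<omega>, s) \<partial>L) \<le> ennreal ((stopped_walk \<epsilon> (\<lambda>i. \<theta> i \<omega>) n)\<^sup>2) + V"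
      by (cases "\<epsilon> \<le> \<bar>W (hist k \<omega>)\<bar>") (auto simp: G_def Wh L.emeasure_space_1)
  qed
  also have "\<dots> = (\<integral>\<^sup>+\<omega>. ennreal ((stopped_walk \<epsilon> (\<lambda>i. \<theta> i \<omega>) n)\<^sup>2) \<partial>M) + V"
    by (subst nn_integral_add) (auto simp: emeasure_space_1)
  also have "\<dots> \<le> (\<Sum>j<n. \<integral>\<^sup>+s. ennreal (s\<^sup>2) \<partial>angle_law \<eta> \<sigma> (c * real (Suc j))) + V"
    by (rule add_right_mono[OF Suc.IH])
  finally show ?case by (simp add: V_def L_def)
qed simp

lemma stopped_walk_large_prob:
  assumes \<epsilon>: "0 < \<epsilon>" and v: "(\<Sum>j<n. \<integral>\<^sup>+s. ennreal (s\<^sup>2) \<partial>angle_law \<eta> \<sigma> (c * real (Suc j))) \<le> ennreal v" "0 \<le> v"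
  shows "measure M {\<omega> \<in> space M. \<epsilon> \<le> \<bar>stopped_walk \<epsilon> (\<lambda>i. \<theta> i \<omega>) n\<bar>} \<le> v / \<epsilon>\<^sup>2"
proof -
  define E where "E = {\<omega> \<in> space M. \<epsilon> \<le> \<bar>stopped_walk \<epsilon> (\<lambda>i. \<theta> i \<omega>) n\<bar>}"
  have [measurable]: "E \<in> sets M" unfolding E_def by measurable
  have "ennreal (\<epsilon>\<^sup>2 * measure M E) = (\<integral>\<^sup>+\<omega>. ennreal (\<epsilon>\<^sup>2) * indicator E \<omega> \<partial>M)"
    by (simp add: nn_integral_cmult_indicator emeasure_eq_measure ennreal_mult)
  also have "\<dots> \<le> (\<integral>\<^sup>+\<omega>. ennreal ((stopped_walk \<epsilon> (\<lambda>i. \<theta> i \<omega>) n)\<^sup>2) \<partial>M)"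
  proof (rule nn_integral_mono)
    fix \<omega>
    have "\<epsilon>\<^sup>2 \<le> y\<^sup>2" if "\<epsilon> \<le> \<bar>y\<bar>" for y :: real using power_mono[OF that, of 2] \<epsilon> by simp
    then show "ennreal (\<epsilon>\<^sup>2) * indicator E \<omega> \<le> ennreal ((stopped_walk \<epsilon> (\<lambda>i. \<theta> i \<omega>) n)\<^sup>2)"
      by (auto simp: E_def split: split_indicator intro!: ennreal_leI)
  qed
  also have "\<dots> \<le> ennreal v" by (rule order_trans[OF stopped_walk_second_moment v(1)])
  finally have "\<epsilon>\<^sup>2 * measure M E \<le> v" using v(2) by simp
  then show ?thesis using \<epsilon> unfolding E_def[symmetric] by (simp add: pos_le_divide_eq mult.commute)
qed

section \<open>The path event\<close>

lemma increment_in_arc_iff: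
  assumes "0 < c"
  shows "(\<exists>x. cis u = cis x \<and> \<bar>x\<bar> < arc_angle c) \<longleftrightarrow> \<bar>wrap u\<bar> < arc_angle c"
proof
  assume "\<exists>x. cis u = cis x \<and> \<bar>x\<bar> < arc_angle c"
  then obtain x where x: "cis u = cis x" "\<bar>x\<bar> < arc_angle c" by blast
  have "arc_angle c < pi" using arc_angle_bounds[of c] assms by simp
  then have "wrap x = x" using x by (intro wrap_ident) auto
  moreover have "wrap u = wrap x" using x by (simp add: wrap_eq_Arg)
  ultimately show "\<bar>wrap u\<bar> < arc_angle c" using x by simp
next
  assume "\<bar>wrap u\<bar> < arc_angle c"
  then show "\<exists>x. cis u = cis x \<and> \<bar>x\<bar> < arc_angle c" using cis_wrap[of u] by metis
qed

lemma path_event_eq: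
  "path_event M c \<theta> n = {\<omega> \<in> space M. \<forall>k\<in>{2..n}. \<bar>wrap (\<theta> k \<omega> - \<theta> (k - 1) \<omega>)\<bar> < arc_angle c}"
proof -
  have "(\<forall>j\<in>{1..n}. has_parent c (\<lambda>i. \<theta> i \<omega>) j (j - 1)) \<longleftrightarrow>
      (\<forall>k\<in>{2..n}. \<bar>wrap (\<theta> k \<omega> - \<theta> (k - 1) \<omega>)\<bar> < arc_angle c)" for \<omega>
  proof -
    have "(\<forall>j\<in>{1..n}. has_parent c (\<lambda>i. \<theta> i \<omega>) j (j - 1)) \<longleftrightarrow>
      (\<forall>j\<in>{1..n}. j = 1 \<or> \<bar>wrap (\<theta> j \<omega> - \<theta> (j - 1) \<omega>)\<bar> < arc_angle c)"
      by (intro ball_cong refl) (simp add: has_parent_pred_iff[OF c_pos] increment_in_arc_iff[OF c_pos])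
    also have "\<dots> \<longleftrightarrow> (\<forall>k\<in>{2..n}. \<bar>wrap (\<theta> k \<omega> - \<theta> (k - 1) \<omega>)\<bar> < arc_angle c)"
    proof -
      have "{1..n} - {1} = {2..n}" by auto
      then show ?thesis by blast
    qed
    finally show ?thesis .
  qed
  then show ?thesis by (simp add: path_event_def)
qed

lemma increment_arc_sets:
  "2 \<le> k \<Longrightarrow> {\<omega> \<in> space M. wrap (\<theta> k \<omega> - \<theta> (k - 1) \<omega>) \<in> S} \<in> sets M" if [measurable]: "S \<in> sets borel"
proof -
  assume "2 \<le> k"
  then have [measurable]: "\<theta> k \<in> borel_measurable M" "\<theta> (k - 1) \<in> borel_measurable M"
    by (auto intro: angle_measurable)
  show ?thesis by measurable
qed

lemma path_event_prob_ge:
  assumes u: "(\<Sum>j\<in>{1..<n}. emeasure (angle_law \<eta> \<sigma> (c * real j)) {s. arc_angle c \<le> \<bar>s\<bar>}) \<le> ennreal u" "0 \<le> u"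
  shows "1 - u \<le> measure M (path_event M c \<theta> n)"
proof -
  define B where "B k = {\<omega> \<in> space M. wrap (\<theta> k \<omega> - \<theta> (k - 1) \<omega>) \<in> {s. arc_angle c \<le> \<bar>s\<bar>}}" for k
  have B: "B k \<in> sets M" if "2 \<le> k" for k unfolding B_def by (rule increment_arc_sets[OF _ that]) measurable
  define U where "U = (\<Union>k\<in>{2..n}. B k)"
  have U: "U \<in> sets M" unfolding U_def using B by (intro sets.finite_UN) auto
  have "path_event M c \<theta> n = space M - U"
    unfolding path_event_eq by (auto simp: U_def B_def not_le)
  then have "measure M (path_event M c \<theta> n) = 1 - measure M U" using prob_compl[OF U] by simp
  moreover have "measure M U \<le> u"
  proof -
    have "emeasure M U \<le> (\<Sum>k\<in>{2..n}. emeasure M (B k))"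
      unfolding U_def using B by (intro emeasure_subadditive_finite) auto
    also have "\<dots> = (\<Sum>k\<in>{2..n}. emeasure (angle_law \<eta> \<sigma> (c * real (k - 1))) {s. arc_angle c \<le> \<bar>s\<bar>})"
      unfolding B_def by (intro sum.cong refl emeasure_increment) auto
    also have "\<dots> = (\<Sum>j\<in>{1..<n}. emeasure (angle_law \<eta> \<sigma> (c * real j)) {s. arc_angle c \<le> \<bar>s\<bar>})"
      by (rule sum.reindex_bij_witness[of _ Suc "\<lambda>k. k - 1"]) auto
    also have "\<dots> \<le> ennreal u" by (rule u(1))
    finally show ?thesis using u(2) by (simp add: emeasure_eq_measure)
  qed
  ultimately show ?thesis by linarith
qed

lemma path_event_prob_le:
  assumes n: "2 \<le> n" and u: "emeasure (angle_law \<eta> \<sigma> (c * real (n - 1))) {s. \<bar>s\<bar> < arc_angle c} \<le> ennreal u" "0 \<le> u"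
  shows "measure M (path_event M c \<theta> n) \<le> u"
proof -
  define B where "B = {\<omega> \<in> space M. wrap (\<theta> n \<omega> - \<theta> (n - 1) \<omega>) \<in> {s. \<bar>s\<bar> < arc_angle c}}"
  have B: "B \<in> sets M" unfolding B_def by (rule increment_arc_sets[OF _ n]) measurable
  have "path_event M c \<theta> n \<subseteq> B" unfolding path_event_eq B_def using n by auto
  then have "measure M (path_event M c \<theta> n) \<le> measure M B" by (rule finite_measure_mono[OF _ B])
  also have "emeasure M B = emeasure (angle_law \<eta> \<sigma> (c * real (n - 1))) {s. \<bar>s\<bar> < arc_angle c}"
    unfolding B_def by (rule emeasure_increment[OF n]) measurable
  then have "emeasure M B \<le> ennreal u" using u(1) by simp
  then have "measure M B \<le> u" using u(2) by (simp add: emeasure_eq_measure)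
  finally show ?thesis .
qed

lemma angles_measurable: "(\<lambda>\<omega> i. if i = 0 then 0 else \<theta> i \<omega>) \<in> borel_measurable M"
proof (rule measurable_coordinatewise_then_product)
  show "(\<lambda>\<omega>. if i = 0 then 0 else \<theta> i \<omega>) \<in> borel_measurable M" for i
    using angle_measurable[of i] by (cases "i = 0") auto
qed

end

section \<open>Concentration for \<open>\<eta> > 1\<close>\<close>

lemma one_minus_exp_ge:
  fixes t T :: real
  assumes "0 \<le> t" "t \<le> T"
  shows "exp (- T) * t \<le> 1 - exp (- t)"
proof -
  have "t \<le> exp t - 1" using exp_ge_add_one_self[of t] by linarith
  then have "exp (- T) * t \<le> exp (- t) * (exp t - 1)"
    using assms by (intro mult_mono) auto
  also have "\<dots> = 1 - exp (- t)" by (simp add: exp_minus right_diff_distrib)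
  finally show ?thesis .
qed

lemma sum_inverse_sqrt_le: "(\<Sum>j\<in>{1..n}. 1 / sqrt (real j)) \<le> 2 * sqrt (real n)"
proof (induction n)
  case (Suc n)
  define a where "a = sqrt (real n)"
  define b where "b = sqrt (real (Suc n))"
  have ab: "0 \<le> a" "0 < b" "a \<le> b" by (auto simp: a_def b_def)
  have "(b - a) * (b + a) = b\<^sup>2 - a\<^sup>2" by (simp add: power2_eq_square algebra_simps)
  also have "\<dots> = 1" by (simp add: a_def b_def)
  finally have "1 = (b - a) * (b + a)" ..
  also have "\<dots> \<le> (b - a) * (2 * b)" using ab by (intro mult_left_mono) auto
  finally have "1 / b \<le> 2 * (b - a)" using ab by (simp add: divide_le_eq mult_ac)
  then show ?case using Suc.IH by (simp add: a_def b_def)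
qed simp

lemma tendsto_powr_at_right_0: "0 < g \<Longrightarrow> ((\<lambda>c::real. c powr g) \<longlongrightarrow> 0) (at_right 0)"
  by (rule tendsto_zero_powrI[where b = g]) (auto simp: eventually_at_right_less less_imp_le intro: eventually_mono[OF eventually_at_right_less])

lemma powr_minus_half: "0 \<le> x \<Longrightarrow> x powr (- 1 / 2) = 1 / sqrt x" for x :: real
proof -
  assume "0 \<le> x"
  have "x powr (- (1 / 2)) = 1 / sqrt x"
    unfolding powr_minus inverse_eq_divide powr_half_sqrt[OF \<open>0 \<le> x\<close>] ..
  then show ?thesis by simp
qed

lemma eventually_at_right_0_less: "0 < b \<Longrightarrow> \<forall>\<^sub>F c in at_right (0::real). c < b"
  by (rule order_tendstoD(2)[OF tendsto_ident_at])

lemma nat_floor_divide_le: "0 < c \<Longrightarrow> 0 \<le> t \<Longrightarrow> c * real (nat \<lfloor>t / c\<rfloor>) \<le> t"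
  and nat_floor_divide_gt: "0 < c \<Longrightarrow> 0 \<le> t \<Longrightarrow> t < c * real (nat \<lfloor>t / c\<rfloor>) + c"
proof -
  assume c: "0 < c" "0 \<le> t"
  define n where "n = real (nat \<lfloor>t / c\<rfloor>)"
  have "n = of_int \<lfloor>t / c\<rfloor>" using c by (simp add: n_def)
  then have "n \<le> t / c" "t / c < n + 1" by linarith+
  then have "c * n \<le> t" "t < c * n + c" using c by (simp_all add: field_simps)
  then show "c * real (nat \<lfloor>t / c\<rfloor>) \<le> t" "t < c * real (nat \<lfloor>t / c\<rfloor>) + c" by (simp_all only: n_def)
qed

lemma less_arc_angle:
  assumes c: "0 < c" "c \<le> T" and x: "0 \<le> x" "x \<le> pi" "x\<^sup>2 < 4 * exp (- T) * c"
  shows "x < arc_angle c"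
proof (rule ccontr)
  assume "\<not> x < arc_angle c"
  then have "cos x \<le> cos (arc_angle c)"
    using arc_angle_bounds[of c] c x by (intro cos_monotone_0_pi_le) auto
  then have "2 - 2 * cos x \<ge> 4 * (1 - exp (- c))" using cos_arc_angle[of c] c by simp
  moreover have "2 - 2 * cos x \<le> x\<^sup>2"
  proof -
    have "\<bar>sin (x / 2)\<bar>\<^sup>2 \<le> \<bar>x / 2\<bar>\<^sup>2" using abs_sin_x_le_abs_x[of "x / 2"] by (intro power_mono) auto
    then show ?thesis unfolding two_minus_two_cos by (simp add: power_divide)
  qed
  ultimately show False using one_minus_exp_ge[of c T] c x(3) by simp
qed

definition increments_small :: "real \<Rightarrow> real \<Rightarrow> real \<Rightarrow> real \<Rightarrow> real \<Rightarrow> real \<Rightarrow> bool" where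
  "increments_small \<eta> T c \<sigma> u w \<longleftrightarrow>
    (\<Sum>j\<in>{1..<nat \<lfloor>T / c\<rfloor>}. emeasure (angle_law \<eta> \<sigma> (c * real j)) {s. arc_angle c \<le> \<bar>s\<bar>}) \<le> ennreal u \<and>
    (\<Sum>j<nat \<lfloor>T / c\<rfloor> - 1. \<integral>\<^sup>+s. ennreal (s\<^sup>2) \<partial>angle_law \<eta> \<sigma> (c * real (Suc j))) \<le> ennreal w"

lemma concentration:
  fixes \<eta> \<gamma> T :: real
  assumes \<eta>: "1 < \<eta>" and \<gamma>: "(\<eta> + 1) / (2 * (\<eta> - 1)) < \<gamma>" and T: "0 < T"
  obtains U W :: "real \<Rightarrow> real"
  where "(U \<longlongrightarrow> 0) (at_right 0)" "(W \<longlongrightarrow> 0) (at_right 0)"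
    "\<forall>\<^sub>F c in at_right 0. 0 \<le> U c \<and> 0 \<le> W c \<and> (\<forall>\<sigma>. 0 < \<sigma> \<and> \<sigma> < c powr \<gamma> \<longrightarrow>
      increments_small \<eta> T c \<sigma> (U c) (W c))"
proof -
  obtain C where C: "0 < C" and tail:
    "\<And>\<sigma> t x. 0 < t \<Longrightarrow> t \<le> T \<Longrightarrow> 0 < \<sigma> \<Longrightarrow> \<sigma> \<le> 1 \<Longrightarrow> \<sigma>\<^sup>2 \<le> 1 - exp (- t) \<Longrightarrow> 0 < x \<Longrightarrow>
      emeasure (angle_law \<eta> \<sigma> t) {s. x < \<bar>s\<bar>} \<le>
        ennreal (C * (\<sigma> powr (\<eta> - 1) * ((1 - exp (- t)) powr (- \<eta> / 2) + x powr (1 - \<eta>))))"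
    using angle_law_tail[OF \<eta>, of T] by metis
  define g where "g = \<gamma> * (\<eta> - 1) - (\<eta> + 1) / 2"
  define \<delta> where "\<delta> = g / 2 / (\<eta> - 1)"
  define \<kappa> where "\<kappa> = exp (- T)"
  define \<kappa>' where "\<kappa>' = \<kappa> powr (- \<eta> / 2)"
  define U where "U c = C * (2 * \<kappa>' * sqrt T * c powr g + T * c powr (g / 2))" for c
  define W where "W c = T * c powr (2 * \<delta>) + pi\<^sup>2 * U c" for c
  have g: "0 < g" using \<gamma> \<eta> by (simp add: g_def field_simps)
  have \<delta>: "0 < \<delta>" using g \<eta> by (simp add: \<delta>_def)
  have \<delta>_mult: "\<delta> * (\<eta> - 1) = g / 2"
    unfolding \<delta>_def using \<eta> by (intro nonzero_eq_divide_eq[THEN iffD1, OF _ refl]) simp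
  have \<kappa>: "0 < \<kappa>" by (simp add: \<kappa>_def)
  have \<gamma>2: "1 / 2 < \<gamma>"
  proof -
    have "1 / 2 < (\<eta> + 1) / (2 * (\<eta> - 1))" using \<eta> by (simp add: field_simps)
    then show ?thesis using \<gamma> by linarith
  qed
  have "(U \<longlongrightarrow> C * (2 * \<kappa>' * sqrt T * 0 + T * 0)) (at_right 0)"
    unfolding U_def using g by (intro tendsto_intros tendsto_powr_at_right_0) auto
  then have U: "(U \<longlongrightarrow> 0) (at_right 0)" by simp
  have "(W \<longlongrightarrow> T * 0 + pi\<^sup>2 * 0) (at_right 0)"
    unfolding W_def using \<delta> by (intro tendsto_intros tendsto_powr_at_right_0 U) auto
  then have W: "(W \<longlongrightarrow> 0) (at_right 0)" by simp
  have ev1: "\<forall>\<^sub>F c in at_right 0. c powr (2 * \<gamma> - 1) < \<kappa>"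
    using order_tendstoD(2)[OF tendsto_powr_at_right_0 \<kappa>] \<gamma>2 by simp
  have ev2: "\<forall>\<^sub>F c in at_right 0. c powr (2 * \<delta>) < 4 * \<kappa>"
    using order_tendstoD(2)[OF tendsto_powr_at_right_0, of "2 * \<delta>" "4 * \<kappa>"] \<delta> \<kappa> by simp
  have ev3: "\<forall>\<^sub>F c in at_right (0::real). 0 < c \<and> c < min 1 T"
    using eventually_at_right_0_less[of "min 1 T"] eventually_at_right_less[of 0] T
    by (auto intro: eventually_conj)
  have main: "increments_small \<eta> T c \<sigma> (U c) (W c)"
    if ev: "c powr (2 * \<gamma> - 1) < \<kappa>" "c powr (2 * \<delta>) < 4 * \<kappa>" "0 < c \<and> c < min 1 T"
      and \<sigma>: "0 < \<sigma>" "\<sigma> < c powr \<gamma>" for c \<sigma>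
  proof -
    have c: "0 < c" "c < 1" "c \<le> T" using ev(3) by auto
    define N where "N = nat \<lfloor>T / c\<rfloor>"
    have N: "c * real N \<le> T" unfolding N_def using nat_floor_divide_le[of c T] c T by simp
    define x where "x = c powr (1 / 2 + \<delta>)"
    have x: "0 < x" "x \<le> pi"
    proof -
      show "0 < x" using c by (simp add: x_def)
      have "x \<le> 1 powr (1 / 2 + \<delta>)" unfolding x_def using c \<delta> by (intro powr_mono2) auto
      then show "x \<le> pi" using pi_gt3 by simp
    qed
    have x2: "x\<^sup>2 = c * c powr (2 * \<delta>)"
      using c by (simp add: x_def power2_eq_square flip: powr_add) (simp add: powr_add)
    have arc: "x < arc_angle c"
    proof (rule less_arc_angle[OF c(1,3)])
      show "x\<^sup>2 < 4 * exp (- T) * c"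
        unfolding x2 using mult_strict_left_mono[OF ev(2) c(1)] by (simp add: \<kappa>_def mult_ac)
    qed (use x in auto)
    have \<sigma>1: "\<sigma> \<le> 1"
    proof -
      have "c powr \<gamma> \<le> 1 powr \<gamma>" using c \<gamma>2 by (intro powr_mono2) auto
      then show ?thesis using \<sigma> by simp
    qed
    have \<sigma>2: "\<sigma>\<^sup>2 \<le> \<kappa> * c"
    proof -
      have "\<sigma>\<^sup>2 \<le> (c powr \<gamma>)\<^sup>2" using \<sigma> by (intro power_mono) auto
      also have "\<dots> = c powr (2 * \<gamma> - 1) * c" using c by (simp add: power2_eq_square powr_diff flip: powr_add)
      also have "\<dots> \<le> \<kappa> * c" using ev(1) c by (intro mult_right_mono) auto
      finally show ?thesis .
    qed
    define b where "b j = C * (c powr (\<gamma> * (\<eta> - 1)) * (\<kappa>' * c powr (- \<eta> / 2) * (1 / sqrt (real j)) + x powr (1 - \<eta>)))" for j :: nat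
    have b0: "0 \<le> b j" for j unfolding b_def using C by (intro mult_nonneg_nonneg add_nonneg_nonneg) (auto simp: \<kappa>'_def)
    have tail_b: "emeasure (angle_law \<eta> \<sigma> (c * real j)) {s. x < \<bar>s\<bar>} \<le> ennreal (b j)" if j: "1 \<le> j" "j \<le> N" for j
    proof -
      have "c * real j \<le> c * real N" using c j by (intro mult_left_mono) auto
      then have cj: "0 < c * real j" "c * real j \<le> T" using c(1) j(1) N by (simp, linarith)
      have e: "\<kappa> * (c * real j) \<le> 1 - exp (- (c * real j))"
        unfolding \<kappa>_def using one_minus_exp_ge[of "c * real j" T] cj by simp
      have "\<kappa> * c * 1 \<le> \<kappa> * c * real j" using \<kappa> c j by (intro mult_left_mono) auto
      then have s: "\<sigma>\<^sup>2 \<le> 1 - exp (- (c * real j))" using \<sigma>2 e by (simp add: mult.assoc)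
      have "emeasure (angle_law \<eta> \<sigma> (c * real j)) {s. x < \<bar>s\<bar>} \<le>
          ennreal (C * (\<sigma> powr (\<eta> - 1) * ((1 - exp (- (c * real j))) powr (- \<eta> / 2) + x powr (1 - \<eta>))))"
        by (rule tail[OF cj \<sigma>(1) \<sigma>1 s x(1)])
      also have "\<dots> \<le> ennreal (b j)"
        unfolding b_def
      proof (intro ennreal_leI mult_left_mono mult_mono add_right_mono)
        have "\<sigma> powr (\<eta> - 1) \<le> (c powr \<gamma>) powr (\<eta> - 1)" using \<sigma> \<eta> by (intro powr_mono2) auto
        then show "\<sigma> powr (\<eta> - 1) \<le> c powr (\<gamma> * (\<eta> - 1))" by (simp add: powr_powr)
        have "(1 - exp (- (c * real j))) powr (- \<eta> / 2) \<le> (\<kappa> * (c * real j)) powr (- \<eta> / 2)"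
          using e \<kappa> cj \<eta> by (intro powr_mono2') auto
        also have "\<dots> = \<kappa>' * c powr (- \<eta> / 2) * real j powr (- \<eta> / 2)"
          by (simp add: \<kappa>'_def powr_mult)
        also have "real j powr (- \<eta> / 2) \<le> real j powr (- 1 / 2)" using j \<eta> by (intro powr_mono) auto
        also have "real j powr (- 1 / 2) = 1 / sqrt (real j)"
          by (rule powr_minus_half) simp
        finally show "(1 - exp (- (c * real j))) powr (- \<eta> / 2) \<le> \<kappa>' * c powr (- \<eta> / 2) * (1 / sqrt (real j))"
          by (simp add: \<kappa>'_def mult_left_mono)
      qed (use C in \<open>auto simp: \<kappa>'_def\<close>)
      finally show ?thesis .
    qed
    have sum_b: "(\<Sum>j\<in>{1..<N}. b j) \<le> U c"
    proof -
      have "(\<Sum>j\<in>{1..<N}. b j) \<le> (\<Sum>j\<in>{1..N}. b j)" using b0 by (intro sum_mono2) auto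
      also have "\<dots> = C * (c powr (\<gamma> * (\<eta> - 1)) * (\<kappa>' * c powr (- \<eta> / 2) * (\<Sum>j\<in>{1..N}. 1 / sqrt (real j)) + real N * x powr (1 - \<eta>)))"
        unfolding b_def by (simp only: sum_distrib_left[symmetric] sum.distrib) simp
      also have "\<dots> \<le> C * (c powr (\<gamma> * (\<eta> - 1)) * (\<kappa>' * c powr (- \<eta> / 2) * (2 * (sqrt T * c powr (- 1 / 2))) + (T * c powr (- 1)) * x powr (1 - \<eta>)))"
      proof -
        have NT: "real N \<le> T / c" using N c by (simp add: field_simps)
        have "sqrt (real N) \<le> sqrt (T / c)" using NT by (rule real_sqrt_le_mono)
        also have "\<dots> = sqrt T * c powr (- 1 / 2)"
          using powr_minus_half[of c] c by (simp add: real_sqrt_divide)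
        finally have "(\<Sum>j\<in>{1..N}. 1 / sqrt (real j)) \<le> 2 * (sqrt T * c powr (- 1 / 2))"
          using sum_inverse_sqrt_le[of N] by linarith
        moreover have "real N \<le> T * c powr (- 1)" using NT c by (simp add: powr_minus divide_inverse)
        ultimately show ?thesis using C by (intro mult_left_mono add_mono mult_right_mono) (auto simp: \<kappa>'_def)
      qed
      also have "\<dots> = U c"
      proof -
        have "c powr (\<gamma> * (\<eta> - 1)) * c powr (- \<eta> / 2) * c powr (- 1 / 2) = c powr g"
        proof -
          have "\<gamma> * (\<eta> - 1) + - \<eta> / 2 + - 1 / 2 = g" unfolding g_def by argo
          then show ?thesis by (simp only: powr_add[symmetric])
        qed
        moreover have "c powr (\<gamma> * (\<eta> - 1)) * c powr (- 1) * x powr (1 - \<eta>) = c powr (g / 2)"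
        proof -
          have "\<gamma> * (\<eta> - 1) + (- 1) + (1 / 2 + \<delta>) * (1 - \<eta>) = g / 2"
            using \<delta>_mult by (simp add: g_def algebra_simps) (simp add: field_simps)
          then show ?thesis unfolding x_def powr_powr by (simp only: powr_add[symmetric])
        qed
        ultimately show ?thesis unfolding U_def by (simp only: distrib_left mult_ac)
      qed
      finally show ?thesis .
    qed
    have first: "(\<Sum>j\<in>{1..<N}. emeasure (angle_law \<eta> \<sigma> (c * real j)) {s. x < \<bar>s\<bar>}) \<le> ennreal (U c)"
    proof -
      have "(\<Sum>j\<in>{1..<N}. emeasure (angle_law \<eta> \<sigma> (c * real j)) {s. x < \<bar>s\<bar>}) \<le> (\<Sum>j\<in>{1..<N}. ennreal (b j))"
        by (rule sum_mono) (use tail_b in auto)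
      also have "\<dots> = ennreal (\<Sum>j\<in>{1..<N}. b j)" using b0 by (simp add: sum_ennreal)
      also have "\<dots> \<le> ennreal (U c)" by (rule ennreal_leI[OF sum_b])
      finally show ?thesis .
    qed
    have arcs: "(\<Sum>j\<in>{1..<N}. emeasure (angle_law \<eta> \<sigma> (c * real j)) {s. arc_angle c \<le> \<bar>s\<bar>}) \<le> ennreal (U c)"
    proof (rule order_trans[OF sum_mono first])
      fix j
      show "emeasure (angle_law \<eta> \<sigma> (c * real j)) {s. arc_angle c \<le> \<bar>s\<bar>} \<le> emeasure (angle_law \<eta> \<sigma> (c * real j)) {s. x < \<bar>s\<bar>}"
        by (rule emeasure_mono) (use arc in auto)
    qed
    have "(\<Sum>j<N - 1. \<integral>\<^sup>+s. ennreal (s\<^sup>2) \<partial>angle_law \<eta> \<sigma> (c * real (Suc j)))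
        = (\<Sum>j\<in>{1..<N}. \<integral>\<^sup>+s. ennreal (s\<^sup>2) \<partial>angle_law \<eta> \<sigma> (c * real j))"
      by (rule sum.reindex_bij_witness[of _ "\<lambda>j. j - 1" Suc]) auto
    also have "\<dots> \<le> (\<Sum>j\<in>{1..<N}. ennreal (x\<^sup>2) + ennreal (pi\<^sup>2) * emeasure (angle_law \<eta> \<sigma> (c * real j)) {s. x < \<bar>s\<bar>})"
      by (rule sum_mono) (use x c \<sigma> in \<open>auto intro!: angle_law_second_moment\<close>)
    also have "\<dots> = ennreal (real (N - 1) * x\<^sup>2) + ennreal (pi\<^sup>2) * (\<Sum>j\<in>{1..<N}. emeasure (angle_law \<eta> \<sigma> (c * real j)) {s. x < \<bar>s\<bar>})"
      by (simp add: sum.distrib sum_distrib_left ennreal_mult ennreal_of_nat_eq_real_of_nat)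
    also have "\<dots> \<le> ennreal (T * c powr (2 * \<delta>)) + ennreal (pi\<^sup>2) * ennreal (U c)"
    proof (intro add_mono mult_left_mono first ennreal_leI)
      have "real (N - 1) * x\<^sup>2 \<le> real N * x\<^sup>2" by (intro mult_right_mono) auto
      also have "\<dots> = (c * real N) * c powr (2 * \<delta>)" by (simp add: x2)
      also have "\<dots> \<le> T * c powr (2 * \<delta>)" using N by (intro mult_right_mono) auto
      finally show "real (N - 1) * x\<^sup>2 \<le> T * c powr (2 * \<delta>)" .
    qed auto
    also have "\<dots> = ennreal (W c)"
    proof -
      have "0 \<le> U c" using b0 sum_b by (meson order_trans sum_nonneg)
      then show ?thesis using T by (simp add: W_def ennreal_mult)
    qed
    finally show ?thesis using arcs by (simp add: increments_small_def N_def)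
  qed
  have "\<forall>\<^sub>F c in at_right 0. 0 \<le> U c \<and> 0 \<le> W c \<and> (\<forall>\<sigma>. 0 < \<sigma> \<and> \<sigma> < c powr \<gamma> \<longrightarrow>
      increments_small \<eta> T c \<sigma> (U c) (W c))"
    using ev1 ev2 ev3
  proof eventually_elim
    case (elim c)
    have "0 \<le> U c" unfolding U_def using C T by (auto simp: \<kappa>'_def)
    moreover from this have "0 \<le> W c" unfolding W_def using T by simp
    ultimately show ?case using main[OF elim] by blast
  qed
  then show ?thesis using that U W by blast
qed

lemma tendsto_arc_angle: "(arc_angle \<longlongrightarrow> 0) (at_right 0)"
proof -
  have "continuous_on {0..} arc_angle"
    unfolding arc_angle_def
    by (intro continuous_intros) (auto intro: order_trans[of "- 1" 0])
  then have "(arc_angle \<longlongrightarrow> arc_angle 0) (at 0 within {0..})" by (simp add: continuous_on_def)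
  then have "(arc_angle \<longlongrightarrow> arc_angle 0) (at 0 within {0<..})" by (rule tendsto_within_subset) auto
  then show ?thesis by (simp add: arc_angle_def)
qed

section \<open>Deterministic error bounds\<close>

lemma cluster_map_error_eventually_small:
  fixes r T e :: real
  assumes r: "1 < r" and T: "0 < T" and e: "0 < e"
  obtains \<epsilon> where "0 < \<epsilon>"
    "\<And>c \<theta> t z. 0 < c \<Longrightarrow> c \<le> 1 \<Longrightarrow> angles_near \<epsilon> \<theta> (nat \<lfloor>T / c\<rfloor>) \<Longrightarrow> 0 \<le> t \<Longrightarrow> t \<le> T \<Longrightarrow> r \<le> norm z \<Longrightarrow>
      norm (cluster_map c \<theta> (nat \<lfloor>t / c\<rfloor>) z - rotated_slit_map (c * real (nat \<lfloor>t / c\<rfloor>)) (\<theta> 1) z) \<le> e"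
proof
  define q where "q = 1 - 1 / r\<^sup>2"
  define A where "A = 1 + 16 / q\<^sup>2"
  define B where "B = (8 + 16 / q) / q"
  define \<epsilon> where "\<epsilon> = e / (T * exp (T * A) * B)"
  have q: "0 < q" unfolding q_def by (rule q_pos[OF r refl])
  have AB: "0 < A" "0 < B" using q by (auto simp: A_def B_def add_pos_pos)
  show \<epsilon>: "0 < \<epsilon>" using AB T e by (simp add: \<epsilon>_def)
  fix c t :: real and \<theta> and z :: complex
  assume c: "0 < c" "c \<le> 1" and near: "angles_near \<epsilon> \<theta> (nat \<lfloor>T / c\<rfloor>)" and t: "0 \<le> t" "t \<le> T" and z: "r \<le> norm z"
  define n where "n = nat \<lfloor>t / c\<rfloor>"
  have "n \<le> nat \<lfloor>T / c\<rfloor>" unfolding n_def using t c by (intro nat_mono floor_mono divide_right_mono) auto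
  then have nn: "angles_near \<epsilon> \<theta> n" by (rule angles_near_mono[OF near])
  have nc: "c * real n \<le> T" using nat_floor_divide_le[of c t] c t by (simp add: n_def)
  have "norm (cluster_map c \<theta> n z - rotated_slit_map (c * real n) (\<theta> 1) z)
      \<le> n * exp (c * (1 + 16 / q\<^sup>2)) ^ n * (c * ((8 + 16 / q) / q) * \<epsilon>)"
    by (rule cluster_map_close[OF r q_def _ c(2) z]) (use c angles_near_norm_le[OF nn] in auto)
  also have "\<dots> = (c * real n) * exp (c * real n * A) * (B * \<epsilon>)"
    by (simp add: A_def B_def exp_of_nat_mult[symmetric] mult_ac)
  also have "\<dots> \<le> T * exp (T * A) * (B * \<epsilon>)"
    using nc c AB \<epsilon> T by (intro mult_right_mono mult_mono) auto
  also have "\<dots> = e" using AB T by (simp add: \<epsilon>_def)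
  finally show "norm (cluster_map c \<theta> (nat \<lfloor>t / c\<rfloor>) z - rotated_slit_map (c * real (nat \<lfloor>t / c\<rfloor>)) (\<theta> 1) z) \<le> e"
    by (simp add: n_def)
qed

lemma hausdorff_error_eventually_small:
  fixes t e :: real
  assumes t: "0 \<le> t" and e: "0 < e"
  obtains \<epsilon> c0 where "0 < \<epsilon>" "0 < c0"
    "\<And>c \<theta>. 0 < c \<Longrightarrow> c < c0 \<Longrightarrow> angles_near \<epsilon> \<theta> (nat \<lfloor>t / c\<rfloor>) \<Longrightarrow>
      hausdorff_dist (cluster c \<theta> (nat \<lfloor>t / c\<rfloor>)) (slit_disk t (\<theta> 1)) \<le> ennreal e"
proof -
  have "uniformly_continuous_on {0..t} slit_length"
    by (intro compact_uniformly_continuous continuous_on_slit_length) auto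
  then obtain d where d: "0 < d" "\<And>s s'. s \<in> {0..t} \<Longrightarrow> s' \<in> {0..t} \<Longrightarrow> dist s' s < d \<Longrightarrow> dist (slit_length s') (slit_length s) < e / 2"
    unfolding uniformly_continuous_on_def using e by (metis half_gt_zero)
  define D where "D = 1 + slit_length t"
  have D: "0 < D" using slit_length_nonneg[OF t] by (simp add: D_def)
  define \<epsilon> where "\<epsilon> = min (1 / 16) (min ((d / 16)\<^sup>2) (e / (2 * D)))"
  have \<epsilon>: "0 < \<epsilon>" "\<epsilon> \<le> 1 / 16" "\<epsilon> \<le> (d / 16)\<^sup>2" "\<epsilon> \<le> e / (2 * D)"
    using d D e by (auto simp: \<epsilon>_def)
  have "sqrt \<epsilon> \<le> sqrt ((d / 16)\<^sup>2)" using \<epsilon>(3) by (rule real_sqrt_le_mono)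
  then have sq: "4 * sqrt \<epsilon> < d / 2" using d by simp
  show ?thesis
  proof (rule that[of \<epsilon> "d / 2"])
    fix c \<theta> assume c: "0 < c" "c < d / 2" and near: "angles_near \<epsilon> \<theta> (nat \<lfloor>t / c\<rfloor>)"
    have "hausdorff_dist (cluster c \<theta> (nat \<lfloor>t / c\<rfloor>)) (slit_disk t (\<theta> 1)) \<le> ennreal (e / 2 + (1 + slit_length t) * \<epsilon>)"
    proof (rule hausdorff_dist_cluster_le[OF c(1) \<epsilon>(1,2) t near])
      fix s s' :: real assume s: "0 \<le> s'" "s' \<le> s" "s \<le> t" "s - s' \<le> c + 4 * sqrt \<epsilon>"
      then have "dist s s' < d" using c sq by (simp add: dist_real_def)
      then have "dist (slit_length s) (slit_length s') < e / 2" using s by (intro d(2)) auto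
      then show "slit_length s - slit_length s' \<le> e / 2" unfolding dist_real_def by linarith
    qed
    also have "(1 + slit_length t) * \<epsilon> \<le> D * (e / (2 * D))" using \<epsilon>(4) D unfolding D_def[symmetric] by (intro mult_left_mono) auto
    then have "ennreal (e / 2 + (1 + slit_length t) * \<epsilon>) \<le> ennreal e" using D by (intro ennreal_leI) simp
    finally show "hausdorff_dist (cluster c \<theta> (nat \<lfloor>t / c\<rfloor>)) (slit_disk t (\<theta> 1)) \<le> ennreal e" .
  qed (use \<epsilon> d in auto)
qed

section \<open>Convergence in probability\<close>

lemma tendsto_zero_in_probability_if_near:
  fixes M :: "real \<Rightarrow> 'w measure" and \<theta> :: "real \<Rightarrow> nat \<Rightarrow> 'w \<Rightarrow> real" and \<sigma> :: "real \<Rightarrow> real"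
  assumes model: "\<And>c. 0 < c \<Longrightarrow> markov_slit_model (M c) \<eta> c (\<sigma> c) (\<theta> c)"
    and \<sigma>: "\<And>c. 0 < c \<Longrightarrow> 0 < \<sigma> c \<and> \<sigma> c < c powr \<gamma>"
    and \<eta>: "1 < \<eta>" "(\<eta> + 1) / (2 * (\<eta> - 1)) < \<gamma>" and T: "0 < T"
    and S: "\<And>c. 0 < c \<Longrightarrow> S c \<in> borel_measurable borel"
    and S_cong: "\<And>c \<xi> \<xi>'. 0 < c \<Longrightarrow> (\<And>i. 1 \<le> i \<Longrightarrow> \<xi> i = \<xi>' i) \<Longrightarrow> S c \<xi> = S c \<xi>'"
    and small: "\<And>e. 0 < e \<Longrightarrow> \<exists>\<epsilon>>0. \<forall>\<^sub>F c in at_right 0. \<forall>\<xi>. angles_near \<epsilon> \<xi> (nat \<lfloor>T / c\<rfloor>) \<longrightarrow> S c \<xi> \<le> ennreal e"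
  shows "tendsto_zero_in_probability M (\<lambda>c \<omega>. S c (\<lambda>i. \<theta> c i \<omega>)) (at_right 0)"
proof -
  have meas: "(\<lambda>\<omega>. S c (\<lambda>i. \<theta> c i \<omega>)) \<in> borel_measurable (M c)" if c: "0 < c" for c
  proof -
    interpret markov_slit_model "M c" \<eta> c "\<sigma> c" "\<theta> c" by (rule model[OF c])
    have "(\<lambda>\<omega>. S c (\<lambda>i. \<theta> c i \<omega>)) = (\<lambda>\<omega>. S c (\<lambda>i. if i = 0 then 0 else \<theta> c i \<omega>))"
      by (intro ext S_cong[OF c]) auto
    then show ?thesis using measurable_compose[OF angles_measurable S[OF c]] by simp
  qed
  obtain U W :: "real \<Rightarrow> real" where W: "(W \<longlongrightarrow> 0) (at_right 0)" and
    ev: "\<forall>\<^sub>F c in at_right 0. 0 \<le> U c \<and> 0 \<le> W c \<and> (\<forall>\<sigma>. 0 < \<sigma> \<and> \<sigma> < c powr \<gamma> \<longrightarrow>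
      increments_small \<eta> T c \<sigma> (U c) (W c))"
    by (rule concentration[OF \<eta> T])
  show ?thesis
    unfolding tendsto_zero_in_probability_def
  proof (intro conjI allI impI)
    show "\<forall>\<^sub>F c in at_right 0. (\<lambda>\<omega>. S c (\<lambda>i. \<theta> c i \<omega>)) \<in> borel_measurable (M c)"
      using eventually_at_right_less[of 0] by eventually_elim (rule meas)
    fix e :: real assume "0 < e"
    from small[OF this] obtain \<epsilon> where \<epsilon>: "0 < \<epsilon>"
      and sm: "\<forall>\<^sub>F c in at_right 0. \<forall>\<xi>. angles_near \<epsilon> \<xi> (nat \<lfloor>T / c\<rfloor>) \<longrightarrow> S c \<xi> \<le> ennreal e" by blast
    have "((\<lambda>c. W c / \<epsilon>\<^sup>2) \<longlongrightarrow> 0 / \<epsilon>\<^sup>2) (at_right 0)" using \<epsilon> by (intro tendsto_intros W) auto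
    then have lim: "((\<lambda>c. W c / \<epsilon>\<^sup>2) \<longlongrightarrow> 0) (at_right 0)" by simp
    have evT: "\<forall>\<^sub>F c in at_right 0. c < T" by (rule eventually_at_right_0_less[OF T])
    show "((\<lambda>c. measure (M c) {\<omega> \<in> space (M c). ennreal e < S c (\<lambda>i. \<theta> c i \<omega>)}) \<longlongrightarrow> 0) (at_right 0)"
    proof (rule tendsto_sandwich[OF _ _ tendsto_const lim])
      show "\<forall>\<^sub>F c in at_right 0. measure (M c) {\<omega> \<in> space (M c). ennreal e < S c (\<lambda>i. \<theta> c i \<omega>)} \<le> W c / \<epsilon>\<^sup>2"
        using ev sm evT eventually_at_right_less[of 0]
      proof eventually_elim
        case (elim c)
        then have c: "0 < c" by simp
        interpret markov_slit_model "M c" \<eta> c "\<sigma> c" "\<theta> c" by (rule model[OF c])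
        define n where "n = nat \<lfloor>T / c\<rfloor> - 1"
        have "1 \<le> T / c" using elim c by simp
        then have "1 \<le> nat \<lfloor>T / c\<rfloor>" by linarith
        then have n: "Suc n = nat \<lfloor>T / c\<rfloor>" by (simp add: n_def)
        have "{\<omega> \<in> space (M c). ennreal e < S c (\<lambda>i. \<theta> c i \<omega>)} \<subseteq> {\<omega> \<in> space (M c). \<epsilon> \<le> \<bar>stopped_walk \<epsilon> (\<lambda>i. \<theta> c i \<omega>) n\<bar>}"
        proof safe
          fix \<omega> assume "ennreal e < S c (\<lambda>i. \<theta> c i \<omega>)"
          then have "\<not> angles_near \<epsilon> (\<lambda>i. \<theta> c i \<omega>) (Suc n)" using elim(2) n by (metis not_less)
          then show "\<epsilon> \<le> \<bar>stopped_walk \<epsilon> (\<lambda>i. \<theta> c i \<omega>) n\<bar>" using stopped_walk_small not_less by blast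
        qed
        then have "measure (M c) {\<omega> \<in> space (M c). ennreal e < S c (\<lambda>i. \<theta> c i \<omega>)} \<le>
            measure (M c) {\<omega> \<in> space (M c). \<epsilon> \<le> \<bar>stopped_walk \<epsilon> (\<lambda>i. \<theta> c i \<omega>) n\<bar>}"
          by (rule finite_measure_mono) measurable
        also have "\<dots> \<le> W c / \<epsilon>\<^sup>2"
          by (rule stopped_walk_large_prob[OF \<epsilon>]) (use elim(1) \<sigma>[OF c] in \<open>auto simp: n_def increments_small_def\<close>)
        finally show ?case .
      qed
    qed simp
  qed
qed

lemma rotated_cluster_difference_measurable:
  assumes "0 \<le> c" "\<And>t. t \<in> I \<Longrightarrow> 0 \<le> \<tau> t" "\<And>z. z \<in> Z \<Longrightarrow> 1 \<le> norm z"
  shows "(\<lambda>\<xi>. SUP t\<in>I. SUP z\<in>Z. ennreal (norm (cluster_map c \<xi> (n t) z - rotated_slit_map (\<tau> t) (\<xi> 1) z)))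
    \<in> borel_measurable borel"
  using assms
  by (intro lsc_borel_measurable lsc_SUP lsc_continuous continuous_intros continuous_on_cluster_map
      continuous_on_rotated_slit_map continuous_on_product_coordinates) auto

theorem theorem2:
  fixes M :: "real \<Rightarrow> real \<Rightarrow> 'w measure"
    and \<theta> :: "real \<Rightarrow> real \<Rightarrow> nat \<Rightarrow> 'w \<Rightarrow> real"
    and \<eta> T :: real
  assumes model: "\<And>c \<sigma>. 0 < c \<Longrightarrow> 0 < \<sigma> \<Longrightarrow> markov_slit_model (M c \<sigma>) \<eta> c \<sigma> (\<theta> c \<sigma>)"
    and T_pos: "0 < T"
  shows
    "(\<forall>\<gamma>. 1 < \<eta> \<and> (\<eta> + 1) / (2 * (\<eta> - 1)) < \<gamma> \<longrightarrow>
        ((\<lambda>c. INF \<sigma>\<in>{0<..<c powr \<gamma>}.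
            measure (M c \<sigma>) (path_event (M c \<sigma>) c (\<theta> c \<sigma>) (nat \<lfloor>T / c\<rfloor>))) \<longlongrightarrow> 1) (at_right 0))
     \<and>
     (\<eta> < 1 \<longrightarrow>
        ((\<lambda>c. SUP \<sigma>\<in>{0<..}.
            measure (M c \<sigma>) (path_event (M c \<sigma>) c (\<theta> c \<sigma>) (nat \<lfloor>T / c\<rfloor>))) \<longlongrightarrow> 0) (at_right 0))
     \<and>
     (\<forall>\<gamma> \<sigma>. 1 < \<eta> \<and> (\<eta> + 1) / (2 * (\<eta> - 1)) < \<gamma> \<and>
        (\<forall>c>0. 0 < \<sigma> c \<and> \<sigma> c < c powr \<gamma>) \<longrightarrow>
        (\<forall>r R. 1 < r \<and> r < R \<longrightarrow>
           tendsto_zero_in_probability (\<lambda>c. M c (\<sigma> c))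
             (\<lambda>c \<omega>. SUP t\<in>{0..T}. SUP z\<in>{z. r < norm z \<and> norm z < R}.
                ennreal (norm (cluster_map c (\<lambda>i. \<theta> c (\<sigma> c) i \<omega>) (nat \<lfloor>t / c\<rfloor>) z
                  - rotated_slit_map t (\<theta> c (\<sigma> c) 1 \<omega>) z)))
             (at_right 0)) \<and>
        (\<forall>r>1.
           tendsto_zero_in_probability (\<lambda>c. M c (\<sigma> c))
             (\<lambda>c \<omega>. SUP t\<in>{0..T}. SUP z\<in>{z. r < norm z}.
                ennreal (norm (cluster_map c (\<lambda>i. \<theta> c (\<sigma> c) i \<omega>) (nat \<lfloor>t / c\<rfloor>) z
                  - rotated_slit_map (c * real (nat \<lfloor>t / c\<rfloor>)) (\<theta> c (\<sigma> c) 1 \<omega>) z)))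
             (at_right 0)) \<and>
        (\<forall>t\<in>{0..T}.
           tendsto_zero_in_probability (\<lambda>c. M c (\<sigma> c))
             (\<lambda>c \<omega>. hausdorff_dist (cluster c (\<lambda>i. \<theta> c (\<sigma> c) i \<omega>) (nat \<lfloor>t / c\<rfloor>))
                (slit_disk t (\<theta> c (\<sigma> c) 1 \<omega>)))
             (at_right 0)))"
proof (intro conjI allI impI ballI; (elim conjE)?)
  fix \<gamma> assume \<eta>: "1 < \<eta>" "(\<eta> + 1) / (2 * (\<eta> - 1)) < \<gamma>"
  let ?P = "\<lambda>c \<sigma>. measure (M c \<sigma>) (path_event (M c \<sigma>) c (\<theta> c \<sigma>) (nat \<lfloor>T / c\<rfloor>))"
  obtain U W :: "real \<Rightarrow> real" where U: "(U \<longlongrightarrow> 0) (at_right 0)" and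
    ev: "\<forall>\<^sub>F c in at_right 0. 0 \<le> U c \<and> 0 \<le> W c \<and> (\<forall>\<sigma>. 0 < \<sigma> \<and> \<sigma> < c powr \<gamma> \<longrightarrow>
      increments_small \<eta> T c \<sigma> (U c) (W c))"
    by (rule concentration[OF \<eta> T_pos])
  have "((\<lambda>c. 1 - U c) \<longlongrightarrow> 1 - 0) (at_right 0)" by (intro tendsto_intros U)
  then have lim: "((\<lambda>c. 1 - U c) \<longlongrightarrow> 1) (at_right 0)" by simp
  show "((\<lambda>c. INF \<sigma>\<in>{0<..<c powr \<gamma>}. ?P c \<sigma>) \<longlongrightarrow> 1) (at_right 0)"
  proof (rule tendsto_sandwich[OF _ _ lim tendsto_const])
    show "\<forall>\<^sub>F c in at_right 0. 1 - U c \<le> (INF \<sigma>\<in>{0<..<c powr \<gamma>}. ?P c \<sigma>)"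
      using ev eventually_at_right_less[of 0]
    proof eventually_elim
      case (elim c)
      show ?case
      proof (rule cINF_greatest)
        show "{0<..<c powr \<gamma>} \<noteq> {}" using elim(2) dense[of 0 "c powr \<gamma>"] by auto
        fix \<sigma> assume \<sigma>: "\<sigma> \<in> {0<..<c powr \<gamma>}"
        interpret markov_slit_model "M c \<sigma>" \<eta> c \<sigma> "\<theta> c \<sigma>" by (rule model) (use elim(2) \<sigma> in auto)
        show "1 - U c \<le> ?P c \<sigma>" by (rule path_event_prob_ge) (use elim(1) \<sigma> in \<open>auto simp: increments_small_def\<close>)
      qed
    qed
    show "\<forall>\<^sub>F c in at_right 0. (INF \<sigma>\<in>{0<..<c powr \<gamma>}. ?P c \<sigma>) \<le> 1"
      using eventually_at_right_less[of 0]
    proof eventually_elim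
      case (elim c)
      obtain \<sigma> where \<sigma>: "0 < \<sigma>" "\<sigma> < c powr \<gamma>" using elim dense[of 0 "c powr \<gamma>"] by auto
      interpret markov_slit_model "M c \<sigma>" \<eta> c \<sigma> "\<theta> c \<sigma>" by (rule model[OF elim \<sigma>(1)])
      show ?case by (rule cINF_lower2[where x = \<sigma>]) (use \<sigma> in \<open>auto intro!: bdd_belowI[of _ 0]\<close>)
    qed
  qed
next
  assume \<eta>: "\<eta> < 1"
  let ?P = "\<lambda>c \<sigma>. measure (M c \<sigma>) (path_event (M c \<sigma>) c (\<theta> c \<sigma>) (nat \<lfloor>T / c\<rfloor>))"
  obtain C b0 where C: "0 < C" "0 < b0" and small:
    "\<And>\<sigma> t b. T / 2 \<le> t \<Longrightarrow> t \<le> T \<Longrightarrow> 0 < \<sigma> \<Longrightarrow> 0 < b \<Longrightarrow> b \<le> b0 \<Longrightarrow>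
      emeasure (angle_law \<eta> \<sigma> t) {s. \<bar>s\<bar> < b} \<le> ennreal (C * b powr (1 - max \<eta> 0))"
    using angle_law_small_arc[OF \<eta> T_pos] by metis
  have m: "0 < 1 - max \<eta> 0" using \<eta> by simp
  have "((\<lambda>c. arc_angle c powr (1 - max \<eta> 0)) \<longlongrightarrow> 0) (at_right 0)"
  proof (rule tendsto_zero_powrI[OF tendsto_arc_angle tendsto_const _ m])
    show "\<forall>\<^sub>F c in at_right 0. 0 \<le> arc_angle c"
      using eventually_at_right_less[of 0] by eventually_elim (use arc_angle_pos in \<open>auto intro: less_imp_le\<close>)
  qed
  then have "((\<lambda>c. C * arc_angle c powr (1 - max \<eta> 0)) \<longlongrightarrow> C * 0) (at_right 0)" by (intro tendsto_intros)
  then have lim: "((\<lambda>c. C * arc_angle c powr (1 - max \<eta> 0)) \<longlongrightarrow> 0) (at_right 0)" by simp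
  have ev_arc: "\<forall>\<^sub>F c in at_right 0. arc_angle c < b0" by (rule order_tendstoD(2)[OF tendsto_arc_angle C(2)])
  have ev_T: "\<forall>\<^sub>F c in at_right 0. c < T / 4" by (rule eventually_at_right_0_less) (use T_pos in simp)
  show "((\<lambda>c. SUP \<sigma>\<in>{0<..}. ?P c \<sigma>) \<longlongrightarrow> 0) (at_right 0)"
  proof (rule tendsto_sandwich[OF _ _ tendsto_const lim])
    show "\<forall>\<^sub>F c in at_right 0. 0 \<le> (SUP \<sigma>\<in>{0<..}. ?P c \<sigma>)"
      using eventually_at_right_less[of 0]
    proof eventually_elim
      case (elim c)
      have "bdd_above (?P c ` {0<..})"
      proof (rule bdd_aboveI2)
        fix \<sigma> :: real assume "\<sigma> \<in> {0<..}"
        then interpret markov_slit_model "M c \<sigma>" \<eta> c \<sigma> "\<theta> c \<sigma>" by (intro model[OF elim]) auto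
        show "?P c \<sigma> \<le> 1" by simp
      qed
      then show ?case by (rule cSUP_upper2[where x = 1]) auto
    qed
    show "\<forall>\<^sub>F c in at_right 0. (SUP \<sigma>\<in>{0<..}. ?P c \<sigma>) \<le> C * arc_angle c powr (1 - max \<eta> 0)"
      using eventually_at_right_less[of 0] ev_arc ev_T
    proof eventually_elim
      case (elim c)
      define n where "n = nat \<lfloor>T / c\<rfloor>"
      have n: "c * real n \<le> T" "T < c * real n + c"
        using nat_floor_divide_le[of c T] nat_floor_divide_gt[of c T] elim T_pos by (auto simp: n_def)
      have "2 \<le> n"
      proof (rule ccontr)
        assume "\<not> 2 \<le> n"
        then have "c * real n \<le> c * 1" using elim by (intro mult_left_mono) auto
        then show False using n(2) elim(1,3) by linarith
      qed
      then have n1: "c * real (n - 1) = c * real n - c" by (simp add: of_nat_diff right_diff_distrib)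
      show ?case
      proof (rule cSUP_least)
        fix \<sigma> :: real assume \<sigma>: "\<sigma> \<in> {0<..}"
        then interpret markov_slit_model "M c \<sigma>" \<eta> c \<sigma> "\<theta> c \<sigma>" by (intro model elim) auto
        have "emeasure (angle_law \<eta> \<sigma> (c * real (n - 1))) {s. \<bar>s\<bar> < arc_angle c} \<le> ennreal (C * arc_angle c powr (1 - max \<eta> 0))"
        proof (rule small)
          show "T / 2 \<le> c * real (n - 1)" "c * real (n - 1) \<le> T" unfolding n1 using n elim(1,3) by linarith+
        qed (use elim \<sigma> arc_angle_pos[of c] in auto)
        then show "?P c \<sigma> \<le> C * arc_angle c powr (1 - max \<eta> 0)"
          unfolding n_def[symmetric] using C by (intro path_event_prob_le \<open>2 \<le> n\<close>) auto
      qed auto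
    qed
  qed
next
  fix \<gamma> r R :: real and \<sigma> :: "real \<Rightarrow> real"
  assume \<eta>: "1 < \<eta>" "(\<eta> + 1) / (2 * (\<eta> - 1)) < \<gamma>" and \<sigma>: "\<forall>c>0. 0 < \<sigma> c \<and> \<sigma> c < c powr \<gamma>" and r: "1 < (r::real)" "r < R"
  define q where "q = 1 - 1 / r\<^sup>2"
  have q: "0 < q" unfolding q_def by (rule q_pos[OF r(1) refl])
  let ?S = "\<lambda>c \<xi>. SUP t\<in>{0..T}. SUP z\<in>{z. r < norm z \<and> norm z < R}.
      ennreal (norm (cluster_map c \<xi> (nat \<lfloor>t / c\<rfloor>) z - rotated_slit_map t (\<xi> 1) z))"
  show "tendsto_zero_in_probability (\<lambda>c. M c (\<sigma> c))
     (\<lambda>c \<omega>. SUP t\<in>{0..T}. SUP z\<in>{z. r < norm z \<and> norm z < R}.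
        ennreal (norm (cluster_map c (\<lambda>i. \<theta> c (\<sigma> c) i \<omega>) (nat \<lfloor>t / c\<rfloor>) z
          - rotated_slit_map t (\<theta> c (\<sigma> c) 1 \<omega>) z))) (at_right 0)"
  proof (rule tendsto_zero_in_probability_if_near[where S = "?S" and \<theta> = "\<lambda>c. \<theta> c (\<sigma> c)", OF _ _ \<eta> T_pos])
    fix c :: real assume c: "0 < c"
    show "?S c \<in> borel_measurable borel"
      by (rule rotated_cluster_difference_measurable) (use c r in auto)
  next
    fix e :: real assume e: "0 < e"
    obtain \<epsilon> where \<epsilon>: "0 < \<epsilon>" and close:
      "\<And>c \<theta> t z. 0 < c \<Longrightarrow> c \<le> 1 \<Longrightarrow> angles_near \<epsilon> \<theta> (nat \<lfloor>T / c\<rfloor>) \<Longrightarrow> 0 \<le> t \<Longrightarrow> t \<le> T \<Longrightarrow> r \<le> norm z \<Longrightarrow>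
        norm (cluster_map c \<theta> (nat \<lfloor>t / c\<rfloor>) z - rotated_slit_map (c * real (nat \<lfloor>t / c\<rfloor>)) (\<theta> 1) z) \<le> e / 2"
      using cluster_map_error_eventually_small[OF r(1) T_pos, of "e / 2"] e by (metis half_gt_zero)
    define K where "K = 8 / q * (4 * exp T * R)"
    have K: "0 < K" using q r by (simp add: K_def)
    have "\<forall>\<^sub>F c in at_right 0. c < min 1 (e / (2 * K))"
      by (rule eventually_at_right_0_less) (use e K in simp)
    then have "\<forall>\<^sub>F c in at_right 0. \<forall>\<xi>. angles_near \<epsilon> \<xi> (nat \<lfloor>T / c\<rfloor>) \<longrightarrow>
        ?S c \<xi> \<le> ennreal e"
      using eventually_at_right_less[of 0]
    proof eventually_elim
      case (elim c)
      show ?case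
      proof (intro allI impI SUP_least ennreal_leI)
        fix \<xi> t and z :: complex assume near: "angles_near \<epsilon> \<xi> (nat \<lfloor>T / c\<rfloor>)" and t: "t \<in> {0..T}" and z: "z \<in> {z. r < norm z \<and> norm z < R}"
        define s where "s = c * real (nat \<lfloor>t / c\<rfloor>)"
        have s: "0 \<le> s" "s \<le> t" "t - s \<le> c"
          using nat_floor_divide_le[of c t] nat_floor_divide_gt[of c t] elim t by (auto simp: s_def)
        have "norm (rotated_slit_map t (\<xi> 1) z - rotated_slit_map s (\<xi> 1) z) \<le> 8 * (t - s) / q * (4 * exp s * norm z)"
          by (rule rotated_slit_map_time_diff[OF r(1) q_def]) (use s elim z in auto)
        also have "\<dots> \<le> 8 * c / q * (4 * exp T * R)"
          using s t z q elim by (intro mult_mono divide_right_mono) auto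
        also have "\<dots> = K * c" by (simp add: K_def)
        also have "\<dots> \<le> e / 2" using elim K by (simp add: field_simps)
        finally have "norm (rotated_slit_map t (\<xi> 1) z - rotated_slit_map s (\<xi> 1) z) \<le> e / 2" .
        moreover have "norm (cluster_map c \<xi> (nat \<lfloor>t / c\<rfloor>) z - rotated_slit_map s (\<xi> 1) z) \<le> e / 2"
          unfolding s_def by (rule close) (use elim near t z in auto)
        ultimately show "norm (cluster_map c \<xi> (nat \<lfloor>t / c\<rfloor>) z - rotated_slit_map t (\<xi> 1) z) \<le> e"
          using norm_triangle_ineq4[of "cluster_map c \<xi> (nat \<lfloor>t / c\<rfloor>) z - rotated_slit_map s (\<xi> 1) z"
              "rotated_slit_map t (\<xi> 1) z - rotated_slit_map s (\<xi> 1) z"] by simp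
      qed
    qed
    then show "\<exists>\<epsilon>>0. \<forall>\<^sub>F c in at_right 0. \<forall>\<xi>. angles_near \<epsilon> \<xi> (nat \<lfloor>T / c\<rfloor>) \<longrightarrow>
        ?S c \<xi> \<le> ennreal e"
      using \<epsilon> by blast
  next
    fix c :: real and \<xi> \<xi>' :: "nat \<Rightarrow> real" assume "\<And>i. 1 \<le> i \<Longrightarrow> \<xi> i = \<xi>' i"
    then have "\<xi> 1 = \<xi>' 1" "\<And>n z. cluster_map c \<xi> n z = cluster_map c \<xi>' n z" by (auto intro: cluster_map_cong)
    then show "?S c \<xi> =
        ?S c \<xi>'" by simp
  qed (use model \<sigma> in auto)
next
  fix \<gamma> r :: real and \<sigma> :: "real \<Rightarrow> real"
  assume \<eta>: "1 < \<eta>" "(\<eta> + 1) / (2 * (\<eta> - 1)) < \<gamma>" and \<sigma>: "\<forall>c>0. 0 < \<sigma> c \<and> \<sigma> c < c powr \<gamma>" and r: "1 < (r::real)"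
  let ?S = "\<lambda>c \<xi>. SUP t\<in>{0..T}. SUP z\<in>{z. r < norm z}.
      ennreal (norm (cluster_map c \<xi> (nat \<lfloor>t / c\<rfloor>) z - rotated_slit_map (c * real (nat \<lfloor>t / c\<rfloor>)) (\<xi> 1) z))"
  show "tendsto_zero_in_probability (\<lambda>c. M c (\<sigma> c))
     (\<lambda>c \<omega>. SUP t\<in>{0..T}. SUP z\<in>{z. r < norm z}.
        ennreal (norm (cluster_map c (\<lambda>i. \<theta> c (\<sigma> c) i \<omega>) (nat \<lfloor>t / c\<rfloor>) z
          - rotated_slit_map (c * real (nat \<lfloor>t / c\<rfloor>)) (\<theta> c (\<sigma> c) 1 \<omega>) z))) (at_right 0)"
  proof (rule tendsto_zero_in_probability_if_near[where S = "?S" and \<theta> = "\<lambda>c. \<theta> c (\<sigma> c)", OF _ _ \<eta> T_pos])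
    fix c :: real assume c: "0 < c"
    show "?S c \<in> borel_measurable borel"
      by (rule rotated_cluster_difference_measurable) (use c r in auto)
  next
    fix e :: real assume e: "0 < e"
    obtain \<epsilon> where \<epsilon>: "0 < \<epsilon>" and close:
      "\<And>c \<theta> t z. 0 < c \<Longrightarrow> c \<le> 1 \<Longrightarrow> angles_near \<epsilon> \<theta> (nat \<lfloor>T / c\<rfloor>) \<Longrightarrow> 0 \<le> t \<Longrightarrow> t \<le> T \<Longrightarrow> r \<le> norm z \<Longrightarrow>
        norm (cluster_map c \<theta> (nat \<lfloor>t / c\<rfloor>) z - rotated_slit_map (c * real (nat \<lfloor>t / c\<rfloor>)) (\<theta> 1) z) \<le> e"
      using cluster_map_error_eventually_small[OF r T_pos e] by metis
    have "\<forall>\<^sub>F c in at_right (0::real). c < 1" by (rule eventually_at_right_0_less) simp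
    then have "\<forall>\<^sub>F c in at_right 0. \<forall>\<xi>. angles_near \<epsilon> \<xi> (nat \<lfloor>T / c\<rfloor>) \<longrightarrow>
        ?S c \<xi> \<le> ennreal e"
      using eventually_at_right_less[of 0]
    proof eventually_elim
      case (elim c)
      show ?case by (intro allI impI SUP_least ennreal_leI close) (use elim in auto)
    qed
    then show "\<exists>\<epsilon>>0. \<forall>\<^sub>F c in at_right 0. \<forall>\<xi>. angles_near \<epsilon> \<xi> (nat \<lfloor>T / c\<rfloor>) \<longrightarrow>
        ?S c \<xi> \<le> ennreal e"
      using \<epsilon> by blast
  next
    fix c :: real and \<xi> \<xi>' :: "nat \<Rightarrow> real" assume "\<And>i. 1 \<le> i \<Longrightarrow> \<xi> i = \<xi>' i"
    then have "\<xi> 1 = \<xi>' 1" "\<And>n z. cluster_map c \<xi> n z = cluster_map c \<xi>' n z" by (auto intro: cluster_map_cong)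
    then show "?S c \<xi> =
        ?S c \<xi>'" by simp
  qed (use model \<sigma> in auto)
next
  fix \<gamma> t :: real and \<sigma> :: "real \<Rightarrow> real"
  assume \<eta>: "1 < \<eta>" "(\<eta> + 1) / (2 * (\<eta> - 1)) < \<gamma>" and \<sigma>: "\<forall>c>0. 0 < \<sigma> c \<and> \<sigma> c < c powr \<gamma>" and t: "t \<in> {0..T}"
  let ?S = "\<lambda>c \<xi>. hausdorff_dist (cluster c \<xi> (nat \<lfloor>t / c\<rfloor>)) (slit_disk t (\<xi> 1))"
  show "tendsto_zero_in_probability (\<lambda>c. M c (\<sigma> c))
     (\<lambda>c \<omega>. hausdorff_dist (cluster c (\<lambda>i. \<theta> c (\<sigma> c) i \<omega>) (nat \<lfloor>t / c\<rfloor>))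
        (slit_disk t (\<theta> c (\<sigma> c) 1 \<omega>))) (at_right 0)"
  proof (rule tendsto_zero_in_probability_if_near[where S = "?S"
        and \<theta> = "\<lambda>c. \<theta> c (\<sigma> c)", OF _ _ \<eta> T_pos])
    fix c :: real assume c: "0 < c"
    show "?S c \<in> borel_measurable borel"
      using c by (intro borel_measurable_hausdorff_dist_cluster) auto
  next
    fix e :: real assume e: "0 < e"
    have t0: "0 \<le> t" using t by simp
    obtain \<epsilon> c0 where \<epsilon>: "0 < \<epsilon>" "0 < c0" and close:
      "\<And>c \<theta>. 0 < c \<Longrightarrow> c < c0 \<Longrightarrow> angles_near \<epsilon> \<theta> (nat \<lfloor>t / c\<rfloor>) \<Longrightarrow>
        hausdorff_dist (cluster c \<theta> (nat \<lfloor>t / c\<rfloor>)) (slit_disk t (\<theta> 1)) \<le> ennreal e"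
      using hausdorff_error_eventually_small[OF t0 e] by metis
    have "\<forall>\<^sub>F c in at_right 0. c < c0" by (rule eventually_at_right_0_less[OF \<epsilon>(2)])
    then have "\<forall>\<^sub>F c in at_right 0. \<forall>\<xi>. angles_near \<epsilon> \<xi> (nat \<lfloor>T / c\<rfloor>) \<longrightarrow>
        ?S c \<xi> \<le> ennreal e"
      using eventually_at_right_less[of 0]
    proof eventually_elim
      case (elim c)
      have "nat \<lfloor>t / c\<rfloor> \<le> nat \<lfloor>T / c\<rfloor>" using t elim by (intro nat_mono floor_mono divide_right_mono) auto
      then show ?case using close elim angles_near_mono by blast
    qed
    then show "\<exists>\<epsilon>>0. \<forall>\<^sub>F c in at_right 0. \<forall>\<xi>. angles_near \<epsilon> \<xi> (nat \<lfloor>T / c\<rfloor>) \<longrightarrow>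
        ?S c \<xi> \<le> ennreal e"
      using \<epsilon> by blast
  next
    fix c :: real and \<xi> \<xi>' :: "nat \<Rightarrow> real" assume "\<And>i. 1 \<le> i \<Longrightarrow> \<xi> i = \<xi>' i"
    then have "\<xi> 1 = \<xi>' 1" "\<And>n z. cluster_map c \<xi> n z = cluster_map c \<xi>' n z" by (auto intro: cluster_map_cong)
    then show "?S c \<xi> =
        ?S c \<xi>'" by (simp add: cluster_def)
  qed (use model \<sigma> in auto)
qed

end
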